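(* Assume that the kernel $K:\mathbb{R}^N\setminus\{0\}\to(0,+\infty)$ satisfies $\int_{\mathbb{R}^N}\min\{|x|^2,1\}K(x)\,dx<+\infty$ and the monotonicity condition $K(x)\ge K(y)$ whenever $|x|\le|y|$, and that $$s_0=\sup\Big\{s\ge0\ \Big|\ \lim_{r\to0^+}r^{2s}\int_{B_r^c(0)}K(y)\,dy=+\infty\Big\}\in(0,1].$$ Let $2^*(s_0)=\frac{2N}{N-2s_0}$ and $l_\infty=\liminf_{r\to0^+}r^{2s_0}\int_{B_r^c(0)}K(y)\,dy\in[0,\infty]$. Then $(X_0,\|\cdot\|_X)$ is a Hilbert space and: $(i)$ if $l_\infty=0$, the embedding $X_0\hookrightarrow L^q(\Omega)$ is continuous and compact for $q\in[1,2^*(s_0))$; moreover, for $q\in[1,2^*(s_0))$ there exists $C>0$ such that $\|g\|_{L^q(\Omega)}\le C\|g\|_X$ for all $g\in X_0$; $(ii)$ if $l_\infty\in(0,\infty]$, the embedding $X_0\hookrightarrow L^q(\Omega)$ is continuous for $q\in[1,2^*(s_0)]$ and compact for $q\in[1,2^*(s_0))$; and for $q\in[1,2^*(s_0)]$ there exists $C>0$ such that $\|g\|_{L^q(\Omega)}\le C\|g\|_X$ for all $g\in X_0$.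
   Context: $N\ge2$ and $\Omega\subset\mathbb{R}^N$ is an open bounded $C^2$ domain, $\Omega^c=\mathbb{R}^N\setminus\Omega$, $\mathcal{O}=\Omega^c\times\Omega^c$. $K$ is measurable. $B_r(0)$ is the ball of radius $r$ centered at the origin and $B_r^c(0)$ its complement in $\mathbb{R}^N$. $X$ is the linear space of Lebesgue measurable functions $g:\mathbb{R}^N\to\mathbb{R}$ (identified when equal a.e.) such that $g|_\Omega\in L^2(\Omega)$ and $\int_{\mathbb{R}^{2N}\setminus\mathcal{O}}(g(x)-g(y))^2K(x-y)\,dx\,dy<+\infty$, with norm $$\|g\|_X=\Big(\|g\|_{L^2(\Omega)}^2+\int_{\mathbb{R}^{2N}\setminus\mathcal{O}}(g(x)-g(y))^2K(x-y)\,dx\,dy\Big)^{1/2}.$$ $X_0=\{g\in X\mid g=0\text{ a.e. in }\Omega^c\}$, equipped with the norm $\|\cdot\|_X$ (and the associated inner product). Convention: $2^*(s_0)=+\infty$ when $N=2$ and $s_0=1$. *)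

theory Defs
  imports "HOL-Analysis.Analysis"
begin

section \<open>Domains of class $C^2$\<close>

definition C2_fun :: "('a::real_normed_vector \<Rightarrow> real) \<Rightarrow> bool" where
  "C2_fun f \<longleftrightarrow>
     (\<exists>(f' :: 'a \<Rightarrow> 'a \<Rightarrow>\<^sub>L real) (f'' :: 'a \<Rightarrow> 'a \<Rightarrow>\<^sub>L 'a \<Rightarrow>\<^sub>L real).
        (\<forall>x. (f has_derivative blinfun_apply (f' x)) (at x)) \<and>
        (\<forall>x. (f' has_derivative blinfun_apply (f'' x)) (at x)) \<and>
        continuous_on UNIV f'')"

text \<open>
  Near each boundary point the set is the part of a ball lying above the graph of a $C^2$ function,
  in suitable orthonormal coordinates. The unit vector \<open>\<nu>\<close> is the vertical direction of these
  coordinates and \<open>x - (x \<bullet> \<nu>) *\<^sub>R \<nu>\<close> is the horizontal part of \<open>x\<close>, so only the values of \<open>\<gamma>\<close> on the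
  hyperplane orthogonal to \<open>\<nu>\<close> matter; a $C^2$ function on the hyperplane extends to the whole
  space by composing it with the orthogonal projection.
\<close>

definition C2_boundary :: "'a::euclidean_space set \<Rightarrow> bool" where
  "C2_boundary \<Omega> \<longleftrightarrow>
     (\<forall>p \<in> frontier \<Omega>. \<exists>r>0. \<exists>\<nu> \<gamma>. norm \<nu> = 1 \<and> C2_fun \<gamma> \<and>
        \<Omega> \<inter> ball p r = {x \<in> ball p r. x \<bullet> \<nu> > \<gamma> (x - (x \<bullet> \<nu>) *\<^sub>R \<nu>)})"

definition bounded_C2_domain :: "'a::euclidean_space set \<Rightarrow> bool" where
  "bounded_C2_domain \<Omega> \<longleftrightarrow>
     open \<Omega> \<and> connected \<Omega> \<and> \<Omega> \<noteq> {} \<and> bounded \<Omega> \<and> C2_boundary \<Omega>"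


section \<open>The order of singularity of a kernel\<close>

text \<open>
  Kernels are defined on the punctured space. They are represented by total functions, whose value
  at the origin never matters.
\<close>

definition kernel_tail :: "('a::euclidean_space \<Rightarrow> real) \<Rightarrow> real \<Rightarrow> ennreal" where
  "kernel_tail K r = (\<integral>\<^sup>+y\<in>- ball 0 r. ennreal (K y) \<partial>lebesgue)"

definition scaled_tail :: "('a::euclidean_space \<Rightarrow> real) \<Rightarrow> real \<Rightarrow> real \<Rightarrow> ennreal" where
  "scaled_tail K s r = ennreal (r powr (2 * s)) * kernel_tail K r"

text \<open>
  The supremum is taken in the extended reals, so that it is \<open>-\<infinity>\<close>, and not an unspecified real,
  if the set is empty.
\<close>

definition kernel_order :: "('a::euclidean_space \<Rightarrow> real) \<Rightarrow> ereal" where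
  "kernel_order K =
     Sup (ereal ` {s. s \<ge> 0 \<and> (scaled_tail K s \<longlongrightarrow> \<infinity>) (at_right 0)})"

definition critical_exponent :: "nat \<Rightarrow> real \<Rightarrow> ereal" where
  "critical_exponent N s =
     (if real N = 2 * s then \<infinity> else ereal (2 * real N / (real N - 2 * s)))"


section \<open>The spaces $X$ and $X_0$\<close>

text \<open>
  Elements of function spaces are represented by functions on the whole space; the identification
  of functions that are equal almost everywhere is built into the predicates below that speak about
  these spaces.
\<close>

definition nonlocal_region :: "'a set \<Rightarrow> ('a \<times> 'a) set" where
  "nonlocal_region \<Omega> = - ((- \<Omega>) \<times> (- \<Omega>))"

definition space_X :: "'a::euclidean_space set \<Rightarrow> ('a \<Rightarrow> real) \<Rightarrow> ('a \<Rightarrow> real) set" where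
  "space_X \<Omega> K = {g. g \<in> borel_measurable lebesgue \<and>
     set_integrable lebesgue \<Omega> (\<lambda>x. (g x)\<^sup>2) \<and>
     set_integrable lebesgue (nonlocal_region \<Omega>) (\<lambda>(x, y). (g x - g y)\<^sup>2 * K (x - y))}"

definition space_X0 :: "'a::euclidean_space set \<Rightarrow> ('a \<Rightarrow> real) \<Rightarrow> ('a \<Rightarrow> real) set" where
  "space_X0 \<Omega> K = {g \<in> space_X \<Omega> K. AE x in lebesgue. x \<in> - \<Omega> \<longrightarrow> g x = 0}"

definition norm_X :: "'a::euclidean_space set \<Rightarrow> ('a \<Rightarrow> real) \<Rightarrow> ('a \<Rightarrow> real) \<Rightarrow> real" where
  "norm_X \<Omega> K g = sqrt
     ((LINT x:\<Omega>|lebesgue. (g x)\<^sup>2) +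
      (LINT (x, y):nonlocal_region \<Omega>|lebesgue. (g x - g y)\<^sup>2 * K (x - y)))"

definition inner_X ::
  "'a::euclidean_space set \<Rightarrow> ('a \<Rightarrow> real) \<Rightarrow> ('a \<Rightarrow> real) \<Rightarrow> ('a \<Rightarrow> real) \<Rightarrow> real" where
  "inner_X \<Omega> K f g =
      (LINT x:\<Omega>|lebesgue. f x * g x) +
      (LINT (x, y):nonlocal_region \<Omega>|lebesgue. (f x - f y) * (g x - g y) * K (x - y))"

text \<open>
  The quotient of the function space \<open>V\<close> by equality almost everywhere is a real Hilbert space with
  inner product \<open>ip\<close> and norm \<open>nrm\<close>. That \<open>ip\<close> is compatible with the quotient follows from the
  Cauchy--Schwarz inequality, as the functions of norm zero are exactly the null functions.
\<close>

definition hilbert_space_mod_AE ::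
  "('a::euclidean_space \<Rightarrow> real) set \<Rightarrow> (('a \<Rightarrow> real) \<Rightarrow> ('a \<Rightarrow> real) \<Rightarrow> real)
     \<Rightarrow> (('a \<Rightarrow> real) \<Rightarrow> real) \<Rightarrow> bool" where
  "hilbert_space_mod_AE V ip nrm \<longleftrightarrow>
     (\<lambda>x. 0) \<in> V \<and>
     (\<forall>f\<in>V. \<forall>g\<in>V. (\<lambda>x. f x + g x) \<in> V) \<and>
     (\<forall>c. \<forall>f\<in>V. (\<lambda>x. c * f x) \<in> V) \<and>
     (\<forall>f\<in>V. \<forall>g\<in>V. ip f g = ip g f) \<and>
     (\<forall>f\<in>V. \<forall>g\<in>V. \<forall>h\<in>V. ip (\<lambda>x. f x + g x) h = ip f h + ip g h) \<and>
     (\<forall>c. \<forall>f\<in>V. \<forall>g\<in>V. ip (\<lambda>x. c * f x) g = c * ip f g) \<and>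
     (\<forall>f\<in>V. ip f f \<ge> 0) \<and>
     (\<forall>f\<in>V. ip f f = 0 \<longleftrightarrow> (AE x in lebesgue. f x = 0)) \<and>
     (\<forall>f\<in>V. nrm f = sqrt (ip f f)) \<and>
     (\<forall>u :: nat \<Rightarrow> 'a \<Rightarrow> real.
        (\<forall>n. u n \<in> V) \<and>
        (\<forall>e>0. \<exists>M. \<forall>m\<ge>M. \<forall>n\<ge>M. nrm (\<lambda>x. u m x - u n x) < e) \<longrightarrow>
        (\<exists>g\<in>V. (\<lambda>n. nrm (\<lambda>x. u n x - g x)) \<longlonglongrightarrow> 0))"


section \<open>Lebesgue spaces and embeddings\<close>

definition space_L :: "ereal \<Rightarrow> 'a::euclidean_space set \<Rightarrow> ('a \<Rightarrow> real) set" where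
  "space_L q \<Omega> = {f. set_borel_measurable lebesgue \<Omega> f \<and>
     (if q = \<infinity> then \<exists>C. AE x in lebesgue. x \<in> \<Omega> \<longrightarrow> \<bar>f x\<bar> \<le> C
      else set_integrable lebesgue \<Omega> (\<lambda>x. \<bar>f x\<bar> powr real_of_ereal q))}"

definition norm_L :: "ereal \<Rightarrow> 'a::euclidean_space set \<Rightarrow> ('a \<Rightarrow> real) \<Rightarrow> real" where
  "norm_L q \<Omega> f =
     (if q = \<infinity> then Inf {C. C \<ge> 0 \<and> (AE x in lebesgue. x \<in> \<Omega> \<longrightarrow> \<bar>f x\<bar> \<le> C)}
      else (LINT x:\<Omega>|lebesgue. \<bar>f x\<bar> powr real_of_ereal q) powr (1 / real_of_ereal q))"

text \<open>
  The embedding is the restriction map from \<open>V\<close> to \<open>\<Omega>\<close>. It has to take values in $L^q(\Omega)$ and be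
  injective up to equality almost everywhere.
\<close>

definition embeds_L :: "('a::euclidean_space \<Rightarrow> real) set \<Rightarrow> ereal \<Rightarrow> 'a set \<Rightarrow> bool" where
  "embeds_L V q \<Omega> \<longleftrightarrow> V \<subseteq> space_L q \<Omega> \<and>
     (\<forall>f\<in>V. \<forall>g\<in>V. (AE x in lebesgue. x \<in> \<Omega> \<longrightarrow> f x = g x) \<longrightarrow> (AE x in lebesgue. f x = g x))"

definition continuous_embedding_L ::
  "('a::euclidean_space \<Rightarrow> real) set \<Rightarrow> (('a \<Rightarrow> real) \<Rightarrow> real) \<Rightarrow> ereal \<Rightarrow> 'a set \<Rightarrow> bool" where
  "continuous_embedding_L V nrm q \<Omega> \<longleftrightarrow> embeds_L V q \<Omega> \<and>
     (\<forall>g\<in>V. \<forall>e>0. \<exists>d>0. \<forall>h\<in>V.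
        nrm (\<lambda>x. h x - g x) < d \<longrightarrow> norm_L q \<Omega> (\<lambda>x. h x - g x) < e)"

definition compact_embedding_L ::
  "('a::euclidean_space \<Rightarrow> real) set \<Rightarrow> (('a \<Rightarrow> real) \<Rightarrow> real) \<Rightarrow> ereal \<Rightarrow> 'a set \<Rightarrow> bool" where
  "compact_embedding_L V nrm q \<Omega> \<longleftrightarrow> embeds_L V q \<Omega> \<and>
     (\<forall>u :: nat \<Rightarrow> 'a \<Rightarrow> real.
        (\<forall>n. u n \<in> V) \<and> (\<exists>B. \<forall>n. nrm (u n) \<le> B) \<longrightarrow>
        (\<exists>f \<in> space_L q \<Omega>. \<exists>\<phi> :: nat \<Rightarrow> nat. strict_mono \<phi> \<and>
           (\<lambda>n. norm_L q \<Omega> (\<lambda>x. u (\<phi> n) x - f x)) \<longlonglongrightarrow> 0))"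

end

theory Submission
  imports Defs "HOL-Complex_Analysis.Great_Picard"
begin

text \<open>
  By monotonicity the kernel is radial, and since functions in $X_0$ vanish outside \<open>\<Omega>\<close>, the square
  of the norm is the integral of $g^2$ over the whole space plus the energy, the integral of
  $(g(x)-g(y))^2K(x-y)$ over the whole product space. With \<open>N\<close> the dimension, the proof has three
  parts.

  \<^item> Completeness. A Cauchy sequence has a subsequence that converges almost everywhere, and Fatou's
    lemma, applied to $u_n-u_m$ as \<open>m\<close> runs through the subsequence, shows that its limit is the limit
    in norm (\<open>hilbert_space_X0\<close>).

  \<^item> Continuity. The definition of $s_0$ gives $\int_{B_r^c(0)}K\ge c\,r^{-2s}$ for small \<open>r\<close>, for each
    $s<s_0$, and for $s=s_0$ if $l_\infty>0$. Let $a_k$ be the measure of $A_k=\{|g|>2^k\}$. Among sets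
    of given measure a centred ball leaves the least mass of the kernel outside, so each
    $x\in A_{k+1}$ has $\int_{A_k^c}K(x-y)\,dy\ge c'a_k^{-\theta}$ with $\theta=2s/N$. As
    $|g(x)-g(y)|\ge 2^k$ for $x\in A_{k+1}$ and $y\notin A_k$, and as only the largest such \<open>k\<close>
    matters up to a factor, the sum of $4^ka_{k+1}a_k^{-\theta}$ is bounded by the energy. Young's
    inequality turns this into a bound of $\sum_k 4^ka_k^{1-\theta}$, and hence of
    $\int_\Omega|g|^q$ with $q=2/(1-\theta)=2N/(N-2s)$ (\<open>sobolev_inequality\<close>). In the case $l_\infty>0$ one
    has $s_0<1$, since $r^2\int_{B_r^c(0)}K\to0$; so the critical exponent is finite whenever it has to
    be attained.

  \<^item> Compactness. The growth of the tails also forces $t^N K(z)$, for $0<|z|\le t$, to be arbitrarily large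
    for suitable \<open>t\<close>. On a partition into cubes of diameter at most \<open>t\<close> the mean oscillation of \<open>g\<close> is
    then a small multiple of its energy, so in $L^2$ a function of bounded norm is described, up to a small
    error, by finitely many mean values. A diagonal argument yields a subsequence that is Cauchy in
    $L^2$ (\<open>L2_Cauchy_subsequence\<close>), and interpolation with the bound for a slightly larger
    exponent makes it converge in $L^q$.
\<close>

section \<open>Null sets and measurability on the product space\<close>

lemma null_sets_vimage_fst_snd:
  fixes A :: "'a::euclidean_space set"
  assumes "A \<in> null_sets lborel"
  shows "fst -` A \<in> null_sets (lborel :: ('a \<times> 'b::euclidean_space) measure)"
    and "snd -` A \<in> null_sets (lborel :: ('b \<times> 'a) measure)"
proof -
  have "A \<times> UNIV \<in> null_sets (lborel \<Otimes>\<^sub>M (lborel :: 'b measure))"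
    using assms lborel.times_in_null_sets1[of A lborel UNIV] by auto
  moreover have "fst -` A = A \<times> (UNIV :: 'b set)" by auto
  ultimately show "fst -` A \<in> null_sets (lborel :: ('a \<times> 'b) measure)"
    by (simp add: lborel_prod)
  have "UNIV \<times> A \<in> null_sets ((lborel :: 'b measure) \<Otimes>\<^sub>M lborel)"
    using assms lborel.times_in_null_sets2[of A lborel UNIV] by auto
  moreover have "snd -` A = (UNIV :: 'b set) \<times> A" by auto
  ultimately show "snd -` A \<in> null_sets (lborel :: ('b \<times> 'a) measure)"
    by (simp add: lborel_prod)
qed

lemma measurable_lebesgue_fst_snd [measurable]:
  "fst \<in> (lebesgue :: ('a::euclidean_space \<times> 'b::euclidean_space) measure) \<rightarrow>\<^sub>M lebesgue"
  "snd \<in> (lebesgue :: ('a::euclidean_space \<times> 'b::euclidean_space) measure) \<rightarrow>\<^sub>M lebesgue"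
proof -
  have "(fst :: 'a \<times> 'b \<Rightarrow> 'a) \<in> lebesgue \<rightarrow>\<^sub>M lborel" "(snd :: 'a \<times> 'b \<Rightarrow> 'b) \<in> lebesgue \<rightarrow>\<^sub>M lborel"
    by (auto simp: borel_prod[symmetric] intro!: measurable_completion)
  moreover from this have
    "null_sets lborel \<subseteq> null_sets (distr lebesgue lborel (fst :: 'a \<times> 'b \<Rightarrow> 'a))"
    "null_sets lborel \<subseteq> null_sets (distr lebesgue lborel (snd :: 'a \<times> 'b \<Rightarrow> 'b))"
    by (auto simp: null_sets_distr_iff null_sets_vimage_fst_snd null_sets_completionI
        dest: null_setsD2[of _ lborel, unfolded sets_lborel])
  ultimately show 
    "(fst :: 'a \<times> 'b \<Rightarrow> 'a) \<in> lebesgue \<rightarrow>\<^sub>M lebesgue" "(snd :: 'a \<times> 'b \<Rightarrow> 'b) \<in> lebesgue \<rightarrow>\<^sub>M lebesgue"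
    by (simp_all add: completion.measurable_completion2)
qed

lemma AE_lebesgue_fst_snd:
  assumes "AE x in (lebesgue :: 'a::euclidean_space measure). P x"
  shows "AE p in (lebesgue :: ('a \<times> 'a) measure). P (fst p) \<and> P (snd p)"
proof -
  from assms have "AE x in (lborel :: 'a measure). P x"
    by (simp add: AE_completion_iff)
  then obtain A where A: "{x. \<not> P x} \<subseteq> A" "A \<in> null_sets (lborel :: 'a measure)"
    by (auto simp: eventually_ae_filter)
  have "fst -` A \<union> snd -` A \<in> null_sets (lborel :: ('a \<times> 'a) measure)"
    using A by (intro null_sets.Un null_sets_vimage_fst_snd)
  then have "AE p in (lborel :: ('a \<times> 'a) measure). p \<notin> fst -` A \<union> snd -` A"
    by (rule AE_not_in)
  then have "AE p in (lborel :: ('a \<times> 'a) measure). P (fst p) \<and> P (snd p)"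
    by eventually_elim (use A in auto)
  then show ?thesis by (rule AE_completion)
qed

text \<open>A measurable function vanishing almost everywhere outside an open set has a Borel representative
  that vanishes everywhere outside it. This allows iterated integration of its increments.\<close>

lemma ex_borel_representative:
  fixes g :: "'a::euclidean_space \<Rightarrow> real"
  assumes "g \<in> borel_measurable lebesgue" "open \<Omega>"
    "AE x in lebesgue. x \<in> - \<Omega> \<longrightarrow> g x = 0"
  obtains g' where "g' \<in> borel_measurable borel" "AE x in lebesgue. g x = g' x"
    "\<And>x. x \<notin> \<Omega> \<Longrightarrow> g' x = 0"
proof -
  from completion_ex_borel_measurable_real[OF assms(1)] obtain h
    where h: "h \<in> borel_measurable lborel" "AE x in lborel. g x = h x" by auto
  have m: "h \<in> borel_measurable borel" using h(1) by simp
  show thesis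
  proof (rule that[of "\<lambda>x. indicator \<Omega> x * h x"])
    show "(\<lambda>x. indicator \<Omega> x * h x) \<in> borel_measurable borel"
      using m \<open>open \<Omega>\<close> by (intro borel_measurable_times borel_measurable_indicator) auto
    show "AE x in lebesgue. g x = indicator \<Omega> x * h x"
      using AE_completion[OF h(2)] assms(3)
      by eventually_elim (auto simp: indicator_def)
  qed auto
qed

lemma nn_integral_lebesgue_iterated:
  fixes F :: "'a::euclidean_space \<times> 'b::euclidean_space \<Rightarrow> ennreal"
  assumes "F \<in> borel_measurable borel"
  shows "(\<integral>\<^sup>+p. F p \<partial>lebesgue) = (\<integral>\<^sup>+x. \<integral>\<^sup>+y. F (x, y) \<partial>lborel \<partial>lborel)"
proof -
  have "F \<in> borel_measurable (lborel \<Otimes>\<^sub>M lborel)"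
    using assms by (simp add: lborel_prod)
  from lborel.nn_integral_fst[OF this] show ?thesis
    by (simp add: nn_integral_completion lborel_prod)
qed

section \<open>Square-integrable functions\<close>

lemma integrable_weighted_product:
  fixes f g w :: "'a \<Rightarrow> real"
  assumes [measurable]: "f \<in> borel_measurable M" "g \<in> borel_measurable M" "w \<in> borel_measurable M"
    and w: "\<And>x. w x \<ge> 0"
    and fg: "integrable M (\<lambda>x. (f x)\<^sup>2 * w x)" "integrable M (\<lambda>x. (g x)\<^sup>2 * w x)"
  shows "integrable M (\<lambda>x. f x * g x * w x)"
proof (rule Bochner_Integration.integrable_bound[OF Bochner_Integration.integrable_add[OF fg]])
  have "\<bar>a * b\<bar> \<le> a\<^sup>2 + b\<^sup>2" for a b :: real
  proof -
    have "0 \<le> (\<bar>a\<bar> - \<bar>b\<bar>)\<^sup>2 + \<bar>a\<bar>\<^sup>2 + \<bar>b\<bar>\<^sup>2" by simp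
    then show ?thesis by (simp add: power2_diff abs_mult)
  qed
  then show "AE x in M. norm (f x * g x * w x) \<le> norm ((f x)\<^sup>2 * w x + (g x)\<^sup>2 * w x)"
    using w by (auto simp: abs_mult simp flip: distrib_right intro!: AE_I2 mult_right_mono order_trans[OF _ abs_ge_self])
qed measurable

text \<open>The standard argument for the completeness of $L^2$: along a subsequence the increments are summable
  almost everywhere.\<close>

lemma AE_convergent_subseq_of_L2_Cauchy:
  fixes f :: "nat \<Rightarrow> 'a \<Rightarrow> real"
  assumes [measurable]: "\<And>n. f n \<in> borel_measurable M"
    and Cauchy: "\<And>e. e > 0 \<Longrightarrow>
      \<exists>N. \<forall>m\<ge>N. \<forall>n\<ge>N. (\<integral>\<^sup>+x. ennreal ((f m x - f n x)\<^sup>2) \<partial>M) < ennreal e"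
  obtains r :: "nat \<Rightarrow> nat" and g where "strict_mono r" "g \<in> borel_measurable M"
    "AE x in M. (\<lambda>k. f (r k) x) \<longlonglongrightarrow> g x"
proof -
  have "\<forall>k. \<exists>N. \<forall>m\<ge>N. \<forall>n\<ge>N. (\<integral>\<^sup>+x. ennreal ((f m x - f n x)\<^sup>2) \<partial>M) < ennreal ((1/8)^k)"
    by (intro allI Cauchy) simp
  then obtain N where N: "\<And>k m n. m \<ge> N k \<Longrightarrow> n \<ge> N k \<Longrightarrow>
      (\<integral>\<^sup>+x. ennreal ((f m x - f n x)\<^sup>2) \<partial>M) < ennreal ((1/8)^k)"
    by metis
  define r where "r k = (\<Sum>i\<le>k. N i) + k" for k
  have r: "strict_mono r" unfolding r_def strict_mono_Suc_iff by auto
  have rN: "r k \<ge> N k" for k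
    unfolding r_def by (meson finite_atMost atMost_iff le_refl member_le_sum trans_le_add1 zero_le)
  define d where "d k x = f (r (Suc k)) x - f (r k) x" for k x
  have [measurable]: "d k \<in> borel_measurable M" for k unfolding d_def by measurable
  have int: "(\<integral>\<^sup>+x. ennreal ((d k x)\<^sup>2) \<partial>M) \<le> ennreal ((1/8)^k)" for k
  proof -
    have "r (Suc k) \<ge> N k"
      using rN[of k] strict_mono_less_eq[OF r, of k "Suc k"] by linarith
    then show ?thesis unfolding d_def using N rN less_imp_le by blast
  qed
  have "(\<integral>\<^sup>+x. (\<Sum>k. ennreal (4^k * (d k x)\<^sup>2)) \<partial>M) = (\<Sum>k. \<integral>\<^sup>+x. ennreal (4^k * (d k x)\<^sup>2) \<partial>M)"
    by (rule nn_integral_suminf) measurable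
  also have "\<dots> = (\<Sum>k. ennreal (4^k) * (\<integral>\<^sup>+x. ennreal ((d k x)\<^sup>2) \<partial>M))"
    by (subst nn_integral_cmult[symmetric]) (auto simp: ennreal_mult)
  also have "\<dots> \<le> (\<Sum>k. ennreal (4^k) * ennreal ((1/8)^k))"
    by (intro suminf_le mult_left_mono int) auto
  also have "\<dots> = (\<Sum>k. ennreal ((1/2)^k))"
    by (simp add: ennreal_mult[symmetric] power_mult_distrib[symmetric])
  also have "\<dots> = ennreal (\<Sum>k. (1/2)^k)"
    by (intro suminf_ennreal2) auto
  also have "\<dots> < \<infinity>" by simp
  finally have "AE x in M. (\<Sum>k. ennreal (4^k * (d k x)\<^sup>2)) \<noteq> \<infinity>"
    by (intro nn_integral_noteq_infinite) auto
  then have conv: "AE x in M. convergent (\<lambda>k. f (r k) x)"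
  proof eventually_elim
    case (elim x)
    define c where "c = enn2real (\<Sum>k. ennreal (4^k * (d k x)\<^sup>2))"
    have c: "c \<ge> 0" "(\<Sum>k. ennreal (4^k * (d k x)\<^sup>2)) = ennreal c"
      using elim unfolding c_def by (simp_all add: top.not_eq_extremum del: suminf_eq_zero_iff)
    have "\<bar>d k x\<bar> \<le> sqrt c * (1/2)^k" for k
    proof -
      have "ennreal (4^k * (d k x)\<^sup>2) = (\<Sum>i\<in>{k}. ennreal (4^i * (d i x)\<^sup>2))" by simp
      also have "\<dots> \<le> ennreal c" unfolding c(2)[symmetric] by (intro sum_le_suminf) auto
      finally have "4^k * (d k x)\<^sup>2 \<le> c" using c(1) by simp
      then have "(2^k * \<bar>d k x\<bar>)\<^sup>2 \<le> c"
        by (simp add: power2_eq_square mult_ac flip: power_mult_distrib)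
      then have "2^k * \<bar>d k x\<bar> \<le> sqrt c" by (rule real_le_rsqrt)
      then show ?thesis by (simp add: field_simps power_divide)
    qed
    then have "summable (\<lambda>k. d k x)"
      by (intro summable_comparison_test'[of "\<lambda>k. sqrt c * (1/2)^k" 0 "\<lambda>k. d k x"]
          summable_mult summable_geometric) auto
    then have "convergent (\<lambda>n. \<Sum>k<n. d k x)" by (simp add: summable_iff_convergent)
    moreover have "(\<lambda>n. \<Sum>k<n. d k x) = (\<lambda>n. f (r n) x - f (r 0) x)"
      unfolding d_def by (intro ext sum_lessThan_telescope)
    ultimately have "convergent (\<lambda>n. f (r n) x - f (r 0) x)"
      by (simp only:)
    then obtain L where "(\<lambda>n. f (r n) x - f (r 0) x) \<longlonglongrightarrow> L"
      unfolding convergent_def by blast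
    then have "(\<lambda>n. (f (r n) x - f (r 0) x) + f (r 0) x) \<longlonglongrightarrow> L + f (r 0) x"
      by (rule tendsto_add[OF _ tendsto_const])
    then have "(\<lambda>n. f (r n) x) \<longlonglongrightarrow> L + f (r 0) x"
      by simp
    then show ?case
      by (rule convergentI)
  qed
  show thesis
  proof (rule that[OF r, of "\<lambda>x. lim (\<lambda>k. f (r k) x)"])
    show "(\<lambda>x. lim (\<lambda>k. f (r k) x)) \<in> borel_measurable M" by measurable
    show "AE x in M. (\<lambda>k. f (r k) x) \<longlonglongrightarrow> lim (\<lambda>k. f (r k) x)"
      using conv by eventually_elim (simp add: convergent_LIMSEQ_iff)
  qed
qed

lemma liminf_add_le_ennreal:
  fixes a b :: "nat \<Rightarrow> ennreal"
  assumes "\<And>n. a n + b n \<le> c"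
  shows "liminf a + liminf b \<le> c"
proof -
  have "incseq (\<lambda>n. INF m\<in>{n..}. a m)" "incseq (\<lambda>n. INF m\<in>{n..}. b m)"
    by (auto simp: incseq_def intro!: INF_superset_mono)
  then have "liminf a + liminf b = (SUP n. (INF m\<in>{n..}. a m) + (INF m\<in>{n..}. b m))"
    by (simp add: liminf_SUP_INF ennreal_SUP_add)
  also have "\<dots> \<le> c"
  proof (rule SUP_least)
    fix n
    have "(INF m\<in>{n..}. a m) + (INF m\<in>{n..}. b m) \<le> a n + b n"
      by (intro add_mono INF_lower) auto
    then show "(INF m\<in>{n..}. a m) + (INF m\<in>{n..}. b m) \<le> c"
      using assms[of n] by (rule order_trans)
  qed
  finally show ?thesis .
qed

section \<open>The space as a space of functions on the whole space\<close>

text \<open>A positive kernel that decreases with the norm, with the convention that it is zero at the origin.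
  It is radial, hence Borel measurable; its singularity at the origin is that of a Levy kernel.\<close>

locale radial_kernel =
  fixes K :: "'a::euclidean_space \<Rightarrow> real"
  assumes K_zero: "K 0 = 0"
    and K_pos: "\<And>x. x \<noteq> 0 \<Longrightarrow> K x > 0"
    and K_antimono: "\<And>x y. x \<noteq> 0 \<Longrightarrow> y \<noteq> 0 \<Longrightarrow> norm x \<le> norm y \<Longrightarrow> K x \<ge> K y"
    and K_integrable: "integrable lebesgue (\<lambda>x. min ((norm x)\<^sup>2) 1 * K x)"
begin

lemma K_nonneg [simp]: "K x \<ge> 0"
  using K_pos[of x] K_zero by (cases "x = 0") auto

lemma K_eqI: "norm x = norm y \<Longrightarrow> K x = K y"
  using K_antimono[of x y] K_antimono[of y x] by (cases "x = 0"; cases "y = 0") auto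

lemma K_borel [measurable]: "K \<in> borel_measurable borel"
proof -
  obtain e :: 'a where e: "e \<in> Basis" using nonempty_Basis by blast
  define k where "k t = (if t \<le> 0 then 0 else - K (t *\<^sub>R e))" for t
  have "k \<in> borel_measurable borel"
  proof (rule borel_measurable_piecewise_mono[of "{{..0}, {0<..}}"])
    show "mono_on c k" if "c \<in> {{..0}, {0<..}}" for c
      using that e nonzero_Basis[OF e] by (auto simp: k_def mono_on_def intro!: K_antimono)
  qed auto
  then have "(\<lambda>x. - k (norm x)) \<in> borel_measurable borel"
    by measurable
  moreover have "(\<lambda>x. - k (norm x)) = K"
    using e K_zero K_eqI[of "norm x *\<^sub>R e" x for x] by (auto simp: k_def fun_eq_iff)
  ultimately show ?thesis by metis
qed

text \<open>The kernel \<open>K (x - y)\<close> as a function on the product space.\<close>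

definition diff_kernel :: "'a \<times> 'a \<Rightarrow> real" where
  "diff_kernel p = K (fst p - snd p)"

lemma diff_kernel_borel: "diff_kernel \<in> borel_measurable borel"
proof -
  have "(\<lambda>p :: 'a \<times> 'a. fst p - snd p) \<in> borel \<rightarrow>\<^sub>M borel"
    by (intro borel_measurable_continuous_onI continuous_intros)
  from measurable_compose[OF this K_borel] show ?thesis
    unfolding diff_kernel_def .
qed

lemma diff_kernel_lebesgue [measurable]: "diff_kernel \<in> borel_measurable lebesgue"
  using diff_kernel_borel by (intro measurable_completion) simp

lemma diff_kernel_nonneg [simp]: "diff_kernel p \<ge> 0"
  by (simp add: diff_kernel_def)

end

text \<open>The increment of a function between the two components of a point of the product space.\<close>

definition incr :: "('a \<Rightarrow> real) \<Rightarrow> 'a \<times> 'a \<Rightarrow> real" where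
  "incr g p = g (fst p) - g (snd p)"

lemma incr_linear:
  "incr (\<lambda>x. f x + g x) p = incr f p + incr g p"
  "incr (\<lambda>x. f x - g x) p = incr f p - incr g p"
  "incr (\<lambda>x. c * f x) p = c * incr f p"
  by (auto simp: incr_def algebra_simps)

lemma incr_measurable [measurable]:
  "g \<in> borel_measurable lebesgue \<Longrightarrow> incr g \<in> borel_measurable (lebesgue :: ('a::euclidean_space \<times> 'a) measure)"
  unfolding incr_def
  by (intro borel_measurable_diff measurable_compose[OF measurable_lebesgue_fst_snd(1)]
      measurable_compose[OF measurable_lebesgue_fst_snd(2)])

lemma incr_borel_measurable:
  fixes g :: "'a::euclidean_space \<Rightarrow> real"
  assumes [measurable]: "g \<in> borel_measurable borel"
  shows "incr g \<in> borel_measurable borel"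
  unfolding incr_def borel_prod[symmetric] by measurable

text \<open>The data of the function space $X_0$: a kernel and a bounded open set.\<close>

locale nonlocal_space = radial_kernel K for K :: "'a::euclidean_space \<Rightarrow> real" +
  fixes \<Omega> :: "'a set"
  assumes open_\<Omega>: "open \<Omega>" and bounded_\<Omega>: "bounded \<Omega>"
begin

text \<open>The square of the norm, as an integral over the whole space and the whole product space. For
  functions vanishing outside the domain nothing is changed by this enlargement.\<close>

definition sq_norm :: "('a \<Rightarrow> real) \<Rightarrow> ennreal" where
  "sq_norm g = (\<integral>\<^sup>+x. ennreal ((g x)\<^sup>2) \<partial>lebesgue) + (\<integral>\<^sup>+p. ennreal ((incr g p)\<^sup>2 * diff_kernel p) \<partial>lebesgue)"

abbreviation X0 :: "('a \<Rightarrow> real) set" where "X0 \<equiv> space_X0 \<Omega> K"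
abbreviation nrm :: "('a \<Rightarrow> real) \<Rightarrow> real" where "nrm \<equiv> norm_X \<Omega> K"

lemma region_sets [measurable]: "nonlocal_region \<Omega> \<in> sets lebesgue" "\<Omega> \<in> sets lebesgue"
proof -
  have "closed ((- \<Omega>) \<times> (- \<Omega>))" using open_\<Omega> by (intro closed_Times) auto
  then show "nonlocal_region \<Omega> \<in> sets lebesgue"
    unfolding nonlocal_region_def by (auto simp: open_Compl)
qed (use open_\<Omega> in auto)

lemma AE_indicator_domain:
  assumes "AE x in lebesgue. x \<in> - \<Omega> \<longrightarrow> f x = (0::real)"
  shows "AE x in lebesgue. indicator \<Omega> x * (f x * c x) = f x * c x"
  using assms by eventually_elim (auto simp: indicator_def)

lemma AE_indicator_region:
  assumes "AE x in lebesgue. x \<in> - \<Omega> \<longrightarrow> f x = 0"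
  shows "AE p in lebesgue. indicator (nonlocal_region \<Omega>) p * (incr f p * c p) = incr f p * c p"
  using AE_lebesgue_fst_snd[OF assms]
  by eventually_elim (auto simp: indicator_def nonlocal_region_def incr_def)

lemma set_integrable_domain:
  fixes f :: "'a \<Rightarrow> real" and c :: "_ \<Rightarrow> real"
  assumes [measurable]: "f \<in> borel_measurable lebesgue" "c \<in> borel_measurable lebesgue"
    and f: "AE x in lebesgue. x \<in> - \<Omega> \<longrightarrow> f x = 0"
  shows "set_integrable lebesgue \<Omega> (\<lambda>x. f x * c x) \<longleftrightarrow> integrable lebesgue (\<lambda>x. f x * c x)"
    and "(LINT x:\<Omega>|lebesgue. f x * c x) = (LINT x|lebesgue. f x * c x)"
  unfolding set_integrable_def set_lebesgue_integral_def real_scaleR_def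
  by (intro integrable_cong_AE integral_cong_AE AE_indicator_domain[OF f]; measurable)+

lemma set_integrable_region:
  fixes f :: "'a \<Rightarrow> real" and c :: "_ \<Rightarrow> real"
  assumes [measurable]: "f \<in> borel_measurable lebesgue" "c \<in> borel_measurable lebesgue"
    and f: "AE x in lebesgue. x \<in> - \<Omega> \<longrightarrow> f x = 0"
  shows "set_integrable lebesgue (nonlocal_region \<Omega>) (\<lambda>p. incr f p * c p)
      \<longleftrightarrow> integrable lebesgue (\<lambda>p. incr f p * c p)"
    and "(LINT p:nonlocal_region \<Omega>|lebesgue. incr f p * c p) = (LINT p|lebesgue. incr f p * c p)"
  unfolding set_integrable_def set_lebesgue_integral_def real_scaleR_def
  by (intro integrable_cong_AE integral_cong_AE AE_indicator_region[OF f]; measurable)+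

lemma X0_iff:
  "g \<in> X0 \<longleftrightarrow> g \<in> borel_measurable lebesgue \<and> (AE x in lebesgue. x \<in> - \<Omega> \<longrightarrow> g x = 0) \<and>
     integrable lebesgue (\<lambda>x. (g x)\<^sup>2) \<and> integrable lebesgue (\<lambda>p. (incr g p)\<^sup>2 * diff_kernel p)"
proof (cases "g \<in> borel_measurable lebesgue \<and> (AE x in lebesgue. x \<in> - \<Omega> \<longrightarrow> g x = 0)")
  case True
  then have [measurable]: "g \<in> borel_measurable lebesgue" by simp
  have 1: "(\<lambda>(x, y). (g x - g y)\<^sup>2 * K (x - y)) = (\<lambda>p. incr g p * (incr g p * diff_kernel p))"
    by (auto simp: fun_eq_iff incr_def diff_kernel_def power2_eq_square)
  show ?thesis
    unfolding space_X0_def space_X_def mem_Collect_eq 1 unfolding power2_eq_square mult.assoc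
    using True set_integrable_domain(1)[of g g]
      set_integrable_region(1)[of g "\<lambda>p. incr g p * diff_kernel p"] by simp
qed (auto simp: space_X0_def space_X_def)

lemma X0_measurable: "g \<in> X0 \<Longrightarrow> g \<in> borel_measurable lebesgue"
  by (simp add: X0_iff)

lemma inner_X_eq:
  assumes "f \<in> X0" "g \<in> X0"
  shows "inner_X \<Omega> K f g = (LINT x|lebesgue. f x * g x) +
    (LINT p|lebesgue. incr f p * incr g p * diff_kernel p)"
proof -
  have [measurable]: "f \<in> borel_measurable lebesgue" "g \<in> borel_measurable lebesgue"
    using assms by (auto intro: X0_measurable)
  have 1: "(\<lambda>(x, y). (f x - f y) * (g x - g y) * K (x - y)) = (\<lambda>p. incr f p * (incr g p * diff_kernel p))"
    by (auto simp: fun_eq_iff incr_def diff_kernel_def)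
  have f: "AE x in lebesgue. x \<in> - \<Omega> \<longrightarrow> f x = 0"
    using assms by (simp add: X0_iff)
  have 2: "(LINT x:\<Omega>|lebesgue. f x * g x) = (LINT x|lebesgue. f x * g x)"
    by (rule set_integrable_domain(2)[OF _ _ f]) measurable
  have 3: "(LINT p:nonlocal_region \<Omega>|lebesgue. incr f p * (incr g p * diff_kernel p)) =
      (LINT p|lebesgue. incr f p * (incr g p * diff_kernel p))"
    by (rule set_integrable_region(2)[OF _ _ f]) measurable
  show ?thesis
    unfolding inner_X_def 1 2 3 by (simp only: mult.assoc)
qed

lemma norm_X_eq_sqrt_inner: "norm_X \<Omega> K f = sqrt (inner_X \<Omega> K f f)"
  unfolding norm_X_def inner_X_def power2_eq_square ..

lemma integrable_product:
  assumes "f \<in> X0" "g \<in> X0"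
  shows "integrable lebesgue (\<lambda>x. f x * g x)"
    and "integrable lebesgue (\<lambda>p. incr f p * incr g p * diff_kernel p)"
proof -
  note [measurable] = X0_measurable[OF assms(1)] X0_measurable[OF assms(2)]
  show "integrable lebesgue (\<lambda>x. f x * g x)"
    using integrable_weighted_product[of f lebesgue g "\<lambda>_. 1"] assms by (simp add: X0_iff)
  show "integrable lebesgue (\<lambda>p. incr f p * incr g p * diff_kernel p)"
    using assms by (intro integrable_weighted_product) (auto simp: X0_iff)
qed

lemma X0_zero: "(\<lambda>x. 0) \<in> X0"
  by (simp add: X0_iff incr_def)

lemma X0_add:
  assumes "f \<in> X0" "g \<in> X0" shows "(\<lambda>x. f x + g x) \<in> X0"
proof -
  note [measurable] = X0_measurable[OF assms(1)] X0_measurable[OF assms(2)]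
  have "(\<lambda>x. (f x + g x)\<^sup>2) = (\<lambda>x. (f x)\<^sup>2 + (g x)\<^sup>2 + 2 * (f x * g x))"
    by (simp add: power2_sum mult.assoc)
  moreover have "(\<lambda>p. (incr (\<lambda>x. f x + g x) p)\<^sup>2 * diff_kernel p) =
      (\<lambda>p. (incr f p)\<^sup>2 * diff_kernel p + (incr g p)\<^sup>2 * diff_kernel p + 2 * (incr f p * incr g p * diff_kernel p))"
    by (auto simp: incr_linear power2_eq_square algebra_simps)
  moreover have "AE x in lebesgue. x \<in> - \<Omega> \<longrightarrow> f x + g x = 0"
  proof -
    have "AE x in lebesgue. x \<in> - \<Omega> \<longrightarrow> f x = 0" "AE x in lebesgue. x \<in> - \<Omega> \<longrightarrow> g x = 0"
      using assms by (simp_all add: X0_iff)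
    then show ?thesis by eventually_elim auto
  qed
  ultimately show ?thesis
    using assms integrable_product[OF assms] by (simp add: X0_iff)
qed

lemma X0_cmult:
  assumes "f \<in> X0" shows "(\<lambda>x. c * f x) \<in> X0"
  using assms by (auto simp: X0_iff incr_linear power_mult_distrib mult.assoc)

lemma X0_diff:
  assumes "f \<in> X0" "g \<in> X0" shows "(\<lambda>x. f x - g x) \<in> X0"
  using X0_add[OF assms(1) X0_cmult[OF assms(2), of "-1"]] by simp

lemma inner_X_linear:
  assumes "f \<in> X0" "g \<in> X0"
  shows "inner_X \<Omega> K f g = inner_X \<Omega> K g f"
    and "h \<in> X0 \<Longrightarrow> inner_X \<Omega> K (\<lambda>x. f x + g x) h = inner_X \<Omega> K f h + inner_X \<Omega> K g h"
    and "inner_X \<Omega> K (\<lambda>x. c * f x) g = c * inner_X \<Omega> K f g"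
proof -
  have "(\<lambda>x. f x * g x) = (\<lambda>x. g x * f x)"
    "(\<lambda>p. incr f p * incr g p * diff_kernel p) = (\<lambda>p. incr g p * incr f p * diff_kernel p)"
    by (simp_all add: fun_eq_iff)
  then show "inner_X \<Omega> K f g = inner_X \<Omega> K g f"
    using assms by (simp only: inner_X_eq)
  show "inner_X \<Omega> K (\<lambda>x. f x + g x) h = inner_X \<Omega> K f h + inner_X \<Omega> K g h" if "h \<in> X0"
    using assms that by (simp add: inner_X_eq X0_add incr_linear distrib_right integrable_product)
  show "inner_X \<Omega> K (\<lambda>x. c * f x) g = c * inner_X \<Omega> K f g"
    using assms by (simp add: inner_X_eq X0_cmult incr_linear distrib_left mult.assoc)
qed

lemma X0_iff_sq_norm:
  "g \<in> X0 \<longleftrightarrow> g \<in> borel_measurable lebesgue \<and> (AE x in lebesgue. x \<in> - \<Omega> \<longrightarrow> g x = 0) \<and> sq_norm g < \<infinity>"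
proof (cases "g \<in> borel_measurable lebesgue")
  case True
  note [measurable] = this
  have "integrable lebesgue (\<lambda>x. (g x)\<^sup>2) \<longleftrightarrow> (\<integral>\<^sup>+x. ennreal ((g x)\<^sup>2) \<partial>lebesgue) < \<infinity>"
    by (subst integrable_iff_bounded) auto
  moreover have "integrable lebesgue (\<lambda>p. (incr g p)\<^sup>2 * diff_kernel p) \<longleftrightarrow>
      (\<integral>\<^sup>+p. ennreal ((incr g p)\<^sup>2 * diff_kernel p) \<partial>lebesgue) < \<infinity>"
    by (subst integrable_iff_bounded) (auto simp: abs_mult)
  ultimately show ?thesis
    by (auto simp: X0_iff sq_norm_def)
qed (simp add: X0_iff)

lemma norm_X_nonneg: "f \<in> X0 \<Longrightarrow> nrm f \<ge> 0"
  by (simp add: norm_X_eq_sqrt_inner inner_X_eq)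

lemma sq_norm_eq:
  assumes "g \<in> X0" shows "sq_norm g = ennreal ((nrm g)\<^sup>2)"
proof -
  have "sq_norm g = ennreal (LINT x|lebesgue. (g x)\<^sup>2) + ennreal (LINT p|lebesgue. (incr g p)\<^sup>2 * diff_kernel p)"
    using assms unfolding sq_norm_def
    by (intro arg_cong2[of _ _ _ _ "(+)"] nn_integral_eq_integral) (auto simp: X0_iff)
  also have "\<dots> = ennreal ((LINT x|lebesgue. (g x)\<^sup>2) + (LINT p|lebesgue. (incr g p)\<^sup>2 * diff_kernel p))"
    by (intro ennreal_plus[symmetric]) auto
  also have "(LINT x|lebesgue. (g x)\<^sup>2) + (LINT p|lebesgue. (incr g p)\<^sup>2 * diff_kernel p) = inner_X \<Omega> K g g"
    using assms by (simp add: inner_X_eq power2_eq_square)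
  also have "inner_X \<Omega> K g g = (nrm g)\<^sup>2"
    unfolding norm_X_eq_sqrt_inner using assms by (simp add: inner_X_eq)
  finally show ?thesis .
qed

lemma sq_norm_le_iff:
  assumes "g \<in> X0" "c \<ge> 0"
  shows "sq_norm g \<le> ennreal (c\<^sup>2) \<longleftrightarrow> nrm g \<le> c" "sq_norm g < ennreal (c\<^sup>2) \<longleftrightarrow> nrm g < c"
  using assms norm_X_nonneg[OF assms(1)]
  by (auto simp: sq_norm_eq ennreal_less_iff power_mono_iff intro: power_strict_mono power2_less_imp_less)

lemma sq_norm_cong_AE:
  assumes "AE x in lebesgue. f x = g x" shows "sq_norm f = sq_norm g"
proof -
  have "AE p in lebesgue. incr f p = incr g p"
    using AE_lebesgue_fst_snd[OF assms] by eventually_elim (simp add: incr_def)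
  then show ?thesis
    unfolding sq_norm_def using assms
    by (intro arg_cong2[of _ _ _ _ "(+)"] nn_integral_cong_AE) (auto elim: eventually_mono)
qed

lemma sq_norm_Fatou:
  assumes [measurable]: "\<And>n. u n \<in> borel_measurable lebesgue"
    and lim: "AE x in lebesgue. (\<lambda>n. u n x) \<longlonglongrightarrow> f x"
    and le: "\<And>n. sq_norm (u n) \<le> c"
  shows "sq_norm f \<le> c"
proof -
  have "AE p in lebesgue. (\<lambda>n. incr (u n) p) \<longlonglongrightarrow> incr f p"
    using AE_lebesgue_fst_snd[OF lim] by eventually_elim (auto simp: incr_def intro: tendsto_diff)
  then have "(\<integral>\<^sup>+p. ennreal ((incr f p)\<^sup>2 * diff_kernel p) \<partial>lebesgue) =
      (\<integral>\<^sup>+p. liminf (\<lambda>n. ennreal ((incr (u n) p)\<^sup>2 * diff_kernel p)) \<partial>lebesgue)"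
    by (intro nn_integral_cong_AE, eventually_elim)
      (intro lim_imp_Liminf[symmetric] tendsto_intros, auto)
  also have "\<dots> \<le> liminf (\<lambda>n. \<integral>\<^sup>+p. ennreal ((incr (u n) p)\<^sup>2 * diff_kernel p) \<partial>lebesgue)"
    by (intro nn_integral_liminf) measurable
  finally have 1: "(\<integral>\<^sup>+p. ennreal ((incr f p)\<^sup>2 * diff_kernel p) \<partial>lebesgue) \<le> \<dots>" .
  have "(\<integral>\<^sup>+x. ennreal ((f x)\<^sup>2) \<partial>lebesgue) = (\<integral>\<^sup>+x. liminf (\<lambda>n. ennreal ((u n x)\<^sup>2)) \<partial>lebesgue)"
    using lim by (intro nn_integral_cong_AE, eventually_elim)
      (intro lim_imp_Liminf[symmetric] tendsto_intros, auto)
  also have "\<dots> \<le> liminf (\<lambda>n. \<integral>\<^sup>+x. ennreal ((u n x)\<^sup>2) \<partial>lebesgue)"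
    by (intro nn_integral_liminf) measurable
  finally have 2: "(\<integral>\<^sup>+x. ennreal ((f x)\<^sup>2) \<partial>lebesgue) \<le> \<dots>" .
  have "sq_norm f \<le> liminf (\<lambda>n. \<integral>\<^sup>+x. ennreal ((u n x)\<^sup>2) \<partial>lebesgue) +
      liminf (\<lambda>n. \<integral>\<^sup>+p. ennreal ((incr (u n) p)\<^sup>2 * diff_kernel p) \<partial>lebesgue)"
    unfolding sq_norm_def by (intro add_mono 1 2)
  also have "\<dots> \<le> c"
    using le unfolding sq_norm_def by (rule liminf_add_le_ennreal)
  finally show ?thesis .
qed

lemma L2_le_sq_norm: "(\<integral>\<^sup>+x. ennreal ((g x)\<^sup>2) \<partial>lebesgue) \<le> sq_norm g"
  by (simp add: sq_norm_def)

section \<open>Completeness\<close>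

theorem hilbert_space_X0: "hilbert_space_mod_AE X0 (inner_X \<Omega> K) nrm"
  unfolding hilbert_space_mod_AE_def
proof (intro conjI ballI allI impI)
  show "inner_X \<Omega> K f g = inner_X \<Omega> K g f" if "f \<in> X0" "g \<in> X0" for f g
    by (rule inner_X_linear(1)[OF that])
  show "inner_X \<Omega> K (\<lambda>x. f x + g x) h = inner_X \<Omega> K f h + inner_X \<Omega> K g h"
    if "f \<in> X0" "g \<in> X0" "h \<in> X0" for f g h
    by (rule inner_X_linear(2)[OF that])
  show "inner_X \<Omega> K (\<lambda>x. c * f x) g = c * inner_X \<Omega> K f g" if "f \<in> X0" "g \<in> X0" for c f g
    by (rule inner_X_linear(3)[OF that])
  show "inner_X \<Omega> K f f \<ge> 0" if "f \<in> X0" for f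
    using that by (simp add: inner_X_eq)
  show "inner_X \<Omega> K f f = 0 \<longleftrightarrow> (AE x in lebesgue. f x = 0)" if f: "f \<in> X0" for f
  proof
    note [measurable] = X0_measurable[OF f]
    assume "inner_X \<Omega> K f f = 0"
    then have "sq_norm f = 0"
      using f by (simp add: sq_norm_eq norm_X_eq_sqrt_inner)
    then have "(\<integral>\<^sup>+x. ennreal ((f x)\<^sup>2) \<partial>lebesgue) = 0" by (simp add: sq_norm_def)
    then show "AE x in lebesgue. f x = 0"
      by (subst (asm) nn_integral_0_iff_AE) auto
  next
    assume "AE x in lebesgue. f x = 0"
    then have "sq_norm f = sq_norm (\<lambda>x. 0)" by (rule sq_norm_cong_AE)
    then have "nrm f = 0" using f by (simp add: sq_norm_eq) (simp add: sq_norm_def incr_def)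
    then show "inner_X \<Omega> K f f = 0" by (simp add: norm_X_eq_sqrt_inner)
  qed
  show "\<exists>g\<in>X0. (\<lambda>n. nrm (\<lambda>x. u n x - g x)) \<longlonglongrightarrow> 0"
    if u: "(\<forall>n. u n \<in> X0) \<and> (\<forall>e>0. \<exists>M. \<forall>m\<ge>M. \<forall>n\<ge>M. nrm (\<lambda>x. u m x - u n x) < e)" for u
  proof -
    have uX: "u n \<in> X0" for n using u by blast
    have [measurable]: "u n \<in> borel_measurable lebesgue" for n by (rule X0_measurable[OF uX])
    have Cauchy: "\<exists>M. \<forall>m\<ge>M. \<forall>n\<ge>M. sq_norm (\<lambda>x. u m x - u n x) < ennreal (e\<^sup>2)" if "e > 0" for e
      using u that by (subst sq_norm_le_iff(2)) (auto intro: X0_diff uX)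
    have "\<exists>M. \<forall>m\<ge>M. \<forall>n\<ge>M. (\<integral>\<^sup>+x. ennreal ((u m x - u n x)\<^sup>2) \<partial>lebesgue) < ennreal e" if "e > 0" for e
    proof -
      from Cauchy[of "sqrt e"] that obtain M
        where "\<And>m n. m \<ge> M \<Longrightarrow> n \<ge> M \<Longrightarrow> sq_norm (\<lambda>x. u m x - u n x) < ennreal e" by auto
      then show ?thesis
        by (intro exI[of _ M] allI impI order.strict_trans1[OF L2_le_sq_norm])
    qed
    from AE_convergent_subseq_of_L2_Cauchy[where f = u and M = lebesgue, OF _ this] obtain r g
      where r: "strict_mono r" and g [measurable]: "g \<in> borel_measurable lebesgue"
        and lim: "AE x in lebesgue. (\<lambda>k. u (r k) x) \<longlonglongrightarrow> g x" by auto
    \<comment> \<open>Fatou's lemma in the second index along the subsequence\<close>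
    have close: "\<exists>M. \<forall>n\<ge>M. sq_norm (\<lambda>x. u n x - g x) \<le> ennreal (e\<^sup>2)" if e: "e > 0" for e
    proof -
      from Cauchy[OF e] obtain M where M: "\<And>m n. m \<ge> M \<Longrightarrow> n \<ge> M \<Longrightarrow> sq_norm (\<lambda>x. u m x - u n x) < ennreal (e\<^sup>2)"
        by blast
      have "sq_norm (\<lambda>x. u n x - g x) \<le> ennreal (e\<^sup>2)" if n: "n \<ge> M" for n
      proof (rule sq_norm_Fatou[where u = "\<lambda>k x. u n x - u (r (k + M)) x"])
        show "AE x in lebesgue. (\<lambda>k. u n x - u (r (k + M)) x) \<longlonglongrightarrow> u n x - g x"
          using lim by eventually_elim (intro tendsto_diff tendsto_const LIMSEQ_ignore_initial_segment)
        show "sq_norm (\<lambda>x. u n x - u (r (k + M)) x) \<le> ennreal (e\<^sup>2)" for k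
          using M[OF n, of "r (k + M)"] seq_suble[OF r, of "k + M"] by (auto intro: less_imp_le)
      qed measurable
      then show ?thesis by blast
    qed
    have AE0: "AE x in lebesgue. x \<in> - \<Omega> \<longrightarrow> g x = 0"
    proof -
      have "AE x in lebesgue. \<forall>n. x \<in> - \<Omega> \<longrightarrow> u n x = 0"
        using uX unfolding X0_iff AE_all_countable by blast
      with lim show ?thesis
        by eventually_elim (auto simp: LIMSEQ_const_iff)
    qed
    have dX: "(\<lambda>x. u n x - g x) \<in> X0" if "sq_norm (\<lambda>x. u n x - g x) \<le> ennreal (e\<^sup>2)" for n e
      unfolding X0_iff_sq_norm
    proof (intro conjI ballI allI impI)
      have "AE x in lebesgue. x \<in> - \<Omega> \<longrightarrow> u n x = 0" using uX by (simp add: X0_iff)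
      with AE0 show "AE x in lebesgue. x \<in> - \<Omega> \<longrightarrow> u n x - g x = 0"
        by eventually_elim auto
      show "sq_norm (\<lambda>x. u n x - g x) < \<infinity>"
        using that by (simp add: order.strict_trans1)
    qed measurable
    from close[of 1] obtain n where "sq_norm (\<lambda>x. u n x - g x) \<le> ennreal (1\<^sup>2)" by auto
    from X0_diff[OF uX[of n] dX[OF this]] have gX: "g \<in> X0" by simp
    have "(\<lambda>n. nrm (\<lambda>x. u n x - g x)) \<longlonglongrightarrow> 0"
    proof (rule LIMSEQ_I)
      fix e :: real assume e: "e > 0"
      from close[of "e/2"] e obtain M where M: "\<And>n. n \<ge> M \<Longrightarrow> sq_norm (\<lambda>x. u n x - g x) \<le> ennreal ((e/2)\<^sup>2)"
        by auto
      have "norm (nrm (\<lambda>x. u n x - g x) - 0) < e" if "n \<ge> M" for n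
        using M[OF that] sq_norm_le_iff(1)[OF X0_diff[OF uX gX], of "e/2" n]
          norm_X_nonneg[OF X0_diff[OF uX gX], of n] e by simp
      then show "\<exists>no. \<forall>n\<ge>no. norm (nrm (\<lambda>x. u n x - g x) - 0) < e" by blast
    qed
    with gX show ?thesis by blast
  qed
qed (auto intro: X0_zero X0_add X0_cmult simp: norm_X_eq_sqrt_inner)

end

section \<open>Level sets\<close>

text \<open>With $c=uA^{1-\theta}$ and $b=uA'A^{-\theta}$ one has $uA'^{1-\theta}=b^{1-\theta}c^\theta$. The constant
  \<open>L\<close> is chosen such that Young's inequality leaves half of \<open>c\<close>.\<close>

lemma level_recursion:
  fixes \<theta> A A' u :: real
  assumes \<theta>: "0 < \<theta>" "\<theta> < 1" and A: "0 \<le> A'" "A' \<le> A" and u: "u > 0"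
  defines "L \<equiv> (4 * 2 powr \<theta>) powr (1 / (1 - \<theta>))"
  shows "4 * u * A' powr (1 - \<theta>) \<le> L * (u * A' * A powr (- \<theta>)) + u * A powr (1 - \<theta>) / 2"
proof (cases "A' = 0")
  case False
  then have pos: "A' > 0" "A > 0" using A by auto
  have L: "L > 0" "L powr (1 - \<theta>) = 4 * 2 powr \<theta>"
    using \<theta> by (auto simp: L_def powr_powr)
  define b where "b = u * A' * A powr (- \<theta>)"
  define c where "c = u * A powr (1 - \<theta>)"
  have bc: "b > 0" "c > 0" using pos u by (auto simp: b_def c_def)
  have "b powr (1 - \<theta>) * c powr \<theta> = (u powr (1 - \<theta>) * u powr \<theta>) * A' powr (1 - \<theta>) *
      (A powr (- \<theta> * (1 - \<theta>)) * A powr ((1 - \<theta>) * \<theta>))"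
    using pos u by (simp add: b_def c_def powr_mult powr_powr)
  also have "A powr (- \<theta> * (1 - \<theta>)) * A powr ((1 - \<theta>) * \<theta>) = 1"
    using pos by (simp flip: powr_add)
  also have "u powr (1 - \<theta>) * u powr \<theta> = u"
    using u by (simp flip: powr_add)
  finally have bc': "b powr (1 - \<theta>) * c powr \<theta> = u * A' powr (1 - \<theta>)" by simp
  have "4 * u * A' powr (1 - \<theta>) = (L * b) powr (1 - \<theta>) * (c / 2) powr \<theta>"
    using L bc by (simp add: powr_mult powr_divide bc'[symmetric])
  also have "\<dots> \<le> (1 - \<theta>) * (L * b) + \<theta> * (c / 2)"
    using L bc \<theta> by (intro Youngs_inequality_0) auto
  also have "\<dots> \<le> 1 * (L * b) + 1 * (c / 2)"
    using L bc \<theta> by (intro add_mono mult_right_mono) auto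
  finally show ?thesis by (simp add: b_def c_def)
qed (use u A \<theta> in simp)

text \<open>For $c_k=4^ka_k^{1-\theta}$ the recursion reads $c_{k+1}\le L\,b_k+c_k/2$ with
  $\sum_k b_k\le B$, which bounds $\sum_k c_k$; and $2^{kq}a_k=c_k^{1/(1-\theta)}$ for
  $q=2/(1-\theta)$. The constant depends on \<open>\<theta>\<close>, \<open>V\<close> and \<open>B\<close> only.\<close>

lemma level_sum_bound:
  fixes \<theta> V B :: real
  assumes \<theta>: "0 < \<theta>" "\<theta> < 1" and "V \<ge> 0" "B \<ge> 0"
  obtains C where "C \<ge> 0"
    "\<And>a M. (\<And>k. a k \<ge> 0) \<Longrightarrow> decseq a \<Longrightarrow> a 0 \<le> V \<Longrightarrow>
       (\<And>M. (\<Sum>k<M. 4 ^ k * a (Suc k) * a k powr (- \<theta>)) \<le> B) \<Longrightarrow>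
       (\<Sum>k<M. (2 powr (2 / (1 - \<theta>))) ^ k * a k) \<le> C"
proof -
  define L where "L = (4 * 2 powr \<theta>) powr (1 / (1 - \<theta>))"
  define p where "p = 1 / (1 - \<theta>)"
  define T where "T = 2 * (V powr (1 - \<theta>) + L * B)"
  have p: "p > 1" using \<theta> by (simp add: p_def)
  have L: "L > 0" by (simp add: L_def)
  have T: "T \<ge> 0" using L \<open>B \<ge> 0\<close> by (simp add: T_def)
  show thesis
  proof (rule that[of "T * T powr (p - 1)"])
    show "T * T powr (p - 1) \<ge> 0" using T by simp
    fix a :: "nat \<Rightarrow> real" and M
    assume a: "\<And>k. a k \<ge> 0" "decseq a" "a 0 \<le> V"
      and B: "\<And>M. (\<Sum>k<M. 4 ^ k * a (Suc k) * a k powr (- \<theta>)) \<le> B"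
    define c where "c k = 4 ^ k * a k powr (1 - \<theta>)" for k
    have c_nonneg: "c k \<ge> 0" for k by (simp add: c_def)
    have c_Suc: "c (Suc k) \<le> L * (4 ^ k * a (Suc k) * a k powr (- \<theta>)) + c k / 2" for k
      using level_recursion[OF \<theta> a(1) decseqD[OF a(2), of k "Suc k"], of "4 ^ k"]
      by (simp add: c_def L_def mult.assoc)
    have sum_c: "(\<Sum>k<Suc M. c k) \<le> T" for M
    proof -
      have "(\<Sum>k<Suc M. c k) = c 0 + (\<Sum>k<M. c (Suc k))"
        by (rule sum.lessThan_Suc_shift)
      also have "\<dots> \<le> c 0 + (\<Sum>k<M. L * (4 ^ k * a (Suc k) * a k powr (- \<theta>)) + c k / 2)"
        by (intro add_left_mono sum_mono c_Suc)
      also have "\<dots> = c 0 + L * (\<Sum>k<M. 4 ^ k * a (Suc k) * a k powr (- \<theta>)) + (\<Sum>k<M. c k) / 2"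
        by (simp add: sum.distrib sum_distrib_left sum_divide_distrib)
      also have "\<dots> \<le> V powr (1 - \<theta>) + L * B + (\<Sum>k<Suc M. c k) / 2"
        using a \<theta> L B[of M] c_nonneg[of M]
        by (intro add_mono mult_left_mono) (auto simp: c_def intro!: powr_mono2)
      finally show ?thesis unfolding T_def by (simp only: distrib_left)
    qed
    have c_le: "c k \<le> T" for k
      using sum_c[of k] sum_nonneg[of "{..<k}" c] c_nonneg by simp
    have term_le: "(2 powr (2 / (1 - \<theta>))) ^ k * a k \<le> c k * T powr (p - 1)" for k
    proof (cases "a k = 0")
      case False
      then have ak: "a k > 0" using a(1)[of k] by simp
      have ck: "c k > 0" using ak by (simp add: c_def)
      have "(2 powr (2 / (1 - \<theta>))) ^ k = (4 ^ k) powr p"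
      proof -
        have "2 powr (2 / (1 - \<theta>)) = (2 powr 2) powr p"
          unfolding powr_powr by (simp add: p_def)
        then have "2 powr (2 / (1 - \<theta>)) = 4 powr p" by simp
        then show ?thesis by (simp add: powr_powr mult.commute flip: powr_realpow)
      qed
      moreover have "(a k powr (1 - \<theta>)) powr p = a k"
        using ak \<theta> by (simp add: powr_powr p_def)
      ultimately have "(2 powr (2 / (1 - \<theta>))) ^ k * a k = c k powr p"
        by (simp add: c_def powr_mult)
      also have "\<dots> = c k powr 1 * c k powr (p - 1)" by (subst powr_add[symmetric]) simp
      also have "\<dots> \<le> c k * T powr (p - 1)"
        using ck p c_le[of k] by (auto intro!: mult_left_mono powr_mono2)
      finally show ?thesis .
    qed (simp add: c_nonneg)
    have "(\<Sum>k<M. (2 powr (2 / (1 - \<theta>))) ^ k * a k) \<le> (\<Sum>k<M. c k) * T powr (p - 1)"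
      unfolding sum_distrib_right by (intro sum_mono term_le)
    also have "(\<Sum>k<M. c k) \<le> T"
      using sum_c[of M] c_nonneg[of M] by simp
    finally show "(\<Sum>k<M. (2 powr (2 / (1 - \<theta>))) ^ k * a k) \<le> T * T powr (p - 1)"
      by (simp add: mult_right_mono)
  qed
qed

text \<open>The terms form part of a geometric series, so their sum is comparable to the last one that is not
  zero, and there \<open>\<bar>a\<bar>\<close> and \<open>\<bar>b\<bar>\<close> differ by at least \<open>2 ^ k\<close>.\<close>

lemma sum_level_pairs_le:
  fixes a b :: real
  shows "(\<Sum>k<M. 4 ^ k * (of_bool (2 ^ Suc k < \<bar>a\<bar>) * of_bool (\<bar>b\<bar> \<le> 2 ^ k))) \<le> 2 * (a - b)\<^sup>2"
proof (induction M)
  case (Suc M)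
  show ?case
  proof (cases "2 ^ Suc M < \<bar>a\<bar> \<and> \<bar>b\<bar> \<le> 2 ^ M")
    case True
    have geo: "(\<Sum>k<n. (4::real) ^ k) \<le> 4 ^ n" for n
    proof (induction n)
      case (Suc n)
      then show ?case
        using zero_le_power[of "4::real" n] unfolding sum.lessThan_Suc power_Suc by linarith
    qed simp
    have "(\<Sum>k<Suc M. 4 ^ k * (of_bool (2 ^ Suc k < \<bar>a\<bar>) * of_bool (\<bar>b\<bar> \<le> 2 ^ k))) \<le> (\<Sum>k<Suc M. (4::real) ^ k)"
      by (intro sum_mono) auto
    also have "\<dots> \<le> 2 * 4 ^ M" using geo[of M] by simp
    also have "\<dots> = 2 * (2 ^ M)\<^sup>2" by (simp add: power2_eq_square flip: power_mult_distrib)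
    also have "\<dots> \<le> 2 * \<bar>a - b\<bar>\<^sup>2"
      using True by (intro mult_left_mono power_mono) auto
    finally show ?thesis by simp
  qed (use Suc in auto)
qed simp

lemma powr_le_level_sum:
  fixes t q :: real
  assumes "q > 0"
  shows "ennreal (\<bar>t\<bar> powr q) \<le> 1 + (\<Sum>k. ennreal (2 powr q * (2 powr q) ^ k) * indicator {x. 2 ^ k < \<bar>x\<bar>} t)"
proof (cases "\<bar>t\<bar> \<le> 1")
  case True
  then have "\<bar>t\<bar> powr q \<le> 1" using assms powr_mono2[of q "\<bar>t\<bar>" 1] by simp
  then show ?thesis by (intro order_trans[OF _ add_increasing2]) auto
next
  case False
  define n where "n = (LEAST n. \<bar>t\<bar> \<le> 2 ^ n)"
  have "\<exists>n. \<bar>t\<bar> \<le> 2 ^ n" using real_arch_pow[of 2 "\<bar>t\<bar>"] by (auto intro: less_imp_le)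
  then have n: "\<bar>t\<bar> \<le> 2 ^ n" unfolding n_def by (rule LeastI_ex)
  then obtain m where m: "n = Suc m" using False by (cases n) auto
  have m': "2 ^ m < \<bar>t\<bar>" using not_less_Least[of m "\<lambda>n. \<bar>t\<bar> \<le> 2 ^ n"] m unfolding n_def by auto
  have "\<bar>t\<bar> powr q \<le> (2 ^ Suc m) powr q" using n m assms by (intro powr_mono2) auto
  also have "\<dots> = 2 powr q * (2 powr q) ^ m"
    by (simp add: powr_mult powr_powr mult.commute flip: powr_realpow)
  finally have "ennreal (\<bar>t\<bar> powr q) \<le> (\<Sum>k\<in>{m}. ennreal (2 powr q * (2 powr q) ^ k) * indicator {x. 2 ^ k < \<bar>x\<bar>} t)"
    using m' by (simp add: ennreal_leI)
  also have "\<dots> \<le> (\<Sum>k. ennreal (2 powr q * (2 powr q) ^ k) * indicator {x. 2 ^ k < \<bar>x\<bar>} t)"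
    by (rule sum_le_suminf) auto
  finally show ?thesis by (rule add_increasing[rotated]) simp
qed

text \<open>Where \<open>\<bar>t\<bar>\<close> is small the power is at most \<open>d\<close>, where it is large the higher power dominates,
  and in between \<open>\<bar>t\<bar>\<close> is bounded while \<open>t\<^sup>2\<close> is bounded away from zero.\<close>

lemma powr_interpolation:
  fixes q q' d :: real
  assumes q: "0 < q" "q < q'" and d: "d > 0"
  obtains C where "C \<ge> 0" "\<And>t. \<bar>t\<bar> powr q \<le> d * (1 + \<bar>t\<bar> powr q') + C * t\<^sup>2"
proof -
  define T where "T = (1 / d) powr (1 / (q' - q))"
  define \<tau> where "\<tau> = d powr (1 / q)"
  have T: "T > 0" "\<tau> > 0" using d by (auto simp: T_def \<tau>_def)
  show thesis
  proof (rule that[of "T powr q / \<tau>\<^sup>2"])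
    show "T powr q / \<tau>\<^sup>2 \<ge> 0" by simp
    fix t :: real
    consider "\<bar>t\<bar> \<le> \<tau>" | "\<bar>t\<bar> \<ge> T" | "\<tau> < \<bar>t\<bar>" "\<bar>t\<bar> < T" by linarith
    then show "\<bar>t\<bar> powr q \<le> d * (1 + \<bar>t\<bar> powr q') + T powr q / \<tau>\<^sup>2 * t\<^sup>2"
    proof cases
      case 1
      have "\<bar>t\<bar> powr q \<le> \<tau> powr q" using 1 q by (intro powr_mono2) auto
      also have "\<dots> = d" using d q by (simp add: \<tau>_def powr_powr)
      also have "\<dots> \<le> d * (1 + \<bar>t\<bar> powr q') + T powr q / \<tau>\<^sup>2 * t\<^sup>2"
        using d by (simp add: distrib_left)
      finally show ?thesis .
    next
      case 2
      have "1 / d = T powr (q' - q)" using d q by (simp add: T_def powr_powr)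
      also have "\<dots> \<le> \<bar>t\<bar> powr (q' - q)" using 2 T q by (intro powr_mono2) auto
      finally have "1 \<le> d * \<bar>t\<bar> powr (q' - q)" using d by (simp add: field_simps)
      then have "\<bar>t\<bar> powr q * 1 \<le> \<bar>t\<bar> powr q * (d * \<bar>t\<bar> powr (q' - q))" by (intro mult_left_mono) auto
      also have "\<dots> = d * \<bar>t\<bar> powr q'" using 2 T by (simp add: mult.left_commute flip: powr_add)
      also have "\<dots> \<le> d * (1 + \<bar>t\<bar> powr q') + T powr q / \<tau>\<^sup>2 * t\<^sup>2"
        using d by (simp add: distrib_left)
      finally show ?thesis by simp
    next
      case 3
      have "\<bar>t\<bar> powr q \<le> T powr q * 1" using 3 q T by (simp add: powr_mono2)
      also have "1 \<le> t\<^sup>2 / \<tau>\<^sup>2"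
        using 3 T power_mono[of \<tau> "\<bar>t\<bar>" 2] by simp
      finally have "\<bar>t\<bar> powr q \<le> T powr q / \<tau>\<^sup>2 * t\<^sup>2" by (simp add: mult_left_mono)
      then show ?thesis using d by (smt (verit) mult_nonneg_nonneg powr_ge_zero)
    qed
  qed
qed

section \<open>Tails of the kernel\<close>

lemma nn_integral_reflect:
  fixes x :: "'a::euclidean_space"
  assumes [measurable]: "F \<in> borel_measurable borel"
  shows "(\<integral>\<^sup>+y. F y \<partial>lborel) = (\<integral>\<^sup>+z. F (x - z) \<partial>lborel)"
proof -
  have "lborel = distr lborel borel (\<lambda>z. x - z)"
    using lborel_affine[of "-1" x] by (simp add: density_1)
  then have "(\<integral>\<^sup>+y. F y \<partial>lborel) = (\<integral>\<^sup>+y. F y \<partial>distr lborel borel (\<lambda>z. x - z))"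
    by simp
  also have "\<dots> = (\<integral>\<^sup>+z. F (x - z) \<partial>lborel)"
    by (simp add: nn_integral_distr)
  finally show ?thesis .
qed

context radial_kernel begin

lemma kernel_tail_eq: "kernel_tail K r = (\<integral>\<^sup>+y. ennreal (K y) * indicator (- ball 0 r) y \<partial>lborel)"
  unfolding kernel_tail_def by (simp add: nn_integral_completion)

text \<open>Among all sets of given measure a ball around the origin captures the most mass of the kernel, as the
  kernel is at least \<open>\<kappa>\<close> inside the ball and at most \<open>\<kappa>\<close> outside.\<close>

lemma kernel_tail_le_compl:
  assumes A [measurable]: "A \<in> sets borel" and r: "r > 0"
    and le: "emeasure lborel A \<le> emeasure lborel (ball (0::'a) r)"
  shows "kernel_tail K r \<le> (\<integral>\<^sup>+y. ennreal (K y) * indicator (- A) y \<partial>lborel)"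
proof -
  obtain e :: 'a where e: "e \<in> Basis" using nonempty_Basis by blast
  let ?B = "ball (0::'a) r"
  define \<kappa> where "\<kappa> = K (r *\<^sub>R e)"
  have out: "K y \<le> \<kappa>" if "y \<notin> ?B" for y
    unfolding \<kappa>_def using that r e nonzero_Basis[OF e] by (intro K_antimono) auto
  have inside: "K y \<ge> \<kappa>" if "y \<in> ?B" "y \<noteq> 0" for y
    unfolding \<kappa>_def using that r e nonzero_Basis[OF e] by (intro K_antimono) auto
  have AE0: "AE y in lborel. y \<noteq> (0::'a)"
    by (rule AE_lborel_singleton)
  have fin: "emeasure lborel (?B \<inter> A) \<noteq> \<infinity>"
    using emeasure_mono[of "?B \<inter> A" ?B lborel] emeasure_ball[of r "0::'a"] r
    by (auto simp: top_unique)
  have "emeasure lborel (A - ?B) + emeasure lborel (?B \<inter> A) = emeasure lborel A"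
    by (subst plus_emeasure) (auto intro!: arg_cong[where f = "emeasure lborel"])
  also have "\<dots> \<le> emeasure lborel ?B" by (rule le)
  also have "\<dots> = emeasure lborel (?B - A) + emeasure lborel (?B \<inter> A)"
    by (subst plus_emeasure) (auto intro!: arg_cong[where f = "emeasure lborel"])
  finally have meas: "emeasure lborel (A - ?B) \<le> emeasure lborel (?B - A)"
    using fin by (simp add: add.commute[of _ "emeasure lborel (?B \<inter> A)"])
  have "kernel_tail K r = (\<integral>\<^sup>+y. ennreal (K y) * indicator (- ?B - A) y \<partial>lborel) +
      (\<integral>\<^sup>+y. ennreal (K y) * indicator (A - ?B) y \<partial>lborel)"
    unfolding kernel_tail_eq
    by (subst nn_integral_add[symmetric]) (auto intro!: nn_integral_cong simp: indicator_def)
  also have "(\<integral>\<^sup>+y. ennreal (K y) * indicator (A - ?B) y \<partial>lborel) \<le>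
      (\<integral>\<^sup>+y. ennreal \<kappa> * indicator (A - ?B) y \<partial>lborel)"
    by (intro nn_integral_mono) (auto simp: indicator_def intro!: ennreal_leI out)
  also have "\<dots> = ennreal \<kappa> * emeasure lborel (A - ?B)"
    by (intro nn_integral_cmult_indicator) auto
  also have "\<dots> \<le> ennreal \<kappa> * emeasure lborel (?B - A)"
    by (intro mult_left_mono meas) auto
  also have "\<dots> = (\<integral>\<^sup>+y. ennreal \<kappa> * indicator (?B - A) y \<partial>lborel)"
    by (intro nn_integral_cmult_indicator[symmetric]) auto
  also have "\<dots> \<le> (\<integral>\<^sup>+y. ennreal (K y) * indicator (?B - A) y \<partial>lborel)"
    by (intro nn_integral_mono_AE eventually_mono[OF AE0])
      (auto simp: indicator_def intro!: ennreal_leI inside)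
  also have "(\<integral>\<^sup>+y. ennreal (K y) * indicator (- ?B - A) y \<partial>lborel) + \<dots> =
      (\<integral>\<^sup>+y. ennreal (K y) * indicator (- A) y \<partial>lborel)"
    by (subst nn_integral_add[symmetric]) (auto intro!: nn_integral_cong simp: indicator_def)
  finally show ?thesis by (simp add: add_left_mono)
qed

lemma kernel_tail_le_translate:
  assumes A [measurable]: "A \<in> sets borel" and r: "r > 0"
    and le: "emeasure lborel A \<le> emeasure lborel (ball (0::'a) r)"
  shows "kernel_tail K r \<le> (\<integral>\<^sup>+y. ennreal (K (x - y)) * indicator (- A) y \<partial>lborel)"
proof -
  have [measurable]: "(\<lambda>z. x - z) -` A \<in> sets borel"
    using measurable_sets[of "\<lambda>z. x - z" borel borel A] by simp
  have "emeasure lborel A = (\<integral>\<^sup>+y. indicator A y \<partial>lborel)" by simp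
  also have "\<dots> = (\<integral>\<^sup>+z. indicator A (x - z) \<partial>lborel)"
    by (rule nn_integral_reflect) simp
  also have "\<dots> = (\<integral>\<^sup>+z. indicator ((\<lambda>z. x - z) -` A) z \<partial>lborel)"
    by (simp add: indicator_def)
  also have "\<dots> = emeasure lborel ((\<lambda>z. x - z) -` A)" by simp
  finally have "kernel_tail K r \<le> (\<integral>\<^sup>+z. ennreal (K z) * indicator (- ((\<lambda>z. x - z) -` A)) z \<partial>lborel)"
    using le r by (intro kernel_tail_le_compl) auto
  also have "\<dots> = (\<integral>\<^sup>+z. ennreal (K (x - (x - z))) * indicator (- A) (x - z) \<partial>lborel)"
    by (simp add: indicator_def)
  also have "\<dots> = (\<integral>\<^sup>+y. ennreal (K (x - y)) * indicator (- A) y \<partial>lborel)"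
    by (rule nn_integral_reflect[symmetric, where F = "\<lambda>y. ennreal (K (x - y)) * indicator (- A) y"]) measurable
  finally show ?thesis .
qed

end

section \<open>The Sobolev inequality\<close>

context radial_kernel begin

text \<open>The preceding estimate with a ball of the same measure as \<open>A\<close>, whose radius is
  $(m/\omega)^{1/N}$.\<close>

lemma kernel_tail_ge_of_measure:
  fixes A :: "'a set"
  defines "\<omega> \<equiv> unit_ball_vol (real DIM('a))"
  assumes s: "s > 0" and r\<^sub>0: "r\<^sub>0 > 0" and A [measurable]: "A \<in> sets borel"
    and fin: "emeasure lborel A = ennreal m" and m: "m > 0" "m \<le> \<omega> * r\<^sub>0 ^ DIM('a)"
    and tail: "\<And>r. 0 < r \<Longrightarrow> r \<le> r\<^sub>0 \<Longrightarrow> ennreal (c * r powr (- (2 * s))) \<le> kernel_tail K r"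
  shows "ennreal (c * \<omega> powr (2 * s / real DIM('a)) * m powr (- (2 * s / real DIM('a))))
      \<le> (\<integral>\<^sup>+y. ennreal (K (x - y)) * indicator (- A) y \<partial>lborel)"
proof -
  define N where "N = real DIM('a)"
  have N: "N > 0" by (simp add: N_def)
  have \<omega>: "\<omega> > 0" by (simp add: \<omega>_def)
  define r where "r = (m / \<omega>) powr (1 / N)"
  have r: "r > 0" using m \<omega> by (simp add: r_def)
  have rN: "r ^ DIM('a) = m / \<omega>"
  proof -
    have "r ^ DIM('a) = r powr N" using r by (simp add: N_def powr_realpow)
    also have "\<dots> = m / \<omega>" using m \<omega> N by (simp add: r_def powr_powr)
    finally show ?thesis .
  qed
  have "r ^ DIM('a) \<le> r\<^sub>0 ^ DIM('a)"
    unfolding rN using m \<omega> by (simp add: field_simps)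
  then have "r \<le> r\<^sub>0" using r r\<^sub>0 by (subst (asm) power_mono_iff) auto
  have "m powr (- (2 * s / N)) * \<omega> powr (2 * s / N) = (m / \<omega>) powr (- (2 * s / N))"
    using m \<omega> by (simp add: powr_divide powr_minus field_simps)
  also have "\<dots> = r powr (- (2 * s))"
    using N by (simp add: r_def powr_powr)
  finally have "ennreal (c * \<omega> powr (2 * s / N) * m powr (- (2 * s / N))) = ennreal (c * r powr (- (2 * s)))"
    by (simp add: mult_ac)
  also have "\<dots> \<le> kernel_tail K r" using r \<open>r \<le> r\<^sub>0\<close> by (rule tail)
  also have "\<dots> \<le> (\<integral>\<^sup>+y. ennreal (K (x - y)) * indicator (- A) y \<partial>lborel)"
    using r rN \<omega> by (intro kernel_tail_le_translate) (simp_all add: fin emeasure_ball flip: \<omega>_def)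
  finally show ?thesis by (simp add: N_def)
qed

text \<open>The interactions between \<open>A (Suc k)\<close> and the complement of \<open>A k\<close>, weighted with \<open>4 ^ k\<close> and summed
  over all levels, are controlled by the energy.\<close>

lemma level_sets_energy:
  fixes g :: "'a \<Rightarrow> real" and \<tau> :: "nat \<Rightarrow> ennreal"
  assumes [measurable]: "g \<in> borel_measurable borel"
  defines "A \<equiv> \<lambda>k. {x. 2 ^ k < \<bar>g x\<bar>}"
  assumes \<tau>: "\<And>k x. k < M \<Longrightarrow> emeasure lborel (A (Suc k)) \<noteq> 0 \<Longrightarrow>
      \<tau> k \<le> (\<integral>\<^sup>+y. ennreal (K (x - y)) * indicator (- A k) y \<partial>lborel)"
  shows "(\<Sum>k<M. ennreal (4 ^ k) * (\<tau> k * emeasure lborel (A (Suc k))))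
      \<le> 2 * (\<integral>\<^sup>+x. \<integral>\<^sup>+y. ennreal ((g x - g y)\<^sup>2 * K (x - y)) \<partial>lborel \<partial>lborel)"
proof -
  have [measurable]: "A k \<in> sets borel" for k unfolding A_def by measurable
  define J where "J k x = (\<integral>\<^sup>+y. ennreal (K (x - y)) * indicator (- A k) y \<partial>lborel)" for k x
  have J [measurable]: "J k \<in> borel_measurable borel" for k
    unfolding J_def by measurable
  have "(\<Sum>k<M. ennreal (4 ^ k) * (\<tau> k * emeasure lborel (A (Suc k)))) \<le>
      (\<Sum>k<M. \<integral>\<^sup>+x. ennreal (4 ^ k) * (indicator (A (Suc k)) x * J k x) \<partial>lborel)"
  proof (rule sum_mono)
    fix k assume k: "k \<in> {..<M}"
    have "\<tau> k * emeasure lborel (A (Suc k)) = (\<integral>\<^sup>+x. \<tau> k * indicator (A (Suc k)) x \<partial>lborel)"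
      by (rule nn_integral_cmult_indicator[symmetric]) simp
    also have "\<dots> \<le> (\<integral>\<^sup>+x. indicator (A (Suc k)) x * J k x \<partial>lborel)"
    proof (cases "emeasure lborel (A (Suc k)) = 0")
      case True
      then show ?thesis by (subst nn_integral_cmult_indicator) auto
    next
      case False
      then show ?thesis
        using \<tau> k by (intro nn_integral_mono) (auto simp: indicator_def J_def)
    qed
    finally show "ennreal (4 ^ k) * (\<tau> k * emeasure lborel (A (Suc k))) \<le>
        (\<integral>\<^sup>+x. ennreal (4 ^ k) * (indicator (A (Suc k)) x * J k x) \<partial>lborel)"
      by (subst nn_integral_cmult) (auto intro: mult_left_mono)
  qed
  also have "\<dots> = (\<integral>\<^sup>+x. (\<Sum>k<M. ennreal (4 ^ k) * (indicator (A (Suc k)) x * J k x)) \<partial>lborel)"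
    by (rule nn_integral_sum[symmetric]) measurable
  also have "\<dots> \<le> (\<integral>\<^sup>+x. \<integral>\<^sup>+y. 2 * ennreal ((g x - g y)\<^sup>2 * K (x - y)) \<partial>lborel \<partial>lborel)"
  proof (rule nn_integral_mono)
    fix x
    have "(\<Sum>k<M. ennreal (4 ^ k) * (indicator (A (Suc k)) x * J k x)) =
        (\<integral>\<^sup>+y. (\<Sum>k<M. ennreal (4 ^ k) * (indicator (A (Suc k)) x *
          (ennreal (K (x - y)) * indicator (- A k) y))) \<partial>lborel)"
      unfolding J_def by (simp add: nn_integral_sum nn_integral_cmult)
    also have "\<dots> \<le> (\<integral>\<^sup>+y. 2 * ennreal ((g x - g y)\<^sup>2 * K (x - y)) \<partial>lborel)"
    proof (rule nn_integral_mono)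
      fix y
      have "(\<Sum>k<M. ennreal (4 ^ k) * (indicator (A (Suc k)) x * (ennreal (K (x - y)) * indicator (- A k) y))) =
          (\<Sum>k<M. ennreal (4 ^ k * (of_bool (2 ^ Suc k < \<bar>g x\<bar>) * of_bool (\<bar>g y\<bar> \<le> 2 ^ k)) * K (x - y)))"
        by (intro sum.cong) (auto simp: A_def indicator_def ennreal_mult)
      also have "\<dots> = ennreal ((\<Sum>k<M. 4 ^ k * (of_bool (2 ^ Suc k < \<bar>g x\<bar>) * of_bool (\<bar>g y\<bar> \<le> 2 ^ k))) * K (x - y))"
        unfolding sum_distrib_right by (rule sum_ennreal) simp
      also have "\<dots> \<le> ennreal (2 * (g x - g y)\<^sup>2 * K (x - y))"
        by (intro ennreal_leI mult_right_mono sum_level_pairs_le) simp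
      also have "\<dots> = 2 * ennreal ((g x - g y)\<^sup>2 * K (x - y))"
        by (simp add: mult.assoc ennreal_mult)
      finally show "(\<Sum>k<M. ennreal (4 ^ k) * (indicator (A (Suc k)) x * (ennreal (K (x - y)) * indicator (- A k) y)))
          \<le> 2 * ennreal ((g x - g y)\<^sup>2 * K (x - y))" .
    qed
    finally show "(\<Sum>k<M. ennreal (4 ^ k) * (indicator (A (Suc k)) x * J k x)) \<le>
        (\<integral>\<^sup>+y. 2 * ennreal ((g x - g y)\<^sup>2 * K (x - y)) \<partial>lborel)" .
  qed
  also have "\<dots> = 2 * (\<integral>\<^sup>+x. \<integral>\<^sup>+y. ennreal ((g x - g y)\<^sup>2 * K (x - y)) \<partial>lborel \<partial>lborel)"
    by (simp add: nn_integral_cmult)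
  finally show ?thesis .
qed

end

context nonlocal_space begin

lemma X0_borel_representative:
  assumes g: "g \<in> X0"
  obtains g' where "g' \<in> borel_measurable borel" "AE x in lebesgue. g x = g' x"
    "\<And>x. x \<notin> \<Omega> \<Longrightarrow> g' x = 0"
    "(\<integral>\<^sup>+x. ennreal ((g' x)\<^sup>2) \<partial>lborel) \<le> ennreal ((nrm g)\<^sup>2)"
    "(\<integral>\<^sup>+x. \<integral>\<^sup>+y. ennreal ((g' x - g' y)\<^sup>2 * K (x - y)) \<partial>lborel \<partial>lborel) \<le> ennreal ((nrm g)\<^sup>2)"
proof -
  from g obtain g' where g' [measurable]: "g' \<in> borel_measurable borel" and ae: "AE x in lebesgue. g x = g' x"
    and off: "\<And>x. x \<notin> \<Omega> \<Longrightarrow> g' x = 0"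
    using ex_borel_representative[OF _ open_\<Omega>, of g] by (auto simp: X0_iff)
  note [measurable] = incr_borel_measurable[OF g'] diff_kernel_borel
  have mF: "(\<lambda>p. ennreal ((incr g' p)\<^sup>2 * diff_kernel p)) \<in> borel_measurable borel"
    by measurable
  have energy: "(\<integral>\<^sup>+p. ennreal ((incr g' p)\<^sup>2 * diff_kernel p) \<partial>lebesgue) =
      (\<integral>\<^sup>+x. \<integral>\<^sup>+y. ennreal ((g' x - g' y)\<^sup>2 * K (x - y)) \<partial>lborel \<partial>lborel)"
    by (subst nn_integral_lebesgue_iterated[OF mF]) (simp add: incr_def diff_kernel_def)
  have eq: "ennreal ((nrm g)\<^sup>2) = (\<integral>\<^sup>+x. ennreal ((g' x)\<^sup>2) \<partial>lborel) +
      (\<integral>\<^sup>+x. \<integral>\<^sup>+y. ennreal ((g' x - g' y)\<^sup>2 * K (x - y)) \<partial>lborel \<partial>lborel)"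
    unfolding sq_norm_eq[OF g, symmetric] sq_norm_cong_AE[OF ae] unfolding sq_norm_def energy
    by (simp add: nn_integral_completion)
  show thesis
    by (rule that[OF g' ae off]) (simp_all add: eq)
qed

text \<open>The inequality is stated for functions of small norm, since then all the level sets are so small, by
  Chebyshev's inequality, that the assumption on the tails for radii up to \<open>r\<^sub>0\<close> applies to them.
  The general case follows by scaling.\<close>

theorem sobolev_inequality:
  assumes s: "s > 0" "2 * s < real DIM('a)" and "c > 0" "r\<^sub>0 > 0"
    and tail: "\<And>r. 0 < r \<Longrightarrow> r \<le> r\<^sub>0 \<Longrightarrow> ennreal (c * r powr (- (2 * s))) \<le> kernel_tail K r"
  defines "q \<equiv> 2 * real DIM('a) / (real DIM('a) - 2 * s)"
  obtains \<delta> C where "\<delta> > 0" "C \<ge> 0"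
    "\<And>g. g \<in> X0 \<Longrightarrow> nrm g \<le> \<delta> \<Longrightarrow>
       (\<integral>\<^sup>+x. ennreal (\<bar>g x\<bar> powr q) * indicator \<Omega> x \<partial>lebesgue) \<le> ennreal C"
proof -
  define \<omega> where "\<omega> = unit_ball_vol (real DIM('a))"
  define \<theta> where "\<theta> = 2 * s / real DIM('a)"
  define V where "V = \<omega> * r\<^sub>0 ^ DIM('a)"
  define B where "B = 2 / (c * \<omega> powr \<theta>)"
  define \<delta> where "\<delta> = min 1 (sqrt V)"
  have \<omega>: "\<omega> > 0" by (simp add: \<omega>_def)
  have \<theta>: "0 < \<theta>" "\<theta> < 1" using s by (auto simp: \<theta>_def)
  have q: "q = 2 / (1 - \<theta>)" "q > 0" using s by (auto simp: q_def \<theta>_def field_simps)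
  have V: "V > 0" using \<omega> \<open>r\<^sub>0 > 0\<close> by (simp add: V_def)
  have \<delta>: "\<delta> > 0" "\<delta>\<^sup>2 \<le> V" "\<delta>\<^sup>2 \<le> 1"
  proof -
    show "\<delta> > 0" using V by (simp add: \<delta>_def)
    have "\<delta> \<le> sqrt V" "\<delta> \<le> 1" by (simp_all add: \<delta>_def)
    then show "\<delta>\<^sup>2 \<le> V" "\<delta>\<^sup>2 \<le> 1"
      using power_mono[of \<delta> "sqrt V" 2] power_mono[of \<delta> 1 2] V \<open>\<delta> > 0\<close> by simp_all
  qed
  have B: "B \<ge> 0" using \<open>c > 0\<close> by (simp add: B_def)
  show thesis
  proof (rule level_sum_bound[OF \<theta> less_imp_le[OF V] B])
    fix C\<^sub>0 assume C\<^sub>0: "C\<^sub>0 \<ge> 0"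
      "\<And>a M. (\<And>k. a k \<ge> 0) \<Longrightarrow> decseq a \<Longrightarrow> a 0 \<le> V \<Longrightarrow>
         (\<And>M. (\<Sum>k<M. 4 ^ k * a (Suc k) * a k powr (- \<theta>)) \<le> B) \<Longrightarrow>
         (\<Sum>k<M. (2 powr (2 / (1 - \<theta>))) ^ k * a k) \<le> C\<^sub>0"
    show thesis
    proof (rule that[OF \<delta>(1), of "measure lebesgue \<Omega> + 2 powr q * C\<^sub>0"])
      show "measure lebesgue \<Omega> + 2 powr q * C\<^sub>0 \<ge> 0" using C\<^sub>0 by simp
      fix g assume g: "g \<in> X0" "nrm g \<le> \<delta>"
      from X0_borel_representative[OF g(1)] obtain g' where g' [measurable]: "g' \<in> borel_measurable borel"
        and ae: "AE x in lebesgue. g x = g' x" and off: "\<And>x. x \<notin> \<Omega> \<Longrightarrow> g' x = 0"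
        and L2: "(\<integral>\<^sup>+x. ennreal ((g' x)\<^sup>2) \<partial>lborel) \<le> ennreal ((nrm g)\<^sup>2)"
        and energy: "(\<integral>\<^sup>+x. \<integral>\<^sup>+y. ennreal ((g' x - g' y)\<^sup>2 * K (x - y)) \<partial>lborel \<partial>lborel) \<le> ennreal ((nrm g)\<^sup>2)"
        by blast
      have nrm_le: "ennreal ((nrm g)\<^sup>2) \<le> ennreal (\<delta>\<^sup>2)"
        using g norm_X_nonneg[OF g(1)] by (intro ennreal_leI power_mono)
      define A where "A k = {x. 2 ^ k < \<bar>g' x\<bar>}" for k :: nat
      define a where "a k = measure lborel (A k)" for k
      have A [measurable]: "A k \<in> sets borel" for k unfolding A_def by measurable
      have A_mono: "A j \<subseteq> A k" if "k \<le> j" for k j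
        by (auto simp: A_def intro: order.strict_trans1[OF power_increasing[OF that]])
      have A0: "emeasure lborel (A k) \<le> ennreal (\<delta>\<^sup>2)" for k
      proof -
        have "emeasure lborel (A k) = (\<integral>\<^sup>+x. indicator (A k) x \<partial>lborel)" by simp
        also have "\<dots> \<le> (\<integral>\<^sup>+x. ennreal ((g' x)\<^sup>2) \<partial>lborel)"
        proof (intro nn_integral_mono)
          fix x
          show "indicator (A k) x \<le> ennreal ((g' x)\<^sup>2)"
          proof (cases "x \<in> A k")
            case True
            then have "1 \<le> \<bar>g' x\<bar>" using one_le_power[of "2::real" k, OF one_le_numeral]
              unfolding A_def mem_Collect_eq by linarith
            then have "1 \<le> (g' x)\<^sup>2" using power_mono[of 1 "\<bar>g' x\<bar>" 2] by simp
            then show ?thesis using True by (simp add: ennreal_leI flip: ennreal_1)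
          qed simp
        qed
        also have "\<dots> \<le> ennreal (\<delta>\<^sup>2)" using L2 nrm_le by (rule order_trans)
        finally show ?thesis .
      qed
      have fin: "emeasure lborel (A k) = ennreal (a k)" for k
        unfolding a_def using A0[of k] by (intro emeasure_eq_ennreal_measure) (auto simp: top_unique)
      have a_nonneg: "a k \<ge> 0" for k by (simp add: a_def)
      have a_V: "a k \<le> V" for k
      proof -
        have "ennreal (a k) \<le> ennreal V"
          using A0[of k] \<delta>(2) unfolding fin by (meson ennreal_leI order_trans)
        then show ?thesis using V by (simp add: ennreal_le_iff)
      qed
      have a_dec: "decseq a"
      proof (rule decseq_SucI)
        fix k
        have "emeasure lborel (A (Suc k)) \<le> emeasure lborel (A k)"
          by (intro emeasure_mono A_mono) auto
        then show "a (Suc k) \<le> a k" by (simp add: fin a_nonneg)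
      qed
      have levels: "(\<Sum>k<M. 4 ^ k * a (Suc k) * a k powr (- \<theta>)) \<le> B" for M
      proof -
        define \<tau> where "\<tau> k = c * \<omega> powr \<theta> * a k powr (- \<theta>)" for k
        have \<tau>0: "\<tau> k \<ge> 0" for k using \<open>c > 0\<close> by (simp add: \<tau>_def)
        have "(\<Sum>k<M. ennreal (4 ^ k) * (ennreal (\<tau> k) * emeasure lborel (A (Suc k))))
            \<le> 2 * (\<integral>\<^sup>+x. \<integral>\<^sup>+y. ennreal ((g' x - g' y)\<^sup>2 * K (x - y)) \<partial>lborel \<partial>lborel)"
          unfolding A_def
        proof (rule level_sets_energy[OF g'], fold A_def)
          fix k x assume "emeasure lborel (A (Suc k)) \<noteq> 0"
          then have "a (Suc k) > 0" using a_nonneg[of "Suc k"] by (auto simp: fin less_le)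
          then have "a k > 0" using decseqD[OF a_dec, of k "Suc k"] by simp
          then show "ennreal (\<tau> k) \<le> (\<integral>\<^sup>+y. ennreal (K (x - y)) * indicator (- A k) y \<partial>lborel)"
            using a_V[of k] unfolding \<tau>_def \<theta>_def \<omega>_def V_def
            by (intro kernel_tail_ge_of_measure[OF s(1) \<open>r\<^sub>0 > 0\<close> A fin _ _ tail])
        qed
        also have "\<dots> \<le> 2 * ennreal 1"
          using order_trans[OF energy nrm_le] ennreal_leI[OF \<delta>(3)]
          by (intro mult_left_mono) (auto intro: order_trans)
        also have "\<dots> = ennreal 2" by simp
        also have "(\<Sum>k<M. ennreal (4 ^ k) * (ennreal (\<tau> k) * emeasure lborel (A (Suc k)))) =
            ennreal (\<Sum>k<M. 4 ^ k * (\<tau> k * a (Suc k)))"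
          unfolding fin using \<tau>0 a_nonneg
          by (subst sum_ennreal[symmetric]) (auto simp: ennreal_mult intro!: sum.cong)
        finally have "(\<Sum>k<M. 4 ^ k * (\<tau> k * a (Suc k))) \<le> 2"
          by (subst (asm) ennreal_le_iff) auto
        moreover have "(\<Sum>k<M. 4 ^ k * (\<tau> k * a (Suc k))) =
            c * \<omega> powr \<theta> * (\<Sum>k<M. 4 ^ k * a (Suc k) * a k powr (- \<theta>))"
          unfolding \<tau>_def sum_distrib_left by (intro sum.cong) auto
        ultimately show ?thesis
          using \<open>c > 0\<close> \<omega> by (simp add: B_def field_simps)
      qed
      have sum_le: "(\<Sum>k<M. (2 powr q) ^ k * a k) \<le> C\<^sub>0" for M
        unfolding q(1) by (rule C\<^sub>0(2)[OF a_nonneg a_dec a_V levels])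
      have "(\<integral>\<^sup>+x. ennreal (\<bar>g x\<bar> powr q) * indicator \<Omega> x \<partial>lebesgue) =
          (\<integral>\<^sup>+x. ennreal (\<bar>g' x\<bar> powr q) * indicator \<Omega> x \<partial>lebesgue)"
        using ae by (intro nn_integral_cong_AE) (auto elim: eventually_mono)
      also have "\<dots> \<le> (\<integral>\<^sup>+x. indicator \<Omega> x + (\<Sum>k. ennreal (2 powr q * (2 powr q) ^ k) * indicator (A k) x) \<partial>lborel)"
        unfolding nn_integral_completion
      proof (rule nn_integral_mono)
        fix x
        have "indicator {x. 2 ^ k < \<bar>x\<bar>} (g' x) = (indicator (A k) x :: ennreal)" for k
          by (simp add: A_def indicator_def)
        then show "ennreal (\<bar>g' x\<bar> powr q) * indicator \<Omega> x \<le>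
            indicator \<Omega> x + (\<Sum>k. ennreal (2 powr q * (2 powr q) ^ k) * indicator (A k) x)"
          using powr_le_level_sum[OF q(2), of "g' x"] by (auto simp: indicator_def[of \<Omega>])
      qed
      also have "\<dots> = emeasure lborel \<Omega> + (\<Sum>k. ennreal (2 powr q * (2 powr q) ^ k) * emeasure lborel (A k))"
        using open_\<Omega> by (simp add: nn_integral_add nn_integral_suminf nn_integral_cmult_indicator)
      also have "(\<Sum>k. ennreal (2 powr q * (2 powr q) ^ k) * emeasure lborel (A k)) \<le> ennreal (2 powr q * C\<^sub>0)"
        unfolding suminf_eq_SUP
      proof (rule SUP_least)
        fix M
        have "(\<Sum>k<M. ennreal (2 powr q * (2 powr q) ^ k) * emeasure lborel (A k)) =
            (\<Sum>k<M. ennreal (2 powr q * ((2 powr q) ^ k * a k)))"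
          by (intro sum.cong) (auto simp: fin ennreal_mult a_nonneg mult.assoc)
        also have "\<dots> = ennreal (2 powr q * (\<Sum>k<M. (2 powr q) ^ k * a k))"
          unfolding sum_distrib_left by (rule sum_ennreal) (simp add: a_nonneg)
        also have "\<dots> \<le> ennreal (2 powr q * C\<^sub>0)"
          by (intro ennreal_leI mult_left_mono sum_le) simp
        finally show "(\<Sum>k<M. ennreal (2 powr q * (2 powr q) ^ k) * emeasure lborel (A k)) \<le> ennreal (2 powr q * C\<^sub>0)" .
      qed
      also have "emeasure lborel \<Omega> = ennreal (measure lebesgue \<Omega>)"
        using open_\<Omega> emeasure_bounded_finite[OF bounded_\<Omega>]
        by (simp add: emeasure_eq_ennreal_measure)
      also have "ennreal (measure lebesgue \<Omega>) + ennreal (2 powr q * C\<^sub>0) = ennreal (measure lebesgue \<Omega> + 2 powr q * C\<^sub>0)"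
        using C\<^sub>0 by (intro ennreal_plus[symmetric]) auto
      finally show "(\<integral>\<^sup>+x. ennreal (\<bar>g x\<bar> powr q) * indicator \<Omega> x \<partial>lebesgue) \<le> ennreal (measure lebesgue \<Omega> + 2 powr q * C\<^sub>0)"
        by (simp add: add_left_mono)
    qed
  qed
qed

end

section \<open>Partition into cubes\<close>

lemma ex_cube_partition:
  fixes \<Omega> :: "'a::euclidean_space set"
  assumes "bounded \<Omega>" and \<epsilon>: "\<epsilon> > 0"
  obtains \<Q> where "finite \<Q>" "disjoint \<Q>" "\<Omega> \<subseteq> \<Union>\<Q>" "\<And>Q. Q \<in> \<Q> \<Longrightarrow> Q \<in> sets borel"
    "\<And>Q. Q \<in> \<Q> \<Longrightarrow> emeasure lborel Q = ennreal (\<epsilon> ^ DIM('a))"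
    "\<And>Q x y. Q \<in> \<Q> \<Longrightarrow> x \<in> Q \<Longrightarrow> y \<in> Q \<Longrightarrow> norm (x - y) \<le> real DIM('a) * \<epsilon>"
proof -
  from \<open>bounded \<Omega>\<close> obtain B where B: "\<And>x. x \<in> \<Omega> \<Longrightarrow> norm x \<le> B"
    by (auto simp: bounded_iff)
  define m where "m = \<lceil>B / \<epsilon>\<rceil> + 1"
  define Q where "Q f = {x :: 'a. \<forall>b\<in>Basis. \<lfloor>(x \<bullet> b) / \<epsilon>\<rfloor> = f b}" for f :: "'a \<Rightarrow> int"
  define F :: "('a \<Rightarrow> int) set" where "F = PiE Basis (\<lambda>_. {-m..m})"
  define l where "l f = (\<Sum>b\<in>Basis. (\<epsilon> * real_of_int (f b)) *\<^sub>R b)" for f :: "'a \<Rightarrow> int"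
  define u where "u f = (\<Sum>b\<in>Basis. (\<epsilon> * real_of_int (f b) + \<epsilon>) *\<^sub>R b)" for f :: "'a \<Rightarrow> int"
  have lu: "l f \<bullet> b = \<epsilon> * real_of_int (f b)" "u f \<bullet> b = \<epsilon> * real_of_int (f b) + \<epsilon>" if "b \<in> Basis" for f b
    using that by (simp_all add: l_def u_def)
  have Q_iff: "x \<in> Q f \<longleftrightarrow> (\<forall>b\<in>Basis. l f \<bullet> b \<le> x \<bullet> b \<and> x \<bullet> b < u f \<bullet> b)" for x f
    using \<epsilon> by (auto simp: Q_def lu floor_eq_iff field_simps)
  have vol: "(\<Prod>b\<in>Basis. (u f - l f) \<bullet> b) = \<epsilon> ^ DIM('a)" for f
    by (simp add: inner_diff_left lu)
  have Q_borel: "Q f \<in> sets borel" for f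
  proof -
    have "Q f = (\<Inter>b\<in>Basis. {x. l f \<bullet> b \<le> x \<bullet> b} \<inter> {x. x \<bullet> b < u f \<bullet> b})"
      by (auto simp: Q_iff)
    moreover have "{x :: 'a. l f \<bullet> b \<le> x \<bullet> b} \<inter> {x. x \<bullet> b < u f \<bullet> b} \<in> sets borel" for b
      by (intro sets.Int borel_closed borel_open closed_halfspace_component_ge open_halfspace_component_lt)
    ultimately show ?thesis by (auto intro!: sets.finite_INT)
  qed
  show thesis
  proof (rule that[of "Q ` F"])
    show "finite (Q ` F)" unfolding F_def by (intro finite_imageI finite_PiE) auto
    show "disjoint (Q ` F)"
    proof (rule disjointI)
      fix a b assume "a \<in> Q ` F" "b \<in> Q ` F" "a \<noteq> b"
      then obtain f g where fg: "a = Q f" "b = Q g" by auto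
      have "Q f = Q g" if "x \<in> Q f" "x \<in> Q g" for x
        using that by (auto simp: Q_def)
      then show "a \<inter> b = {}" using fg \<open>a \<noteq> b\<close> by auto
    qed
    show "\<Omega> \<subseteq> \<Union>(Q ` F)"
    proof
      fix x assume x: "x \<in> \<Omega>"
      define f where "f = restrict (\<lambda>b. \<lfloor>(x \<bullet> b) / \<epsilon>\<rfloor>) Basis"
      have "\<lfloor>(x \<bullet> b) / \<epsilon>\<rfloor> \<in> {-m..m}" if b: "b \<in> Basis" for b
      proof -
        have "\<bar>x \<bullet> b\<bar> \<le> B" using Basis_le_norm[OF b, of x] B[OF x] by linarith
        then have "\<bar>x \<bullet> b\<bar> / \<epsilon> \<le> B / \<epsilon>" using \<epsilon> by (intro divide_right_mono) auto
        moreover have "\<bar>(x \<bullet> b) / \<epsilon>\<bar> = \<bar>x \<bullet> b\<bar> / \<epsilon>" using \<epsilon> by (simp add: abs_divide)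
        ultimately have "\<bar>(x \<bullet> b) / \<epsilon>\<bar> \<le> B / \<epsilon>" by (simp only:)
        then show ?thesis unfolding m_def atLeastAtMost_iff by linarith
      qed
      then have "f \<in> F" by (auto simp: f_def F_def)
      moreover have "x \<in> Q f" by (simp add: Q_def f_def)
      ultimately show "x \<in> \<Union>(Q ` F)" by blast
    qed
    fix S assume "S \<in> Q ` F"
    then obtain f where S: "S = Q f" by blast
    show "S \<in> sets borel" unfolding S by (rule Q_borel)
    have "box (l f) (u f) \<subseteq> Q f" "Q f \<subseteq> cbox (l f) (u f)"
      by (auto simp: Q_iff mem_box less_imp_le)
    then have "emeasure lborel (box (l f) (u f)) \<le> emeasure lborel (Q f)"
      "emeasure lborel (Q f) \<le> emeasure lborel (cbox (l f) (u f))"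
      by (auto intro!: emeasure_mono Q_borel)
    moreover have "l f \<bullet> b \<le> u f \<bullet> b" if "b \<in> Basis" for b using that \<epsilon> by (simp add: lu)
    ultimately show "emeasure lborel S = ennreal (\<epsilon> ^ DIM('a))"
      unfolding S by (simp add: emeasure_lborel_box emeasure_lborel_cbox vol)
    fix x y assume xy: "x \<in> S" "y \<in> S"
    have "norm (x - y) \<le> (\<Sum>b\<in>Basis. \<bar>(x - y) \<bullet> b\<bar>)" by (rule norm_le_l1)
    also have "\<dots> \<le> (\<Sum>b\<in>(Basis :: 'a set). \<epsilon>)"
      using xy unfolding S Q_iff inner_diff_left by (intro sum_mono) (force simp: lu)
    finally show "norm (x - y) \<le> real DIM('a) * \<epsilon>" by simp
  qed
qed

text \<open>The double integral of $(w(x)-w(y))^2$ over $Q\times Q$ in terms of the integrals of \<open>w\<close> and of its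
  square over \<open>Q\<close>.\<close>

lemma mean_oscillation_identity:
  fixes w :: "'a \<Rightarrow> real"
  assumes Q: "Q \<in> sets M" "emeasure M Q = ennreal v" "v \<ge> 0"
    and w: "integrable M (\<lambda>x. indicator Q x * w x)" "integrable M (\<lambda>x. indicator Q x * (w x)\<^sup>2)"
  shows "(\<integral>\<^sup>+x. \<integral>\<^sup>+y. ennreal ((w x - w y)\<^sup>2 * (indicator Q x * indicator Q y)) \<partial>M \<partial>M) =
    ennreal (2 * v * (LINT x|M. indicator Q x * (w x)\<^sup>2) - 2 * (LINT x|M. indicator Q x * w x)\<^sup>2)"
proof -
  define I where "I = (LINT x|M. indicator Q x * w x)"
  define J where "J = (LINT x|M. indicator Q x * (w x)\<^sup>2)"
  have ind: "integrable M (indicator Q :: 'a \<Rightarrow> real)" "(LINT x|M. indicator Q x) = v"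
    using Q by (auto simp: measure_def)
  have inner: "(\<integral>\<^sup>+y. ennreal ((w x - w y)\<^sup>2 * (indicator Q x * indicator Q y)) \<partial>M) =
      ennreal (v * (indicator Q x * (w x)\<^sup>2) - 2 * I * (indicator Q x * w x) + J * indicator Q x)"
    and nonneg: "v * (indicator Q x * (w x)\<^sup>2) - 2 * I * (indicator Q x * w x) + J * indicator Q x \<ge> 0" for x
  proof -
    have eq: "(w x - w y)\<^sup>2 * (indicator Q x * indicator Q y) = (indicator Q x * (w x)\<^sup>2) * indicator Q y
        - (2 * (indicator Q x * w x)) * (indicator Q y * w y) + indicator Q x * (indicator Q y * (w y)\<^sup>2)" for y
      by (simp add: power2_eq_square algebra_simps)
    have "integrable M (\<lambda>y. (w x - w y)\<^sup>2 * (indicator Q x * indicator Q y))"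
      unfolding eq using ind w by simp
    moreover have lint: "(LINT y|M. (w x - w y)\<^sup>2 * (indicator Q x * indicator Q y)) =
        v * (indicator Q x * (w x)\<^sup>2) - 2 * I * (indicator Q x * w x) + J * indicator Q x"
      unfolding eq using ind w by (simp add: I_def J_def)
    ultimately show "(\<integral>\<^sup>+y. ennreal ((w x - w y)\<^sup>2 * (indicator Q x * indicator Q y)) \<partial>M) =
      ennreal (v * (indicator Q x * (w x)\<^sup>2) - 2 * I * (indicator Q x * w x) + J * indicator Q x)"
      by (subst nn_integral_eq_integral) (auto simp: lint)
    show "v * (indicator Q x * (w x)\<^sup>2) - 2 * I * (indicator Q x * w x) + J * indicator Q x \<ge> 0"
      unfolding lint[symmetric] by (intro integral_nonneg_AE) auto
  qed
  have "integrable M (\<lambda>x. v * (indicator Q x * (w x)\<^sup>2) - 2 * I * (indicator Q x * w x) + J * indicator Q x)"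
    using ind w by simp
  moreover have "(LINT x|M. v * (indicator Q x * (w x)\<^sup>2) - 2 * I * (indicator Q x * w x) + J * indicator Q x) =
      v * J - 2 * I * I + J * v"
    using ind w by (simp add: I_def J_def)
  ultimately show ?thesis
    unfolding inner I_def[symmetric] J_def[symmetric] using nonneg
    by (subst nn_integral_eq_integral) (simp_all add: power2_eq_square mult.assoc mult.commute[of v J])
qed

section \<open>Compactness of the embedding into $L^2$\<close>

context radial_kernel begin

lemma kernel_tail_1_finite: "kernel_tail K 1 < \<infinity>"
proof -
  have "kernel_tail K 1 \<le> (\<integral>\<^sup>+y. ennreal (min ((norm y)\<^sup>2) 1 * K y) \<partial>lebesgue)"
    unfolding kernel_tail_def
  proof (intro nn_integral_mono)
    fix y :: 'a
    have "min ((norm y)\<^sup>2) 1 = 1" if "\<not> norm y < 1"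
      using that by (intro min.absorb2) (simp add: one_le_power)
    then show "ennreal (K y) * indicator (- ball 0 1) y \<le> ennreal (min ((norm y)\<^sup>2) 1 * K y)"
      by (auto simp: indicator_def)
  qed
  also have "\<dots> < \<infinity>"
    using K_integrable unfolding integrable_iff_bounded by (auto simp: abs_mult)
  finally show ?thesis .
qed

lemma kernel_tail_half_le:
  assumes r: "r > 0" and M: "K ((r / 2) *\<^sub>R e) \<le> M" and e: "e \<in> Basis"
  shows "kernel_tail K (r / 2) \<le> kernel_tail K r + ennreal (unit_ball_vol (real DIM('a)) * r ^ DIM('a) * M)"
proof -
  have K_le: "K y \<le> M" if "y \<notin> ball 0 (r / 2)" for y
    using that r e nonzero_Basis[OF e] by (intro order_trans[OF K_antimono M]) auto
  have M0: "M \<ge> 0" using M K_nonneg order_trans by blast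
  have [measurable]: "ball (0::'a) r \<in> sets borel" by simp
  have "kernel_tail K (r / 2) \<le> (\<integral>\<^sup>+y. ennreal (K y) * indicator (- ball 0 r) y +
      ennreal M * indicator (ball 0 r) y \<partial>lborel)"
    unfolding kernel_tail_eq using r K_le
    by (intro nn_integral_mono) (auto simp: indicator_def intro!: ennreal_leI)
  also have "(\<integral>\<^sup>+y. ennreal (K y) * indicator (- ball 0 r) y + ennreal M * indicator (ball 0 r) y \<partial>lborel) =
      kernel_tail K r + ennreal M * emeasure lborel (ball (0::'a) r)"
    unfolding kernel_tail_eq by (subst nn_integral_add) (measurable, simp add: nn_integral_cmult_indicator)
  also have "ennreal M * emeasure lborel (ball (0::'a) r) = ennreal (unit_ball_vol (real DIM('a)) * r ^ DIM('a) * M)"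
    using r M0 by (simp add: emeasure_ball mult.commute flip: ennreal_mult)
  finally show ?thesis .
qed

text \<open>If the scaled kernel were bounded, each halving of the radius would add at most a constant to the
  tail, so that the tails would grow only logarithmically.\<close>

lemma scaled_kernel_unbounded:
  assumes s: "s > 0" and "c > 0" "r\<^sub>0 > 0"
    and tail: "\<And>r. 0 < r \<Longrightarrow> r \<le> r\<^sub>0 \<Longrightarrow> ennreal (c * r powr (- (2 * s))) \<le> kernel_tail K r"
  obtains t where "t > 0" "\<And>z. z \<noteq> 0 \<Longrightarrow> norm z \<le> t \<Longrightarrow> M \<le> t ^ DIM('a) * K z"
proof (rule ccontr)
  assume "\<not> thesis"
  note witness = that
  have neg: "\<exists>z. z \<noteq> 0 \<and> norm z \<le> t \<and> t ^ DIM('a) * K z < M" if "t > 0" for t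
    using witness[of t] that \<open>\<not> thesis\<close> not_le by blast
  obtain e :: 'a where e: "e \<in> Basis" using nonempty_Basis by blast
  have bound: "t ^ DIM('a) * K (t *\<^sub>R e) \<le> M" if t: "t > 0" for t
  proof -
    from neg[OF t] obtain z where z: "z \<noteq> 0" "norm z \<le> t" "t ^ DIM('a) * K z < M" by blast
    have "K (t *\<^sub>R e) \<le> K z"
      using z t e nonzero_Basis[OF e] by (intro K_antimono) auto
    then have "t ^ DIM('a) * K (t *\<^sub>R e) \<le> t ^ DIM('a) * K z" using t by (intro mult_left_mono) auto
    then show ?thesis using z by linarith
  qed
  define C where "C = unit_ball_vol (real DIM('a)) * 2 ^ DIM('a) * M"
  have M: "M \<ge> 0" using order_trans[OF _ bound[of 1]] by simp
  then have C: "C \<ge> 0" by (simp add: C_def)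
  define T where "T = enn2real (kernel_tail K 1)"
  have T: "kernel_tail K 1 = ennreal T" "T \<ge> 0"
    using kernel_tail_1_finite by (simp_all add: T_def)
  have grow: "kernel_tail K ((1/2) ^ m) \<le> ennreal (T + real m * C)" for m
  proof (induction m)
    case (Suc m)
    define r :: real where "r = (1/2) ^ m"
    have r: "r > 0" by (simp add: r_def)
    have "K ((r / 2) *\<^sub>R e) \<le> M / (r / 2) ^ DIM('a)"
      using bound[of "r / 2"] r by (simp add: field_simps)
    from kernel_tail_half_le[OF r this e]
    have "kernel_tail K (r / 2) \<le> kernel_tail K r + ennreal C"
      using r by (simp add: C_def power_divide mult_ac)
    also have "\<dots> \<le> ennreal (T + real m * C) + ennreal C"
      using Suc by (intro add_right_mono) (simp add: r_def)
    also have "\<dots> = ennreal (T + real (Suc m) * C)"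
      using T C by (simp add: algebra_simps flip: ennreal_plus)
    finally show ?case by (simp add: r_def)
  qed (simp add: T)
  define y :: real where "y = 4 powr (- s)"
  have y: "0 < y" "y < 1" using s powr_less_mono[of "-s" 0 "4::real"] by (simp_all add: y_def)
  have "eventually (\<lambda>m. (1/2) ^ m < r\<^sub>0) sequentially"
    using LIMSEQ_realpow_zero[of "1/2"] \<open>r\<^sub>0 > 0\<close> by (intro order_tendstoD) auto
  then have "eventually (\<lambda>m. c \<le> T * y ^ m + C * (real m * y ^ m)) sequentially"
  proof eventually_elim
    case (elim m)
    have "((1/2) ^ m) powr (- (2 * s)) = (4 powr s) ^ m"
    proof -
      have "((1/2::real) ^ m) powr (- (2 * s)) = ((1/2) powr (- (2 * s))) ^ m"
        by (simp add: powr_powr mult.commute flip: powr_realpow)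
      also have "(1/2::real) powr (- (2 * s)) = (2 powr 2) powr s"
        unfolding powr_powr by (simp add: powr_divide powr_minus)
      finally show ?thesis by simp
    qed
    with elim tail[of "(1/2) ^ m"] have "ennreal (c * (4 powr s) ^ m) \<le> kernel_tail K ((1/2) ^ m)"
      by simp
    also have "\<dots> \<le> ennreal (T + real m * C)" by (rule grow)
    finally have "c * (4 powr s) ^ m \<le> T + real m * C"
      using T C by (subst (asm) ennreal_le_iff) auto
    then have "c * (4 powr s) ^ m * y ^ m \<le> (T + real m * C) * y ^ m"
      using y by (intro mult_right_mono) auto
    moreover have "(4 powr s) ^ m * y ^ m = 1"
      by (simp add: y_def powr_minus flip: power_mult_distrib)
    ultimately show ?case by (simp add: algebra_simps)
  qed
  moreover have "(\<lambda>m. T * y ^ m + C * (real m * y ^ m)) \<longlonglongrightarrow> T * 0 + C * 0"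
    using y by (intro tendsto_intros LIMSEQ_realpow_zero powser_times_n_limit_0) auto
  ultimately have "c \<le> T * 0 + C * 0"
    using tendsto_lowerbound trivial_limit_sequentially by blast
  then show False using \<open>c > 0\<close> by simp
qed

end

context nonlocal_space begin

lemma integral_square_le: "g \<in> X0 \<Longrightarrow> (LINT x|lebesgue. (g x)\<^sup>2) \<le> (nrm g)\<^sup>2"
  by (simp add: norm_X_eq_sqrt_inner inner_X_eq power2_eq_square)

lemma measure_domain_finite: "emeasure lebesgue \<Omega> = ennreal (measure lebesgue \<Omega>)"
  using open_\<Omega> emeasure_bounded_finite[OF bounded_\<Omega>] by (simp add: emeasure_eq_ennreal_measure)

lemma X0_integrable:
  assumes g: "g \<in> X0"
  shows "integrable lebesgue g"
    and "Q \<in> sets lebesgue \<Longrightarrow> \<bar>LINT x|lebesgue. indicator Q x * g x\<bar> \<le> measure lebesgue \<Omega> + (nrm g)\<^sup>2"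
proof -
  note [measurable] = X0_measurable[OF g]
  have ind: "integrable lebesgue (indicator \<Omega> :: 'a \<Rightarrow> real)"
    using measure_domain_finite by (simp add: integrable_indicator_iff)
  have dom: "integrable lebesgue (\<lambda>x. indicator \<Omega> x + (g x)\<^sup>2)"
    using ind g by (simp add: X0_iff)
  have le1: "\<bar>t\<bar> \<le> 1 + t\<^sup>2" for t :: real
  proof -
    have "0 \<le> (\<bar>t\<bar> - 1)\<^sup>2 + 1 + t\<^sup>2" by simp
    then show ?thesis by (simp add: power2_diff)
  qed
  have le: "AE x in lebesgue. \<bar>g x\<bar> \<le> indicator \<Omega> x + (g x)\<^sup>2"
  proof -
    have "AE x in lebesgue. x \<in> - \<Omega> \<longrightarrow> g x = 0" using g by (simp add: X0_iff)
    then show ?thesis by eventually_elim (auto simp: indicator_def le1)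
  qed
  show int: "integrable lebesgue g"
    by (rule Bochner_Integration.integrable_bound[OF dom]) (use le in auto)
  assume Q [measurable]: "Q \<in> sets lebesgue"
  have "\<bar>LINT x|lebesgue. indicator Q x * g x\<bar> \<le> (LINT x|lebesgue. \<bar>indicator Q x * g x\<bar>)"
    by (rule integral_abs_bound)
  also have "\<dots> \<le> (LINT x|lebesgue. indicator \<Omega> x + (g x)\<^sup>2)"
  proof (rule integral_mono_AE[OF _ dom])
    show "integrable lebesgue (\<lambda>x. \<bar>indicator Q x * g x\<bar>)"
      using integrable_mult_indicator[OF Q int] by auto
    show "AE x in lebesgue. \<bar>indicator Q x * g x\<bar> \<le> indicator \<Omega> x + (g x)\<^sup>2"
      using le by eventually_elim (auto simp: indicator_def)
  qed
  also have "\<dots> = measure lebesgue \<Omega> + (LINT x|lebesgue. (g x)\<^sup>2)"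
    using ind g by (simp add: X0_iff)
  also have "\<dots> \<le> measure lebesgue \<Omega> + (nrm g)\<^sup>2"
    using integral_square_le[OF g] by simp
  finally show "\<bar>LINT x|lebesgue. indicator Q x * g x\<bar> \<le> measure lebesgue \<Omega> + (nrm g)\<^sup>2" .
qed

lemma norm_X_diff_le:
  assumes f: "f \<in> X0" and g: "g \<in> X0"
  shows "(nrm (\<lambda>x. f x - g x))\<^sup>2 \<le> 2 * (nrm f)\<^sup>2 + 2 * (nrm g)\<^sup>2"
proof -
  have sq: "(nrm h)\<^sup>2 = inner_X \<Omega> K h h" if "h \<in> X0" for h
    using that by (simp add: norm_X_eq_sqrt_inner inner_X_eq)
  have exp: "inner_X \<Omega> K (\<lambda>x. f x + c * g x) (\<lambda>x. f x + c * g x) =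
      inner_X \<Omega> K f f + 2 * c * inner_X \<Omega> K f g + c\<^sup>2 * inner_X \<Omega> K g g" for c
  proof -
    note X = f g X0_cmult[OF g, of c] X0_add[OF f X0_cmult[OF g, of c]]
    let ?h = "\<lambda>x. f x + c * g x"
    have "inner_X \<Omega> K ?h ?h = inner_X \<Omega> K f ?h + c * inner_X \<Omega> K g ?h"
      by (simp add: inner_X_linear(2)[OF f X(3) X(4)] inner_X_linear(3)[OF g X(4)])
    also have "inner_X \<Omega> K f ?h = inner_X \<Omega> K f f + c * inner_X \<Omega> K f g"
      by (simp add: inner_X_linear(1)[OF f X(4)] inner_X_linear(2)[OF f X(3) f] inner_X_linear(3)[OF g f]
          inner_X_linear(1)[OF f g])
    also have "inner_X \<Omega> K g ?h = inner_X \<Omega> K f g + c * inner_X \<Omega> K g g"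
      by (simp add: inner_X_linear(1)[OF g X(4)] inner_X_linear(2)[OF f X(3) g] inner_X_linear(3)[OF g g])
    finally show ?thesis by (simp add: power2_eq_square algebra_simps)
  qed
  have "0 \<le> inner_X \<Omega> K (\<lambda>x. f x + 1 * g x) (\<lambda>x. f x + 1 * g x)"
    using sq[OF X0_add[OF f X0_cmult[OF g, of 1]]] by (metis zero_le_power2)
  moreover have "(nrm (\<lambda>x. f x - g x))\<^sup>2 = inner_X \<Omega> K (\<lambda>x. f x + (-1) * g x) (\<lambda>x. f x + (-1) * g x)"
    using sq[OF X0_diff[OF f g]] by simp
  ultimately show ?thesis
    unfolding exp using sq[OF f] sq[OF g] by simp
qed

text \<open>On each cube the integral of the square is the contribution of the mean value plus the mean
  square oscillation. The oscillations on all cubes together are at most the energy divided by a lower bound of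
  the kernel, which is where the large constant \<open>M\<close> enters.\<close>

lemma L2_le_cube_means:
  fixes \<epsilon> M :: real
  assumes w: "w \<in> X0" and M: "M > 0" and \<epsilon>: "\<epsilon> > 0"
    and \<Q>: "finite \<Q>" "disjoint \<Q>" "\<Omega> \<subseteq> \<Union>\<Q>" "\<And>Q. Q \<in> \<Q> \<Longrightarrow> Q \<in> sets borel"
      "\<And>Q. Q \<in> \<Q> \<Longrightarrow> emeasure lborel Q = ennreal (\<epsilon> ^ DIM('a))"
      "\<And>Q x y. Q \<in> \<Q> \<Longrightarrow> x \<in> Q \<Longrightarrow> y \<in> Q \<Longrightarrow> norm (x - y) \<le> real DIM('a) * \<epsilon>"
    and K: "\<And>z. z \<noteq> 0 \<Longrightarrow> norm z \<le> real DIM('a) * \<epsilon> \<Longrightarrow> M \<le> (real DIM('a) * \<epsilon>) ^ DIM('a) * K z"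
  shows "(\<integral>\<^sup>+x. ennreal ((w x)\<^sup>2) \<partial>lebesgue) \<le>
    ennreal ((\<Sum>Q\<in>\<Q>. (LINT x|lebesgue. indicator Q x * w x)\<^sup>2) / \<epsilon> ^ DIM('a) +
      real DIM('a) ^ DIM('a) / M * (nrm w)\<^sup>2)"
proof -
  define N where "N = DIM('a)"
  define v where "v = \<epsilon> ^ N"
  have v: "v > 0" using \<epsilon> by (simp add: v_def)
  define D where "D = (real N * \<epsilon>) ^ N / M"
  have D: "D \<ge> 0" using M \<epsilon> by (simp add: D_def)
  from X0_borel_representative[OF w] obtain w' where w' [measurable]: "w' \<in> borel_measurable borel"
    and ae: "AE x in lebesgue. w x = w' x" and off: "\<And>x. x \<notin> \<Omega> \<Longrightarrow> w' x = 0"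
    and energy: "(\<integral>\<^sup>+x. \<integral>\<^sup>+y. ennreal ((w' x - w' y)\<^sup>2 * K (x - y)) \<partial>lborel \<partial>lborel) \<le> ennreal ((nrm w)\<^sup>2)"
    by blast
  note [measurable] = X0_measurable[OF w]
  have [measurable]: "w' \<in> borel_measurable lebesgue" by (intro measurable_completion) simp
  define I where "I Q = (LINT x|lborel. indicator Q x * w' x)" for Q
  define J where "J Q = (LINT x|lborel. indicator Q x * (w' x)\<^sup>2)" for Q
  have int: "integrable lborel w'" "integrable lborel (\<lambda>x. (w' x)\<^sup>2)"
  proof -
    have "integrable lebesgue w'"
      by (rule integrable_cong_AE[THEN iffD1, OF _ _ ae X0_integrable(1)[OF w]]) measurable
    then show "integrable lborel w'" by (simp add: integrable_completion)
    have "integrable lebesgue (\<lambda>x. (w' x)\<^sup>2)"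
      by (rule integrable_cong_AE[THEN iffD1, of "\<lambda>x. (w x)\<^sup>2"]) (use ae w in \<open>auto simp: X0_iff\<close>)
    then show "integrable lborel (\<lambda>x. (w' x)\<^sup>2)" by (simp add: integrable_completion)
  qed
  have intQ: "integrable lborel (\<lambda>x. indicator Q x * w' x)" "integrable lborel (\<lambda>x. indicator Q x * (w' x)\<^sup>2)"
    if "Q \<in> \<Q>" for Q
    using integrable_mult_indicator[OF _ int(1), of Q] integrable_mult_indicator[OF _ int(2), of Q] \<Q>(4)[OF that]
    by simp_all
  have I_eq: "I Q = (LINT x|lebesgue. indicator Q x * w x)" if "Q \<in> \<Q>" for Q
  proof -
    have [measurable]: "Q \<in> sets borel" by (rule \<Q>(4)[OF that])
    have "(LINT x|lebesgue. indicator Q x * w x) = (LINT x|lebesgue. indicator Q x * w' x)"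
    proof (rule integral_cong_AE)
      have [measurable]: "Q \<in> sets lebesgue" by simp
      show "(\<lambda>x. indicator Q x * w x) \<in> borel_measurable lebesgue"
        "(\<lambda>x. indicator Q x * w' x) \<in> borel_measurable lebesgue" by measurable
    qed (use ae in auto)
    also have "\<dots> = I Q" unfolding I_def by (rule integral_completion) measurable
    finally show ?thesis by simp
  qed
  have osc: "(\<integral>\<^sup>+x. \<integral>\<^sup>+y. ennreal ((w' x - w' y)\<^sup>2 * (indicator Q x * indicator Q y)) \<partial>lborel \<partial>lborel) =
      ennreal (2 * v * J Q - 2 * (I Q)\<^sup>2)" if "Q \<in> \<Q>" for Q
    unfolding I_def J_def using \<Q>(4,5)[OF that] v intQ[OF that]
    by (intro mean_oscillation_identity) (auto simp: v_def N_def)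
  have "ennreal (\<Sum>Q\<in>\<Q>. max 0 (2 * v * J Q - 2 * (I Q)\<^sup>2)) = (\<Sum>Q\<in>\<Q>. ennreal (2 * v * J Q - 2 * (I Q)\<^sup>2))"
  proof -
    have max0: "ennreal (max 0 t) = ennreal t" for t by (simp add: max_def ennreal_neg)
    have "(\<Sum>Q\<in>\<Q>. ennreal (max 0 (2 * v * J Q - 2 * (I Q)\<^sup>2))) =
        ennreal (\<Sum>Q\<in>\<Q>. max 0 (2 * v * J Q - 2 * (I Q)\<^sup>2))"
      by (rule sum_ennreal) simp
    then show ?thesis by (simp only: max0)
  qed
  also have "\<dots> = (\<Sum>Q\<in>\<Q>. \<integral>\<^sup>+x. \<integral>\<^sup>+y. ennreal ((w' x - w' y)\<^sup>2 * (indicator Q x * indicator Q y)) \<partial>lborel \<partial>lborel)"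
    by (intro sum.cong osc[symmetric] refl)
  also have "\<dots> = (\<integral>\<^sup>+x. \<integral>\<^sup>+y. (\<Sum>Q\<in>\<Q>. ennreal ((w' x - w' y)\<^sup>2 * (indicator Q x * indicator Q y))) \<partial>lborel \<partial>lborel)"
  proof -
    have 1: "(\<lambda>y. ennreal ((w' x - w' y)\<^sup>2 * (indicator Q x * indicator Q y))) \<in> borel_measurable lborel"
      "(\<lambda>x. \<integral>\<^sup>+y. ennreal ((w' x - w' y)\<^sup>2 * (indicator Q x * indicator Q y)) \<partial>lborel) \<in> borel_measurable lborel"
      if "Q \<in> \<Q>" for Q x
    proof -
      have [measurable]: "Q \<in> sets borel" by (rule \<Q>(4)[OF that])
      show "(\<lambda>y. ennreal ((w' x - w' y)\<^sup>2 * (indicator Q x * indicator Q y))) \<in> borel_measurable lborel"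
        by measurable
      show "(\<lambda>x. \<integral>\<^sup>+y. ennreal ((w' x - w' y)\<^sup>2 * (indicator Q x * indicator Q y)) \<partial>lborel) \<in> borel_measurable lborel"
        by measurable
    qed
    have "(\<Sum>Q\<in>\<Q>. \<integral>\<^sup>+x. \<integral>\<^sup>+y. ennreal ((w' x - w' y)\<^sup>2 * (indicator Q x * indicator Q y)) \<partial>lborel \<partial>lborel) =
        (\<integral>\<^sup>+x. (\<Sum>Q\<in>\<Q>. \<integral>\<^sup>+y. ennreal ((w' x - w' y)\<^sup>2 * (indicator Q x * indicator Q y)) \<partial>lborel) \<partial>lborel)"
      by (rule nn_integral_sum[symmetric]) (rule 1(2))
    also have "\<dots> = (\<integral>\<^sup>+x. \<integral>\<^sup>+y. (\<Sum>Q\<in>\<Q>. ennreal ((w' x - w' y)\<^sup>2 * (indicator Q x * indicator Q y))) \<partial>lborel \<partial>lborel)"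
      by (intro nn_integral_cong nn_integral_sum[symmetric] 1(1))
    finally show ?thesis .
  qed
  also have "\<dots> \<le> (\<integral>\<^sup>+x. \<integral>\<^sup>+y. ennreal D * ennreal ((w' x - w' y)\<^sup>2 * K (x - y)) \<partial>lborel \<partial>lborel)"
  proof (intro nn_integral_mono)
    fix x y
    show "(\<Sum>Q\<in>\<Q>. ennreal ((w' x - w' y)\<^sup>2 * (indicator Q x * indicator Q y))) \<le>
        ennreal D * ennreal ((w' x - w' y)\<^sup>2 * K (x - y))"
    proof (cases "x \<noteq> y \<and> (\<exists>Q\<in>\<Q>. x \<in> Q \<and> y \<in> Q)")
      case True
      then obtain P where P: "P \<in> \<Q>" "x \<in> P" "y \<in> P" by blast
      have unique: "x \<notin> Q" if "Q \<in> \<Q>" "Q \<noteq> P" for Q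
        using disjointD[OF \<Q>(2) that(1) P(1)] that P by blast
      have "(\<Sum>Q\<in>\<Q>. ennreal ((w' x - w' y)\<^sup>2 * (indicator Q x * indicator Q y))) =
          (\<Sum>Q\<in>\<Q>. if Q = P then ennreal ((w' x - w' y)\<^sup>2) else 0)"
        using P unique by (intro sum.cong) (auto simp: indicator_def)
      also have "\<dots> = ennreal ((w' x - w' y)\<^sup>2)" using P \<Q>(1) by simp
      also have "\<dots> \<le> ennreal (D * ((w' x - w' y)\<^sup>2 * K (x - y)))"
      proof (rule ennreal_leI)
        have "M \<le> (real N * \<epsilon>) ^ N * K (x - y)"
          using True \<Q>(6)[OF P] unfolding N_def by (intro K) auto
        then have "1 \<le> D * K (x - y)" using M by (simp add: D_def field_simps)
        then have "(w' x - w' y)\<^sup>2 * 1 \<le> (w' x - w' y)\<^sup>2 * (D * K (x - y))"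
          by (intro mult_left_mono) auto
        then show "(w' x - w' y)\<^sup>2 \<le> D * ((w' x - w' y)\<^sup>2 * K (x - y))" by (simp add: mult_ac)
      qed
      finally show ?thesis using D by (simp add: ennreal_mult)
    next
      case False
      then have "ennreal ((w' x - w' y)\<^sup>2 * (indicator Q x * indicator Q y)) = 0" if "Q \<in> \<Q>" for Q
        using that by (auto simp: indicator_def)
      then show ?thesis by (simp add: sum.neutral)
    qed
  qed
  also have "\<dots> = ennreal D * (\<integral>\<^sup>+x. \<integral>\<^sup>+y. ennreal ((w' x - w' y)\<^sup>2 * K (x - y)) \<partial>lborel \<partial>lborel)"
    by (simp add: nn_integral_cmult)
  also have "\<dots> \<le> ennreal D * ennreal ((nrm w)\<^sup>2)"
    by (intro mult_left_mono energy) auto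
  also have "\<dots> = ennreal (D * (nrm w)\<^sup>2)" using D by (simp add: ennreal_mult)
  finally have max_le: "(\<Sum>Q\<in>\<Q>. max 0 (2 * v * J Q - 2 * (I Q)\<^sup>2)) \<le> D * (nrm w)\<^sup>2"
    using D by (subst (asm) ennreal_le_iff) auto
  have "(\<Sum>Q\<in>\<Q>. 2 * v * J Q - 2 * (I Q)\<^sup>2) \<le> (\<Sum>Q\<in>\<Q>. max 0 (2 * v * J Q - 2 * (I Q)\<^sup>2))"
    by (intro sum_mono) auto
  also note max_le
  finally have "2 * v * (\<Sum>Q\<in>\<Q>. J Q) - 2 * (\<Sum>Q\<in>\<Q>. (I Q)\<^sup>2) \<le> D * (nrm w)\<^sup>2"
    by (simp add: sum_subtractf sum_distrib_left)
  moreover have "0 \<le> D * (nrm w)\<^sup>2" using D by simp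
  ultimately have "v * (\<Sum>Q\<in>\<Q>. J Q) \<le> (\<Sum>Q\<in>\<Q>. (I Q)\<^sup>2) + D * (nrm w)\<^sup>2"
    by linarith
  then have "(\<Sum>Q\<in>\<Q>. J Q) \<le> ((\<Sum>Q\<in>\<Q>. (I Q)\<^sup>2) + D * (nrm w)\<^sup>2) / v"
    using v by (simp add: field_simps)
  also have "\<dots> = (\<Sum>Q\<in>\<Q>. (I Q)\<^sup>2) / v + real N ^ N / M * (nrm w)\<^sup>2"
    using v \<epsilon> by (simp add: D_def v_def power_mult_distrib add_divide_distrib)
  finally have J_le: "(\<Sum>Q\<in>\<Q>. J Q) \<le> (\<Sum>Q\<in>\<Q>. (I Q)\<^sup>2) / v + real N ^ N / M * (nrm w)\<^sup>2" .
  have "(\<integral>\<^sup>+x. ennreal ((w x)\<^sup>2) \<partial>lebesgue) = (\<integral>\<^sup>+x. ennreal ((w' x)\<^sup>2) \<partial>lebesgue)"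
    using ae by (intro nn_integral_cong_AE) (auto elim: eventually_mono)
  also have "\<dots> = (\<integral>\<^sup>+x. ennreal ((w' x)\<^sup>2) \<partial>lborel)"
    by (rule nn_integral_completion)
  also have "\<dots> \<le> (\<integral>\<^sup>+x. ennreal (\<Sum>Q\<in>\<Q>. indicator Q x * (w' x)\<^sup>2) \<partial>lborel)"
  proof (intro nn_integral_mono ennreal_leI)
    fix x
    show "(w' x)\<^sup>2 \<le> (\<Sum>Q\<in>\<Q>. indicator Q x * (w' x)\<^sup>2)"
    proof (cases "x \<in> \<Omega>")
      case True
      then obtain P where P: "P \<in> \<Q>" "x \<in> P" using \<Q>(3) by blast
      have "(w' x)\<^sup>2 = indicator P x * (w' x)\<^sup>2" using P by simp
      also have "\<dots> \<le> (\<Sum>Q\<in>\<Q>. indicator Q x * (w' x)\<^sup>2)"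
        using P \<Q>(1) by (intro member_le_sum) auto
      finally show ?thesis .
    qed (simp add: off)
  qed
  also have "\<dots> = ennreal (LINT x|lborel. (\<Sum>Q\<in>\<Q>. indicator Q x * (w' x)\<^sup>2))"
    using intQ by (intro nn_integral_eq_integral) (auto intro!: sum_nonneg)
  also have "(LINT x|lborel. (\<Sum>Q\<in>\<Q>. indicator Q x * (w' x)\<^sup>2)) = (\<Sum>Q\<in>\<Q>. J Q)"
    unfolding J_def using intQ by (intro Bochner_Integration.integral_sum) auto
  also have "ennreal (\<Sum>Q\<in>\<Q>. J Q) \<le> ennreal ((\<Sum>Q\<in>\<Q>. (I Q)\<^sup>2) / v + real N ^ N / M * (nrm w)\<^sup>2)"
    by (intro ennreal_leI J_le)
  also have "(\<Sum>Q\<in>\<Q>. (I Q)\<^sup>2) = (\<Sum>Q\<in>\<Q>. (LINT x|lebesgue. indicator Q x * w x)\<^sup>2)"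
    by (simp add: I_eq)
  finally show ?thesis by (simp add: v_def N_def)
qed

text \<open>For each \<open>j\<close> there is a partition into cubes adapted to the bound $M=j+1$. All the cubes together form
  a countable family, so along a subsequence the integrals over each of them converge.\<close>

theorem L2_Cauchy_subsequence:
  fixes u :: "nat \<Rightarrow> 'a \<Rightarrow> real"
  assumes u: "\<And>n. u n \<in> X0" "\<And>n. nrm (u n) \<le> B"
    and unbounded: "\<And>M. \<exists>t>0. \<forall>z. z \<noteq> 0 \<longrightarrow> norm z \<le> t \<longrightarrow> M \<le> t ^ DIM('a) * K z"
  shows "\<exists>r :: nat \<Rightarrow> nat. strict_mono r \<and> (\<forall>e>0. \<exists>n\<^sub>0. \<forall>m\<ge>n\<^sub>0. \<forall>n\<ge>n\<^sub>0.
       (\<integral>\<^sup>+x. ennreal ((u (r m) x - u (r n) x)\<^sup>2) \<partial>lebesgue) < ennreal e)"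
proof -
  define N where "N = DIM('a)"
  have N: "N > 0" by (simp add: N_def)
  \<comment> \<open>the sides are scaled such that the cubes have diameter at most the radius \<open>t\<close> given for \<open>j + 1\<close>\<close>
  define P where "P j \<epsilon> \<Q> \<longleftrightarrow> \<epsilon> > 0 \<and> finite \<Q> \<and> disjoint \<Q> \<and> \<Omega> \<subseteq> \<Union>\<Q> \<and>
      (\<forall>Q\<in>\<Q>. Q \<in> sets borel \<and> emeasure lborel Q = ennreal (\<epsilon> ^ N) \<and>
        (\<forall>x\<in>Q. \<forall>y\<in>Q. norm (x - y) \<le> real N * \<epsilon>)) \<and>
      (\<forall>z. z \<noteq> 0 \<longrightarrow> norm z \<le> real N * \<epsilon> \<longrightarrow> real (Suc j) \<le> (real N * \<epsilon>) ^ N * K z)"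
    for j :: nat and \<epsilon> :: real and \<Q> :: "'a set set"
  have "\<exists>\<epsilon> \<Q>. P j \<epsilon> \<Q>" for j
  proof -
    from unbounded[of "real (Suc j)"] obtain t where t: "t > 0"
      "\<And>z. z \<noteq> 0 \<Longrightarrow> norm z \<le> t \<Longrightarrow> real (Suc j) \<le> t ^ N * K z"
      unfolding N_def by blast
    define \<epsilon> where "\<epsilon> = t / real N"
    have \<epsilon>: "\<epsilon> > 0" "real N * \<epsilon> = t" using t N by (auto simp: \<epsilon>_def)
    show ?thesis
    proof (rule ex_cube_partition[OF bounded_\<Omega> \<epsilon>(1)])
      fix \<Q> assume "finite \<Q>" "disjoint \<Q>" "\<Omega> \<subseteq> \<Union>\<Q>" "\<And>Q. Q \<in> \<Q> \<Longrightarrow> Q \<in> sets borel"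
        "\<And>Q. Q \<in> \<Q> \<Longrightarrow> emeasure lborel Q = ennreal (\<epsilon> ^ DIM('a))"
        "\<And>Q x y. Q \<in> \<Q> \<Longrightarrow> x \<in> Q \<Longrightarrow> y \<in> Q \<Longrightarrow> norm (x - y) \<le> real DIM('a) * \<epsilon>"
      then have "P j \<epsilon> \<Q>"
        unfolding P_def using t \<epsilon> by (simp add: N_def)
      then show ?thesis by blast
    qed
  qed
  then obtain \<epsilon> \<Q> where P: "\<And>j. P j (\<epsilon> j) (\<Q> j)" by metis
  have countable: "countable (\<Union>j. \<Q> j)"
    using P by (intro countable_UN) (auto simp: P_def intro: countable_finite)
  have "B \<ge> 0" using order_trans[OF norm_X_nonneg u(2)] u(1) by blast
  have mean_le: "norm (LINT x|lebesgue. indicator Q x * u n x) \<le> measure lebesgue \<Omega> + B\<^sup>2"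
    if "Q \<in> (\<Union>j. \<Q> j)" for n Q
  proof -
    have "Q \<in> sets lebesgue" using that P by (auto simp: P_def)
    from X0_integrable(2)[OF u(1) this, of n] show ?thesis
      using power_mono[OF u(2)[of n] norm_X_nonneg[OF u(1)[of n]], of 2] by simp
  qed
  show ?thesis
  proof (rule function_convergent_subsequence[OF countable mean_le])
    fix r :: "nat \<Rightarrow> nat" assume r: "strict_mono r"
      and conv: "\<And>Q. Q \<in> (\<Union>j. \<Q> j) \<Longrightarrow> \<exists>l. (\<lambda>n. LINT x|lebesgue. indicator Q x * u (r n) x) \<longlonglongrightarrow> l"
    show ?thesis
    proof (rule exI[of _ r], intro conjI allI impI r)
      fix e :: real assume e: "e > 0"
      \<comment> \<open>differences have norm at most \<open>2 * B\<close>, so \<open>A / (j + 1)\<close> bounds the oscillation term\<close>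
    define A where "A = real N ^ N * (4 * B\<^sup>2)"
      have A: "A \<ge> 0" by (simp add: A_def)
      obtain j :: nat where j: "2 * A / e < real j" using reals_Archimedean2 by blast
      then have "2 * A < real (Suc j) * e" using e by (simp add: field_simps)
      then have Aj: "A / real (Suc j) < e / 2" by (simp add: field_simps)
      have Pj: "\<epsilon> j > 0" "finite (\<Q> j)" "disjoint (\<Q> j)" "\<Omega> \<subseteq> \<Union>(\<Q> j)" "\<And>Q. Q \<in> \<Q> j \<Longrightarrow> Q \<in> sets borel"
        "\<And>Q. Q \<in> \<Q> j \<Longrightarrow> emeasure lborel Q = ennreal (\<epsilon> j ^ DIM('a))"
        "\<And>Q x y. Q \<in> \<Q> j \<Longrightarrow> x \<in> Q \<Longrightarrow> y \<in> Q \<Longrightarrow> norm (x - y) \<le> real DIM('a) * \<epsilon> j"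
        "\<And>z. z \<noteq> 0 \<Longrightarrow> norm z \<le> real DIM('a) * \<epsilon> j \<Longrightarrow> real (Suc j) \<le> (real DIM('a) * \<epsilon> j) ^ DIM('a) * K z"
        using P[of j] unfolding P_def N_def by blast+
      define I where "I n Q = (LINT x|lebesgue. indicator Q x * u (r n) x)" for n Q
      define \<eta> where "\<eta> = sqrt (e / 2 * \<epsilon> j ^ N / (real (card (\<Q> j)) + 1))"
      have \<eta>: "\<eta> > 0" "\<eta>\<^sup>2 = e / 2 * \<epsilon> j ^ N / (real (card (\<Q> j)) + 1)"
        using e Pj(1) by (auto simp: \<eta>_def intro!: divide_pos_pos)
      have "\<forall>Q\<in>\<Q> j. \<exists>n\<^sub>0. \<forall>m\<ge>n\<^sub>0. \<forall>n\<ge>n\<^sub>0. \<bar>I m Q - I n Q\<bar> < \<eta>"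
      proof
        fix Q assume "Q \<in> \<Q> j"
        then obtain l where "(\<lambda>n. I n Q) \<longlonglongrightarrow> l"
          unfolding I_def using conv by blast
        then have "Cauchy (\<lambda>n. I n Q)" by (rule LIMSEQ_imp_Cauchy)
        from metric_CauchyD[OF this \<eta>(1)] show "\<exists>n\<^sub>0. \<forall>m\<ge>n\<^sub>0. \<forall>n\<ge>n\<^sub>0. \<bar>I m Q - I n Q\<bar> < \<eta>"
          by (simp add: dist_real_def)
      qed
      then obtain n\<^sub>0 where n\<^sub>0: "\<And>Q m n. Q \<in> \<Q> j \<Longrightarrow> m \<ge> n\<^sub>0 Q \<Longrightarrow> n \<ge> n\<^sub>0 Q \<Longrightarrow> \<bar>I m Q - I n Q\<bar> < \<eta>"
        by metis
      have "(\<integral>\<^sup>+x. ennreal ((u (r m) x - u (r n) x)\<^sup>2) \<partial>lebesgue) < ennreal e"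
        if mn: "m \<ge> (\<Sum>Q\<in>\<Q> j. n\<^sub>0 Q)" "n \<ge> (\<Sum>Q\<in>\<Q> j. n\<^sub>0 Q)" for m n
      proof -
        define w where "w x = u (r m) x - u (r n) x" for x
        have w: "w \<in> X0" unfolding w_def by (intro X0_diff u)
        have mean: "(LINT x|lebesgue. indicator Q x * w x) = I m Q - I n Q" if "Q \<in> \<Q> j" for Q
        proof -
          have "integrable lebesgue (\<lambda>x. indicator Q x * u k x)" for k
            using integrable_mult_indicator[OF _ X0_integrable(1)[OF u(1)], of Q k] Pj(5)[OF that] by simp
          then show ?thesis by (simp add: w_def I_def right_diff_distrib)
        qed
        have "(\<Sum>Q\<in>\<Q> j. (LINT x|lebesgue. indicator Q x * w x)\<^sup>2) \<le> (\<Sum>Q\<in>\<Q> j. \<eta>\<^sup>2)"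
        proof (rule sum_mono)
          fix Q assume Q: "Q \<in> \<Q> j"
          have "n\<^sub>0 Q \<le> (\<Sum>Q\<in>\<Q> j. n\<^sub>0 Q)" using Q Pj(2) by (intro member_le_sum) auto
          then have "\<bar>I m Q - I n Q\<bar> < \<eta>" using n\<^sub>0[OF Q] mn by (meson order_trans)
          then have "\<bar>I m Q - I n Q\<bar>\<^sup>2 \<le> \<eta>\<^sup>2" by (intro power_mono) auto
          then show "(LINT x|lebesgue. indicator Q x * w x)\<^sup>2 \<le> \<eta>\<^sup>2" by (simp add: mean[OF Q])
        qed
        also have "\<dots> \<le> e / 2 * \<epsilon> j ^ N"
          using e Pj(1) by (simp add: \<eta>(2) field_simps)
        finally have "(\<Sum>Q\<in>\<Q> j. (LINT x|lebesgue. indicator Q x * w x)\<^sup>2) / \<epsilon> j ^ N \<le> e / 2"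
          using Pj(1) by (simp add: field_simps)
        moreover have "real N ^ N / real (Suc j) * (nrm w)\<^sup>2 < e / 2"
        proof -
          have "(nrm w)\<^sup>2 \<le> 2 * (nrm (u (r m)))\<^sup>2 + 2 * (nrm (u (r n)))\<^sup>2"
            unfolding w_def by (intro norm_X_diff_le u)
          also have "\<dots> \<le> 2 * B\<^sup>2 + 2 * B\<^sup>2"
            by (intro add_mono mult_left_mono power_mono u norm_X_nonneg) auto
          finally have "real N ^ N / real (Suc j) * (nrm w)\<^sup>2 \<le> real N ^ N / real (Suc j) * (4 * B\<^sup>2)"
            by (intro mult_left_mono) auto
          also have "\<dots> = A / real (Suc j)" by (simp add: A_def)
          finally show ?thesis using Aj by linarith
        qed
        ultimately have less: "(\<Sum>Q\<in>\<Q> j. (LINT x|lebesgue. indicator Q x * w x)\<^sup>2) / \<epsilon> j ^ N +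
            real N ^ N / real (Suc j) * (nrm w)\<^sup>2 < e" by linarith
        have "(\<integral>\<^sup>+x. ennreal ((w x)\<^sup>2) \<partial>lebesgue) \<le> ennreal ((\<Sum>Q\<in>\<Q> j. (LINT x|lebesgue. indicator Q x * w x)\<^sup>2) / \<epsilon> j ^ N +
            real N ^ N / real (Suc j) * (nrm w)\<^sup>2)"
          unfolding N_def by (rule L2_le_cube_means[OF w _ Pj]) simp
        also have "\<dots> < ennreal e" by (rule ennreal_lessI[OF e less])
        finally show ?thesis by (simp add: w_def)
      qed
      then show "\<exists>n\<^sub>0. \<forall>m\<ge>n\<^sub>0. \<forall>n\<ge>n\<^sub>0. (\<integral>\<^sup>+x. ennreal ((u (r m) x - u (r n) x)\<^sup>2) \<partial>lebesgue) < ennreal e"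
        by blast
    qed
  qed
qed

end

section \<open>Embeddings into Lebesgue spaces\<close>

context nonlocal_space begin

text \<open>The \<open>q\<close>-th power of the norm of $L^q(\Omega)$, possibly infinite.\<close>

definition Lq_integral :: "real \<Rightarrow> ('a \<Rightarrow> real) \<Rightarrow> ennreal" where
  "Lq_integral q g = (\<integral>\<^sup>+x. ennreal (\<bar>g x\<bar> powr q) * indicator \<Omega> x \<partial>lebesgue)"

text \<open>The integral of the \<open>q\<close>-th power is bounded on some ball of $X_0$ around the origin. By homogeneity this
  amounts to a bound of the norm of $L^q(\Omega)$ by that of $X_0$.\<close>

definition Lq_bounded :: "real \<Rightarrow> bool" where
  "Lq_bounded q \<longleftrightarrow> (\<exists>\<delta>>0. \<exists>C\<ge>0. \<forall>g\<in>X0. nrm g \<le> \<delta> \<longrightarrow> Lq_integral q g \<le> ennreal C)"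

lemma Lq_bounded_mono:
  assumes q: "0 < q" "q \<le> q'" and "Lq_bounded q'"
  shows "Lq_bounded q"
proof -
  from \<open>Lq_bounded q'\<close> obtain \<delta> C where \<delta>: "\<delta> > 0" and C: "C \<ge> 0"
    and bound: "\<And>g. g \<in> X0 \<Longrightarrow> nrm g \<le> \<delta> \<Longrightarrow> Lq_integral q' g \<le> ennreal C"
    unfolding Lq_bounded_def by blast
  have powr_le: "\<bar>t\<bar> powr q \<le> 1 + \<bar>t\<bar> powr q'" for t :: real
  proof (cases "\<bar>t\<bar> \<le> 1")
    case True
    then have "\<bar>t\<bar> powr q \<le> 1" using q powr_mono2[of q "\<bar>t\<bar>" 1] by simp
    then show ?thesis by (simp add: add_increasing2)
  next
    case False
    then have "\<bar>t\<bar> powr q \<le> \<bar>t\<bar> powr q'" using q by (intro powr_mono) auto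
    then show ?thesis by linarith
  qed
  have "Lq_integral q g \<le> ennreal (measure lebesgue \<Omega> + C)" if g: "g \<in> X0" "nrm g \<le> \<delta>" for g
  proof -
    note [measurable] = X0_measurable[OF g(1)]
    have "Lq_integral q g \<le> (\<integral>\<^sup>+x. indicator \<Omega> x + ennreal (\<bar>g x\<bar> powr q') * indicator \<Omega> x \<partial>lebesgue)"
      unfolding Lq_integral_def
    proof (rule nn_integral_mono)
      fix x
      have "ennreal (\<bar>g x\<bar> powr q) \<le> ennreal (1 + \<bar>g x\<bar> powr q')"
        by (rule ennreal_leI[OF powr_le])
      then show "ennreal (\<bar>g x\<bar> powr q) * indicator \<Omega> x \<le> indicator \<Omega> x + ennreal (\<bar>g x\<bar> powr q') * indicator \<Omega> x"
        by (simp add: indicator_def)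
    qed
    also have "\<dots> = emeasure lebesgue \<Omega> + Lq_integral q' g"
      unfolding Lq_integral_def by (subst nn_integral_add) (simp_all add: region_sets)
    also have "\<dots> \<le> ennreal (measure lebesgue \<Omega>) + ennreal C"
      unfolding measure_domain_finite by (intro add_left_mono bound g)
    also have "\<dots> = ennreal (measure lebesgue \<Omega> + C)" using C by simp
    finally show ?thesis .
  qed
  then show ?thesis
    unfolding Lq_bounded_def using \<delta> C by (intro exI[of _ \<delta>] conjI exI[of _ "measure lebesgue \<Omega> + C"]) auto
qed

lemma norm_X_cmult: "g \<in> X0 \<Longrightarrow> nrm (\<lambda>x. c * g x) = \<bar>c\<bar> * nrm g"
proof -
  assume g: "g \<in> X0"
  have "inner_X \<Omega> K (\<lambda>x. c * g x) (\<lambda>x. c * g x) = c\<^sup>2 * inner_X \<Omega> K g g"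
    using inner_X_linear(1)[OF g X0_cmult[OF g, of c]] inner_X_linear(3)[OF g g, of c]
      inner_X_linear(3)[OF g X0_cmult[OF g, of c], of c]
    by (simp add: power2_eq_square)
  then show ?thesis by (simp add: norm_X_eq_sqrt_inner real_sqrt_mult)
qed

lemma Lq_integral_le_norm:
  assumes q: "q > 0" and "Lq_bounded q"
  obtains C where "C > 0" "\<And>g. g \<in> X0 \<Longrightarrow> Lq_integral q g \<le> ennreal ((C * nrm g) powr q)"
proof -
  from \<open>Lq_bounded q\<close> obtain \<delta> C where \<delta>: "\<delta> > 0" and C: "C \<ge> 0"
    and bound: "\<And>g. g \<in> X0 \<Longrightarrow> nrm g \<le> \<delta> \<Longrightarrow> Lq_integral q g \<le> ennreal C"
    unfolding Lq_bounded_def by blast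
  define C' where "C' = (C + 1) powr (1 / q) / \<delta>"
  show thesis
  proof (rule that[of C'])
    show "C' > 0" using \<delta> C by (simp add: C'_def)
    fix g assume g: "g \<in> X0"
    note [measurable] = X0_measurable[OF g]
    show "Lq_integral q g \<le> ennreal ((C' * nrm g) powr q)"
    proof (cases "nrm g = 0")
      case True
      then have "AE x in lebesgue. g x = 0"
        using hilbert_space_X0 g unfolding hilbert_space_mod_AE_def by auto
      then have "Lq_integral q g = (\<integral>\<^sup>+x. 0 \<partial>(lebesgue :: 'a measure))"
        unfolding Lq_integral_def by (intro nn_integral_cong_AE) auto
      then show ?thesis by simp
    next
      case False
      then have pos: "nrm g > 0" using norm_X_nonneg[OF g] by simp
      define c where "c = \<delta> / nrm g"
      have c: "c > 0" using pos \<delta> by (simp add: c_def)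
      have "nrm (\<lambda>x. c * g x) \<le> \<delta>" unfolding norm_X_cmult[OF g] using pos \<delta> by (simp add: c_def)
      then have "Lq_integral q (\<lambda>x. c * g x) \<le> ennreal C" by (intro bound X0_cmult g)
      moreover have "Lq_integral q (\<lambda>x. c * g x) = ennreal (c powr q) * Lq_integral q g"
        unfolding Lq_integral_def using c
        by (subst nn_integral_cmult[symmetric])
          (auto simp: abs_mult powr_mult ennreal_mult mult.assoc)
      ultimately have "ennreal (c powr (- q)) * (ennreal (c powr q) * Lq_integral q g) \<le> ennreal (c powr (- q)) * ennreal C"
        by (intro mult_left_mono) auto
      moreover have "ennreal (c powr (- q)) * ennreal (c powr q) = 1"
        using c by (simp flip: ennreal_mult powr_add)
      ultimately have "Lq_integral q g \<le> ennreal (c powr (- q) * C)"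
        using C by (simp add: ennreal_mult mult.assoc[symmetric])
      also have "\<dots> \<le> ennreal (c powr (- q) * (C + 1))" by (intro ennreal_leI mult_left_mono) auto
      also have "c powr (- q) * (C + 1) = (C' * nrm g) powr q"
        using q C c pos \<delta> by (simp add: C'_def c_def powr_mult powr_divide powr_powr powr_minus field_simps)
      finally show ?thesis .
    qed
  qed
qed

lemma space_L_norm_L_le:
  assumes [measurable]: "g \<in> borel_measurable lebesgue" and q: "q > 0" and c: "c \<ge> 0"
    and le: "Lq_integral q g \<le> ennreal (c powr q)"
  shows "g \<in> space_L (ereal q) \<Omega>" "norm_L (ereal q) \<Omega> g \<le> c"
proof -
  have nn: "(\<integral>\<^sup>+x. ennreal (indicator \<Omega> x * \<bar>g x\<bar> powr q) \<partial>lebesgue) = Lq_integral q g"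
    unfolding Lq_integral_def by (intro nn_integral_cong) (auto simp: indicator_def)
  have int: "integrable lebesgue (\<lambda>x. indicator \<Omega> x * \<bar>g x\<bar> powr q)"
    using le by (intro integrableI_nonneg) (auto simp: nn order.strict_trans1)
  then show "g \<in> space_L (ereal q) \<Omega>"
    unfolding space_L_def by (auto simp: set_borel_measurable_def set_integrable_def)
  have "ennreal (LINT x|lebesgue. indicator \<Omega> x * \<bar>g x\<bar> powr q) = Lq_integral q g"
    unfolding nn[symmetric] using int by (intro nn_integral_eq_integral[symmetric]) auto
  with le have "ennreal (LINT x|lebesgue. indicator \<Omega> x * \<bar>g x\<bar> powr q) \<le> ennreal (c powr q)"
    by simp
  then have "(LINT x|lebesgue. indicator \<Omega> x * \<bar>g x\<bar> powr q) \<le> c powr q"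
    by (subst (asm) ennreal_le_iff) auto
  then have "(LINT x|lebesgue. indicator \<Omega> x * \<bar>g x\<bar> powr q) powr (1 / q) \<le> (c powr q) powr (1 / q)"
    using q by (intro powr_mono2) auto
  then show "norm_L (ereal q) \<Omega> g \<le> c"
    using q c by (simp add: norm_L_def set_lebesgue_integral_def powr_powr)
qed

lemma Lq_integral_Fatou:
  assumes [measurable]: "\<And>n. v n \<in> borel_measurable lebesgue" and q: "q > 0"
    and lim: "AE x in lebesgue. (\<lambda>n. v n x) \<longlonglongrightarrow> f x"
    and le: "\<And>n. Lq_integral q (v n) \<le> c"
  shows "Lq_integral q f \<le> c"
proof -
  have "Lq_integral q f = (\<integral>\<^sup>+x. liminf (\<lambda>n. ennreal (\<bar>v n x\<bar> powr q) * indicator \<Omega> x) \<partial>lebesgue)"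
    unfolding Lq_integral_def
  proof (rule nn_integral_cong_AE)
    show "AE x in lebesgue. ennreal (\<bar>f x\<bar> powr q) * indicator \<Omega> x =
        liminf (\<lambda>n. ennreal (\<bar>v n x\<bar> powr q) * indicator \<Omega> x)"
      using lim
    proof eventually_elim
      case (elim x)
      have "(\<lambda>n. \<bar>v n x\<bar> powr q) \<longlonglongrightarrow> \<bar>f x\<bar> powr q"
        using q by (intro tendsto_powr' tendsto_rabs elim tendsto_const) auto
      then have "(\<lambda>n. ennreal (\<bar>v n x\<bar> powr q) * indicator \<Omega> x) \<longlonglongrightarrow> ennreal (\<bar>f x\<bar> powr q) * indicator \<Omega> x"
        by (auto simp: indicator_def intro!: tendsto_ennrealI)
      then show ?case by (rule lim_imp_Liminf[OF sequentially_bot, symmetric])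
    qed
  qed
  also have "\<dots> \<le> liminf (\<lambda>n. Lq_integral q (v n))"
    unfolding Lq_integral_def by (intro nn_integral_liminf) measurable
  also have "\<dots> \<le> liminf (\<lambda>n. c)" by (intro Liminf_mono always_eventually allI le)
  also have "\<dots> = c" by (simp add: Liminf_const)
  finally show ?thesis .
qed

theorem continuous_embedding:
  assumes q: "q \<ge> 1" and bounded: "Lq_bounded q"
  shows "continuous_embedding_L X0 nrm (ereal q) \<Omega>"
    and "\<exists>C>0. \<forall>g\<in>X0. norm_L (ereal q) \<Omega> g \<le> C * nrm g"
    and "embeds_L X0 (ereal q) \<Omega>"
proof -
  have q0: "q > 0" using q by simp
  obtain C where C: "C > 0" and le: "\<And>g. g \<in> X0 \<Longrightarrow> Lq_integral q g \<le> ennreal ((C * nrm g) powr q)"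
    using Lq_integral_le_norm[OF q0 bounded] by metis
  have L: "g \<in> space_L (ereal q) \<Omega>" "norm_L (ereal q) \<Omega> g \<le> C * nrm g" if "g \<in> X0" for g
    using space_L_norm_L_le[OF X0_measurable[OF that] q0 _ le[OF that]] C norm_X_nonneg[OF that] by auto
  then show "\<exists>C>0. \<forall>g\<in>X0. norm_L (ereal q) \<Omega> g \<le> C * nrm g" using C by blast
  show emb: "embeds_L X0 (ereal q) \<Omega>"
    unfolding embeds_L_def
  proof (intro conjI ballI impI subsetI L(1))
    fix f g assume "f \<in> X0" "g \<in> X0" and eq: "AE x in lebesgue. x \<in> \<Omega> \<longrightarrow> f x = g x"
    then have "AE x in lebesgue. x \<in> - \<Omega> \<longrightarrow> f x = 0" "AE x in lebesgue. x \<in> - \<Omega> \<longrightarrow> g x = 0"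
      by (simp_all add: X0_iff)
    with eq show "AE x in lebesgue. f x = g x" by eventually_elim auto
  qed
  show "continuous_embedding_L X0 nrm (ereal q) \<Omega>"
    unfolding continuous_embedding_L_def
  proof (intro conjI emb ballI allI impI)
    fix g e assume g: "g \<in> X0" and e: "(e :: real) > 0"
    have "norm_L (ereal q) \<Omega> (\<lambda>x. h x - g x) < e" if "h \<in> X0" "nrm (\<lambda>x. h x - g x) < e / C" for h
      using L(2)[OF X0_diff[OF that(1) g]] that(2) C by (simp add: field_simps)
    then show "\<exists>d>0. \<forall>h\<in>X0. nrm (\<lambda>x. h x - g x) < d \<longrightarrow> norm_L (ereal q) \<Omega> (\<lambda>x. h x - g x) < e"
      using e C by (intro exI[of _ "e / C"]) auto
  qed
qed

text \<open>Interpolation between the convergence in $L^2$ and the bound in $L^{q'}$.\<close>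

theorem compact_embedding:
  assumes q: "1 \<le> q" "q < q'" and bounded: "Lq_bounded q'"
    and unbounded: "\<And>M. \<exists>t>0. \<forall>z. z \<noteq> 0 \<longrightarrow> norm z \<le> t \<longrightarrow> M \<le> t ^ DIM('a) * K z"
  shows "compact_embedding_L X0 nrm (ereal q) \<Omega>"
  unfolding compact_embedding_L_def
proof (intro conjI allI impI)
  have q0: "q > 0" "q' > 0" using q by auto
  have bounded_q: "Lq_bounded q" using q q0 bounded by (intro Lq_bounded_mono[of q q']) auto
  show "embeds_L X0 (ereal q) \<Omega>" by (rule continuous_embedding(3)[OF q(1) bounded_q])
  fix u :: "nat \<Rightarrow> 'a \<Rightarrow> real"
  assume "(\<forall>n. u n \<in> X0) \<and> (\<exists>B. \<forall>n. nrm (u n) \<le> B)"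
  then obtain B where u: "\<And>n. u n \<in> X0" and B: "\<And>n. nrm (u n) \<le> B" by blast
  note [measurable] = X0_measurable[OF u]
  have B0: "B \<ge> 0" using order_trans[OF norm_X_nonneg B] u by blast
  obtain C where C: "C > 0" and C_le: "\<And>g. g \<in> X0 \<Longrightarrow> Lq_integral q' g \<le> ennreal ((C * nrm g) powr q')"
    using Lq_integral_le_norm[OF q0(2) bounded] by metis
  obtain C\<^sub>1 where C\<^sub>1: "C\<^sub>1 > 0" and C\<^sub>1_le: "\<And>g. g \<in> X0 \<Longrightarrow> Lq_integral q g \<le> ennreal ((C\<^sub>1 * nrm g) powr q)"
    using Lq_integral_le_norm[OF q0(1) bounded_q] by metis
  from L2_Cauchy_subsequence[of u B, OF u B unbounded]
  obtain r\<^sub>1 :: "nat \<Rightarrow> nat" where r\<^sub>1: "strict_mono r\<^sub>1" and Cauchy: "\<And>e. e > 0 \<Longrightarrow> \<exists>n\<^sub>0. \<forall>m\<ge>n\<^sub>0. \<forall>n\<ge>n\<^sub>0.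
       (\<integral>\<^sup>+x. ennreal ((u (r\<^sub>1 m) x - u (r\<^sub>1 n) x)\<^sup>2) \<partial>lebesgue) < ennreal e"
    by blast
  obtain r\<^sub>2 f where r\<^sub>2: "strict_mono r\<^sub>2" and f [measurable]: "f \<in> borel_measurable lebesgue"
    and lim: "AE x in lebesgue. (\<lambda>k. u (r\<^sub>1 (r\<^sub>2 k)) x) \<longlonglongrightarrow> f x"
    using AE_convergent_subseq_of_L2_Cauchy[of "\<lambda>n. u (r\<^sub>1 n)" lebesgue, OF _ Cauchy] by auto
  define r where "r = r\<^sub>1 \<circ> r\<^sub>2"
  have r: "strict_mono r" unfolding r_def by (intro strict_mono_o r\<^sub>1 r\<^sub>2)
  have lim_r: "AE x in lebesgue. (\<lambda>k. u (r k) x) \<longlonglongrightarrow> f x" using lim by (simp add: r_def)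
  define D where "D = measure lebesgue \<Omega> + (C * (2 * B)) powr q'"
  have D: "D \<ge> 0" by (simp add: D_def)
  have Lq_Cauchy: "\<exists>n\<^sub>0. \<forall>m\<ge>n\<^sub>0. \<forall>n\<ge>n\<^sub>0. Lq_integral q (\<lambda>x. u (r m) x - u (r n) x) \<le> ennreal e"
    if e: "e > 0" for e
  proof -
    \<comment> \<open>\<open>d\<close> makes the first term of the interpolation contribute at most \<open>e / 2\<close>, and \<open>n\<^sub>0\<close> the second\<close>
    define d where "d = e / (2 * (D + 1))"
    have d: "d > 0" using e D by (simp add: d_def)
    obtain A where A: "A \<ge> 0" "\<And>t. \<bar>t\<bar> powr q \<le> d * (1 + \<bar>t\<bar> powr q') + A * t\<^sup>2"
      using powr_interpolation[OF q0(1) q(2) d] by metis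
    from Cauchy[of "e / (2 * (A + 1))"] e A(1) obtain n\<^sub>0 where n\<^sub>0: "\<And>m n. m \<ge> n\<^sub>0 \<Longrightarrow> n \<ge> n\<^sub>0 \<Longrightarrow>
      (\<integral>\<^sup>+x. ennreal ((u (r\<^sub>1 m) x - u (r\<^sub>1 n) x)\<^sup>2) \<partial>lebesgue) < ennreal (e / (2 * (A + 1)))" by auto
    have "Lq_integral q (\<lambda>x. u (r m) x - u (r n) x) \<le> ennreal e" if mn: "m \<ge> n\<^sub>0" "n \<ge> n\<^sub>0" for m n
    proof -
      define w where "w x = u (r m) x - u (r n) x" for x
      have w: "w \<in> X0" unfolding w_def by (intro X0_diff u)
      note [measurable] = X0_measurable[OF w]
      have "(nrm w)\<^sup>2 \<le> 2 * (nrm (u (r m)))\<^sup>2 + 2 * (nrm (u (r n)))\<^sup>2"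
        unfolding w_def by (intro norm_X_diff_le u)
      also have "\<dots> \<le> 2 * B\<^sup>2 + 2 * B\<^sup>2"
        by (intro add_mono mult_left_mono power_mono B norm_X_nonneg u) auto
      also have "\<dots> = (2 * B)\<^sup>2" by (simp add: power2_eq_square)
      finally have nrm_w: "nrm w \<le> 2 * B" by (rule power2_le_imp_le) (use B0 in simp)
      have "Lq_integral q' w \<le> ennreal ((C * nrm w) powr q')" by (rule C_le[OF w])
      also have "\<dots> \<le> ennreal ((C * (2 * B)) powr q')"
        using C nrm_w norm_X_nonneg[OF w] q0 by (intro ennreal_leI powr_mono2 mult_left_mono) auto
      finally have w_q': "Lq_integral q' w \<le> ennreal ((C * (2 * B)) powr q')" .
      have w_2: "(\<integral>\<^sup>+x. ennreal ((w x)\<^sup>2) \<partial>lebesgue) \<le> ennreal (e / (2 * (A + 1)))"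
        using n\<^sub>0[of "r\<^sub>2 m" "r\<^sub>2 n"] mn seq_suble[OF r\<^sub>2, of m] seq_suble[OF r\<^sub>2, of n]
        by (simp add: w_def r_def less_imp_le)
      have "Lq_integral q w \<le> (\<integral>\<^sup>+x. ennreal d * (indicator \<Omega> x + ennreal (\<bar>w x\<bar> powr q') * indicator \<Omega> x) +
          ennreal A * ennreal ((w x)\<^sup>2) \<partial>lebesgue)"
        unfolding Lq_integral_def
      proof (rule nn_integral_mono)
        fix x
        have "ennreal (\<bar>w x\<bar> powr q) \<le> ennreal (d * (1 + \<bar>w x\<bar> powr q') + A * (w x)\<^sup>2)"
          by (rule ennreal_leI[OF A(2)])
        also have "\<dots> = ennreal d * (1 + ennreal (\<bar>w x\<bar> powr q')) + ennreal A * ennreal ((w x)\<^sup>2)"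
          using d A(1) by (simp add: ennreal_mult ennreal_plus)
        finally show "ennreal (\<bar>w x\<bar> powr q) * indicator \<Omega> x \<le>
            ennreal d * (indicator \<Omega> x + ennreal (\<bar>w x\<bar> powr q') * indicator \<Omega> x) + ennreal A * ennreal ((w x)\<^sup>2)"
          by (simp add: indicator_def)
      qed
      also have "\<dots> = ennreal d * (emeasure lebesgue \<Omega> + Lq_integral q' w) + ennreal A * (\<integral>\<^sup>+x. ennreal ((w x)\<^sup>2) \<partial>lebesgue)"
        unfolding Lq_integral_def by (simp add: nn_integral_add nn_integral_cmult)
      also have "\<dots> \<le> ennreal d * (ennreal (measure lebesgue \<Omega>) + ennreal ((C * (2 * B)) powr q')) + ennreal A * ennreal (e / (2 * (A + 1)))"
        unfolding measure_domain_finite by (intro add_mono mult_left_mono w_q' w_2 order_refl) auto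
      also have "\<dots> = ennreal (d * D + A * (e / (2 * (A + 1))))"
      proof -
        have "e / (2 * (A + 1)) \<ge> 0" using A(1) e by simp
        then show ?thesis
          using d A(1) unfolding D_def
          by (simp only: ennreal_plus ennreal_mult measure_nonneg powr_ge_zero add_nonneg_nonneg
              mult_nonneg_nonneg less_imp_le)
      qed
      also have "\<dots> \<le> ennreal e"
      proof (rule ennreal_leI)
        have "d * D \<le> e / 2" using D e by (simp add: d_def field_simps)
        moreover have "A * (e / (2 * (A + 1))) \<le> e / 2" using A(1) e by (simp add: field_simps)
        ultimately show "d * D + A * (e / (2 * (A + 1))) \<le> e" by linarith
      qed
      finally show ?thesis by (simp add: w_def[abs_def])
    qed
    then show ?thesis by blast
  qed
  have close: "\<exists>n\<^sub>0. \<forall>n\<ge>n\<^sub>0. Lq_integral q (\<lambda>x. u (r n) x - f x) \<le> ennreal e" if e: "e > 0" for e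
  proof -
    from Lq_Cauchy[OF e] obtain n\<^sub>0 where n\<^sub>0: "\<And>m n. m \<ge> n\<^sub>0 \<Longrightarrow> n \<ge> n\<^sub>0 \<Longrightarrow>
        Lq_integral q (\<lambda>x. u (r m) x - u (r n) x) \<le> ennreal e" by blast
    have "Lq_integral q (\<lambda>x. u (r n) x - f x) \<le> ennreal e" if n: "n \<ge> n\<^sub>0" for n
    proof (rule Lq_integral_Fatou[where v = "\<lambda>k x. u (r n) x - u (r (k + n\<^sub>0)) x", OF _ q0(1)])
      show "AE x in lebesgue. (\<lambda>k. u (r n) x - u (r (k + n\<^sub>0)) x) \<longlonglongrightarrow> u (r n) x - f x"
        using lim_r by eventually_elim (intro tendsto_diff tendsto_const LIMSEQ_ignore_initial_segment)
      show "Lq_integral q (\<lambda>x. u (r n) x - u (r (k + n\<^sub>0)) x) \<le> ennreal e" for k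
        using n by (intro n\<^sub>0) auto
    qed measurable
    then show ?thesis by blast
  qed
  show "\<exists>f\<in>space_L (ereal q) \<Omega>. \<exists>\<phi>. strict_mono \<phi> \<and>
      (\<lambda>n. norm_L (ereal q) \<Omega> (\<lambda>x. u (\<phi> n) x - f x)) \<longlonglongrightarrow> 0"
  proof (intro bexI exI conjI)
    have "Lq_integral q f \<le> ennreal ((C\<^sub>1 * B) powr q)"
    proof (rule Lq_integral_Fatou[where v = "\<lambda>k. u (r k)", OF _ q0(1) lim_r])
      fix n
      have "(C\<^sub>1 * nrm (u (r n))) powr q \<le> (C\<^sub>1 * B) powr q"
        using C\<^sub>1 B norm_X_nonneg[OF u] q0 by (intro powr_mono2 mult_left_mono) auto
      then show "Lq_integral q (u (r n)) \<le> ennreal ((C\<^sub>1 * B) powr q)"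
        using C\<^sub>1_le[OF u, of "r n"] by (meson ennreal_leI order_trans)
    qed measurable
    then show "f \<in> space_L (ereal q) \<Omega>"
      using C\<^sub>1 B0 by (intro space_L_norm_L_le(1)[OF f q0(1), of "C\<^sub>1 * B"]) auto
    show "strict_mono r" by (rule r)
    show "(\<lambda>n. norm_L (ereal q) \<Omega> (\<lambda>x. u (r n) x - f x)) \<longlonglongrightarrow> 0"
    proof (rule LIMSEQ_I)
      fix e :: real assume e: "e > 0"
      from close[of "(e / 2) powr q"] e obtain n\<^sub>0 where n\<^sub>0: "\<And>n. n \<ge> n\<^sub>0 \<Longrightarrow>
          Lq_integral q (\<lambda>x. u (r n) x - f x) \<le> ennreal ((e / 2) powr q)" by auto
      have "norm (norm_L (ereal q) \<Omega> (\<lambda>x. u (r n) x - f x) - 0) < e" if "n \<ge> n\<^sub>0" for n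
      proof -
        have "norm_L (ereal q) \<Omega> (\<lambda>x. u (r n) x - f x) \<le> e / 2"
          using e by (intro space_L_norm_L_le(2)[OF _ q0(1) _ n\<^sub>0[OF that]]) measurable
        moreover have "norm_L (ereal q) \<Omega> (\<lambda>x. u (r n) x - f x) \<ge> 0"
          by (simp add: norm_L_def)
        ultimately show ?thesis using e by simp
      qed
      then show "\<exists>no. \<forall>n\<ge>no. norm (norm_L (ereal q) \<Omega> (\<lambda>x. u (r n) x - f x) - 0) < e" by blast
    qed
  qed
qed

end

section \<open>The order of the kernel\<close>

lemma kernel_tail_ge_of_scaled_tail:
  assumes "r > 0" "ennreal c \<le> scaled_tail K s r"
  shows "ennreal (c * r powr (- (2 * s))) \<le> kernel_tail K r"
proof -
  have one: "ennreal (r powr (- (2 * s))) * ennreal (r powr (2 * s)) = 1"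
    using \<open>r > 0\<close> by (simp flip: ennreal_mult powr_add)
  have "ennreal (c * r powr (- (2 * s))) = ennreal (r powr (- (2 * s))) * ennreal c"
    by (simp add: mult.commute[of c] ennreal_mult')
  also have "\<dots> \<le> ennreal (r powr (- (2 * s))) * (ennreal (r powr (2 * s)) * kernel_tail K r)"
    using assms(2) unfolding scaled_tail_def by (intro mult_left_mono) auto
  also have "\<dots> = kernel_tail K r"
    by (simp add: mult.assoc[symmetric] one)
  finally show ?thesis .
qed

text \<open>Some $s'>s$ belongs to the set whose supremum is the order, and $r^{-2s'}\ge r^{-2s}$ for $r\le1$.\<close>

lemma kernel_tail_growth_below_order:
  assumes order: "kernel_order K = ereal s\<^sub>0" and "s < s\<^sub>0"
  obtains r\<^sub>0 where "r\<^sub>0 > 0" "\<And>r. 0 < r \<Longrightarrow> r \<le> r\<^sub>0 \<Longrightarrow> ennreal (1 * r powr (- (2 * s))) \<le> kernel_tail K r"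
proof -
  have "ereal s < Sup (ereal ` {s. s \<ge> 0 \<and> (scaled_tail K s \<longlongrightarrow> \<infinity>) (at_right 0)})"
    using order \<open>s < s\<^sub>0\<close> unfolding kernel_order_def by simp
  then obtain s' where s': "s < s'" "(scaled_tail K s' \<longlongrightarrow> \<infinity>) (at_right 0)"
    unfolding less_Sup_iff by auto
  have "eventually (\<lambda>r. 1 < scaled_tail K s' r) (at_right 0)"
    by (rule order_tendstoD(1)[OF s'(2)]) simp
  then obtain b where b: "b > 0" "\<And>r. 0 < r \<Longrightarrow> r < b \<Longrightarrow> 1 < scaled_tail K s' r"
    unfolding eventually_at_right_field by auto
  show thesis
  proof (rule that[of "min 1 (b / 2)"])
    show "min 1 (b / 2) > 0" using b by simp
    fix r :: real assume r: "0 < r" "r \<le> min 1 (b / 2)"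
    have "ennreal 1 \<le> scaled_tail K s' r" using b r by (auto intro: less_imp_le)
    from kernel_tail_ge_of_scaled_tail[OF r(1) this]
    have "ennreal (r powr (- (2 * s'))) \<le> kernel_tail K r" by simp
    moreover have "r powr (- (2 * s)) \<le> r powr (- (2 * s'))"
      using r s' by (intro powr_mono') auto
    ultimately show "ennreal (1 * r powr (- (2 * s))) \<le> kernel_tail K r"
      by (auto intro: order_trans ennreal_leI)
  qed
qed

lemma kernel_tail_growth_at_order:
  assumes "0 < Liminf (at_right 0) (scaled_tail K s)"
  obtains c r\<^sub>0 where "c > 0" "r\<^sub>0 > 0"
    "\<And>r. 0 < r \<Longrightarrow> r \<le> r\<^sub>0 \<Longrightarrow> ennreal (c * r powr (- (2 * s))) \<le> kernel_tail K r"
proof -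
  from assms obtain a where a: "0 < a" "a < Liminf (at_right 0) (scaled_tail K s)"
    using dense by blast
  then obtain c where c: "a = ennreal c" "c > 0"
    by (cases a) (auto simp: ennreal_less_zero_iff)
  have "eventually (\<lambda>r. ennreal c < scaled_tail K s r) (at_right 0)"
    using a(2) unfolding c(1) by (rule less_LiminfD)
  then obtain b where b: "b > 0" "\<And>r. 0 < r \<Longrightarrow> r < b \<Longrightarrow> ennreal c < scaled_tail K s r"
    unfolding eventually_at_right_field by auto
  show thesis
  proof (rule that[OF c(2), of "b / 2"])
    show "b / 2 > 0" using b by simp
    fix r assume r: "0 < r" "r \<le> b / 2"
    then have "ennreal c < scaled_tail K s r" using b by simp
    then show "ennreal (c * r powr (- (2 * s))) \<le> kernel_tail K r"
      by (intro kernel_tail_ge_of_scaled_tail r less_imp_le)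
  qed
qed

context radial_kernel begin

text \<open>The tail is $o(r^{-2})$ as \<open>r\<close> tends to zero, by dominated convergence, so it admits no lower bound of
  order $r^{-2}$.\<close>

lemma kernel_tail_not_quadratic:
  assumes c: "c > 0" and r\<^sub>0: "r\<^sub>0 > 0"
    and tail: "\<And>r. 0 < r \<Longrightarrow> r \<le> r\<^sub>0 \<Longrightarrow> ennreal (c * r powr (- (2 * 1))) \<le> kernel_tail K r"
  shows False
proof -
  define \<rho> where "\<rho> n = 1 / (real n + 1)" for n
  have \<rho>: "0 < \<rho> n" "\<rho> n \<le> 1" for n by (auto simp: \<rho>_def)
  have \<rho>0: "\<rho> \<longlonglongrightarrow> 0"
    unfolding \<rho>_def using LIMSEQ_inverse_real_of_nat by (simp add: inverse_eq_divide add.commute)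
  define f where "f n y = ennreal ((\<rho> n)\<^sup>2 * K y) * indicator (- ball 0 (\<rho> n)) y" for n y
  have [measurable]: "f n \<in> borel_measurable borel" for n unfolding f_def by measurable
  define w where "w y = ennreal (min ((norm y)\<^sup>2) 1 * K y)" for y
  have [measurable]: "w \<in> borel_measurable borel" unfolding w_def by measurable
  have "(\<lambda>n. \<integral>\<^sup>+y. f n y \<partial>lborel) \<longlonglongrightarrow> (\<integral>\<^sup>+y. 0 \<partial>(lborel :: 'a measure))"
  proof (rule nn_integral_dominated_convergence[where w = w])
    show "AE y in lborel. f n y \<le> w y" for n
    proof (rule AE_I2)
      fix y :: 'a
      have "(\<rho> n)\<^sup>2 \<le> min ((norm y)\<^sup>2) 1" if "\<rho> n \<le> norm y"
        using that \<rho>[of n] power_mono[of "\<rho> n" "norm y" 2] power_mono[of "\<rho> n" 1 2] by simp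
      then show "f n y \<le> w y"
        by (auto simp: f_def w_def indicator_def intro!: ennreal_leI mult_right_mono)
    qed
    have "(\<integral>\<^sup>+y. w y \<partial>lborel) = (\<integral>\<^sup>+y. w y \<partial>lebesgue)" by (simp add: nn_integral_completion)
    also have "\<dots> < \<infinity>"
      using K_integrable unfolding integrable_iff_bounded w_def by (auto simp: abs_mult)
    finally show "(\<integral>\<^sup>+y. w y \<partial>lborel) < \<infinity>" .
    show "AE y in lborel. (\<lambda>n. f n y) \<longlonglongrightarrow> 0"
    proof (rule AE_I2)
      fix y :: 'a
      have "(\<lambda>n. ennreal ((\<rho> n)\<^sup>2 * K y)) \<longlonglongrightarrow> ennreal (0\<^sup>2 * K y)"
        by (intro tendsto_ennrealI tendsto_mult tendsto_power \<rho>0 tendsto_const)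
      then have lim: "(\<lambda>n. ennreal ((\<rho> n)\<^sup>2 * K y)) \<longlonglongrightarrow> 0" by simp
      show "(\<lambda>n. f n y) \<longlonglongrightarrow> 0"
        by (rule tendsto_sandwich[OF _ _ tendsto_const lim]) (auto simp: f_def indicator_def)
    qed
  qed measurable
  then have "(\<lambda>n. \<integral>\<^sup>+y. f n y \<partial>lborel) \<longlonglongrightarrow> 0" by simp
  then have "eventually (\<lambda>n. (\<integral>\<^sup>+y. f n y \<partial>lborel) < ennreal c) sequentially"
    using c by (intro order_tendstoD(2)) auto
  moreover have "eventually (\<lambda>n. \<rho> n < r\<^sub>0) sequentially"
    using \<rho>0 r\<^sub>0 by (rule order_tendstoD(2))
  ultimately have "eventually (\<lambda>n. False) sequentially"
  proof eventually_elim
    case (elim n)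
    have "ennreal c = ennreal ((\<rho> n)\<^sup>2) * ennreal (c * \<rho> n powr (- (2 * 1)))"
      using \<rho>[of n] c by (simp add: powr_minus field_simps flip: ennreal_mult)
    also have "\<dots> \<le> ennreal ((\<rho> n)\<^sup>2) * kernel_tail K (\<rho> n)"
      using elim \<rho>[of n] by (intro mult_left_mono tail) auto
    also have "\<dots> = (\<integral>\<^sup>+y. f n y \<partial>lborel)"
      unfolding kernel_tail_eq f_def
      by (subst nn_integral_cmult[symmetric]) (auto simp: ennreal_mult mult.assoc)
    finally show False using elim by simp
  qed
  then show False by simp
qed

end

context nonlocal_space begin

lemma Lq_bounded_of_tail:
  assumes s: "s > 0" "2 * s < real DIM('a)" and "c > 0" "r\<^sub>0 > 0"
    and tail: "\<And>r. 0 < r \<Longrightarrow> r \<le> r\<^sub>0 \<Longrightarrow> ennreal (c * r powr (- (2 * s))) \<le> kernel_tail K r"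
  shows "Lq_bounded (2 * real DIM('a) / (real DIM('a) - 2 * s))"
  unfolding Lq_bounded_def Lq_integral_def
  by (rule sobolev_inequality[OF s \<open>c > 0\<close> \<open>r\<^sub>0 > 0\<close> tail]) blast+

lemma subcritical_embeddings:
  assumes order: "kernel_order K = ereal s\<^sub>0" and s\<^sub>0: "0 < s\<^sub>0" "2 * s\<^sub>0 \<le> real DIM('a)"
    and q: "1 \<le> q" "q < critical_exponent DIM('a) s\<^sub>0"
  shows "continuous_embedding_L X0 nrm q \<Omega>"
    and "compact_embedding_L X0 nrm q \<Omega>"
    and "\<exists>C>0. \<forall>g\<in>X0. norm_L q \<Omega> g \<le> C * nrm g"
proof -
  define N where "N = real DIM('a)"
  have N: "N > 0" by (simp add: N_def)
  obtain p where p: "q = ereal p" "1 \<le> p"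
    using q by (cases q) auto
  \<comment> \<open>the exponent belonging to \<open>s\<close> exceeds \<open>p\<close> iff \<open>s\<close> exceeds \<open>N / 2 - N / p\<close>\<close>
  have gap: "N / 2 - N / p < s\<^sub>0"
  proof (cases "N = 2 * s\<^sub>0")
    case True
    then show ?thesis using p N by simp
  next
    case False
    then have "p < 2 * N / (N - 2 * s\<^sub>0)" "N - 2 * s\<^sub>0 > 0"
      using q s\<^sub>0 by (auto simp: p critical_exponent_def N_def)
    then show ?thesis using p by (simp add: field_simps)
  qed
  define s where "s = (max 0 (N / 2 - N / p) + s\<^sub>0) / 2"
  have s: "0 < s" "s < s\<^sub>0" "N / 2 - N / p < s" "2 * s < N"
    using gap s\<^sub>0 by (auto simp: s_def N_def max_def)
  have p_less: "p < 2 * N / (N - 2 * s)"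
    using s p by (simp add: field_simps)
  obtain r\<^sub>0 where r\<^sub>0: "r\<^sub>0 > 0"
    "\<And>r. 0 < r \<Longrightarrow> r \<le> r\<^sub>0 \<Longrightarrow> ennreal (1 * r powr (- (2 * s))) \<le> kernel_tail K r"
    using kernel_tail_growth_below_order[OF order s(2)] by metis
  have bounded: "Lq_bounded (2 * N / (N - 2 * s))"
    using s r\<^sub>0 unfolding N_def by (intro Lq_bounded_of_tail[of s 1 r\<^sub>0]) auto
  have unbounded: "\<exists>t>0. \<forall>z. z \<noteq> 0 \<longrightarrow> norm z \<le> t \<longrightarrow> M \<le> t ^ DIM('a) * K z" for M
    by (rule scaled_kernel_unbounded[OF s(1) zero_less_one r\<^sub>0]) blast+
  have bounded_p: "Lq_bounded p"
    using Lq_bounded_mono[OF _ _ bounded, of p] p p_less by simp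
  show "continuous_embedding_L X0 nrm q \<Omega>" "\<exists>C>0. \<forall>g\<in>X0. norm_L q \<Omega> g \<le> C * nrm g"
    unfolding p(1) by (rule continuous_embedding[OF p(2) bounded_p])+
  show "compact_embedding_L X0 nrm q \<Omega>"
    unfolding p(1) by (rule compact_embedding[OF p(2) p_less bounded unbounded])
qed

text \<open>Here the order cannot be one, so the critical exponent is finite even in dimension two.\<close>

lemma critical_embeddings:
  assumes s\<^sub>0: "0 < s\<^sub>0" "s\<^sub>0 \<le> 1" and N: "DIM('a) \<ge> 2"
    and l_inf: "0 < Liminf (at_right 0) (scaled_tail K s\<^sub>0)"
    and q: "1 \<le> q" "q \<le> critical_exponent DIM('a) s\<^sub>0"
  shows "continuous_embedding_L X0 nrm q \<Omega>"
    and "\<exists>C>0. \<forall>g\<in>X0. norm_L q \<Omega> g \<le> C * nrm g"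
proof -
  obtain c r\<^sub>0 where c: "c > 0" "r\<^sub>0 > 0" and
    tail: "\<And>r. 0 < r \<Longrightarrow> r \<le> r\<^sub>0 \<Longrightarrow> ennreal (c * r powr (- (2 * s\<^sub>0))) \<le> kernel_tail K r"
    using kernel_tail_growth_at_order[OF l_inf] by metis
  have "s\<^sub>0 \<noteq> 1" using kernel_tail_not_quadratic[OF c] tail by blast
  then have s\<^sub>0': "2 * s\<^sub>0 < real DIM('a)" using s\<^sub>0 N by linarith
  then have crit: "critical_exponent DIM('a) s\<^sub>0 = ereal (2 * real DIM('a) / (real DIM('a) - 2 * s\<^sub>0))"
    by (simp add: critical_exponent_def)
  obtain p where p: "q = ereal p" "1 \<le> p" "p \<le> 2 * real DIM('a) / (real DIM('a) - 2 * s\<^sub>0)"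
    using q unfolding crit by (cases q) auto
  have bounded: "Lq_bounded p"
    using Lq_bounded_mono[OF _ p(3) Lq_bounded_of_tail[OF s\<^sub>0(1) s\<^sub>0' c tail]] p by simp
  show "continuous_embedding_L X0 nrm q \<Omega>" "\<exists>C>0. \<forall>g\<in>X0. norm_L q \<Omega> g \<le> C * nrm g"
    unfolding p(1) by (rule continuous_embedding[OF p(2) bounded])+
qed

end

text \<open>The value of the kernel at the origin is irrelevant, so it may be replaced by zero.\<close>

lemma kernel_at_origin_irrelevant:
  fixes K :: "'a::euclidean_space \<Rightarrow> real"
  defines "K\<^sub>0 \<equiv> \<lambda>x. if x = 0 then 0 else K x"
  shows "space_X0 \<Omega> K = space_X0 \<Omega> K\<^sub>0" "norm_X \<Omega> K = norm_X \<Omega> K\<^sub>0" "inner_X \<Omega> K = inner_X \<Omega> K\<^sub>0"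
    "scaled_tail K = scaled_tail K\<^sub>0" "kernel_order K = kernel_order K\<^sub>0"
proof -
  have inner: "(\<lambda>(x, y). (f x - f y) * (g x - g y) * K (x - y)) =
      (\<lambda>(x, y). (f x - f y) * (g x - g y) * K\<^sub>0 (x - y))" for f g :: "'a \<Rightarrow> real"
    by (auto simp: K\<^sub>0_def fun_eq_iff)
  have square: "(\<lambda>(x, y). (g x - g y)\<^sup>2 * K (x - y)) = (\<lambda>(x, y). (g x - g y)\<^sup>2 * K\<^sub>0 (x - y))"
    for g :: "'a \<Rightarrow> real"
    by (auto simp: K\<^sub>0_def fun_eq_iff)
  show "space_X0 \<Omega> K = space_X0 \<Omega> K\<^sub>0" unfolding space_X0_def space_X_def square ..
  show "norm_X \<Omega> K = norm_X \<Omega> K\<^sub>0" unfolding norm_X_def square ..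
  show "inner_X \<Omega> K = inner_X \<Omega> K\<^sub>0" unfolding inner_X_def inner ..
  have "AE y in lebesgue. y \<noteq> (0::'a)"
    by (intro AE_completion AE_lborel_singleton)
  then have "kernel_tail K r = kernel_tail K\<^sub>0 r" for r
    unfolding kernel_tail_def by (intro nn_integral_cong_AE, eventually_elim) (simp add: K\<^sub>0_def)
  then show tail: "scaled_tail K = scaled_tail K\<^sub>0"
    by (simp add: scaled_tail_def fun_eq_iff)
  show "kernel_order K = kernel_order K\<^sub>0" unfolding kernel_order_def tail ..
qed

theorem theorem1p1:
  fixes \<Omega> :: "(real ^ 'n) set"
    and K :: "real ^ 'n \<Rightarrow> real"
    and s\<^sub>0 :: real
    and l_inf :: ennreal
  assumes "CARD('n) \<ge> 2"
    and "bounded_C2_domain \<Omega>"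
    and "K \<in> borel_measurable lebesgue"
    and "\<And>x. x \<noteq> 0 \<Longrightarrow> K x > 0"
    and "integrable lebesgue (\<lambda>x. min ((norm x)\<^sup>2) 1 * K x)"
    and "\<And>x y. x \<noteq> 0 \<Longrightarrow> y \<noteq> 0 \<Longrightarrow> norm x \<le> norm y \<Longrightarrow> K x \<ge> K y"
    and "kernel_order K = ereal s\<^sub>0"
    and "0 < s\<^sub>0" and "s\<^sub>0 \<le> 1"
    and "l_inf = Liminf (at_right 0) (scaled_tail K s\<^sub>0)"
  shows
    "hilbert_space_mod_AE (space_X0 \<Omega> K) (inner_X \<Omega> K) (norm_X \<Omega> K) \<and>
     (l_inf = 0 \<longrightarrow>
       (\<forall>q. 1 \<le> q \<and> q < critical_exponent CARD('n) s\<^sub>0 \<longrightarrow>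
          continuous_embedding_L (space_X0 \<Omega> K) (norm_X \<Omega> K) q \<Omega> \<and>
          compact_embedding_L (space_X0 \<Omega> K) (norm_X \<Omega> K) q \<Omega> \<and>
          (\<exists>C>0. \<forall>g\<in>space_X0 \<Omega> K. norm_L q \<Omega> g \<le> C * norm_X \<Omega> K g))) \<and>
     (0 < l_inf \<longrightarrow>
       (\<forall>q. 1 \<le> q \<and> q \<le> critical_exponent CARD('n) s\<^sub>0 \<longrightarrow>
          continuous_embedding_L (space_X0 \<Omega> K) (norm_X \<Omega> K) q \<Omega> \<and>
          (\<exists>C>0. \<forall>g\<in>space_X0 \<Omega> K. norm_L q \<Omega> g \<le> C * norm_X \<Omega> K g)) \<and>
       (\<forall>q. 1 \<le> q \<and> q < critical_exponent CARD('n) s\<^sub>0 \<longrightarrow>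
          compact_embedding_L (space_X0 \<Omega> K) (norm_X \<Omega> K) q \<Omega>))"
proof -
  define K\<^sub>0 where "K\<^sub>0 x = (if x = 0 then 0 else K x)" for x
  have K\<^sub>0_eq: "K\<^sub>0 = (\<lambda>x. if x = 0 then 0 else K x)" by (simp add: K\<^sub>0_def fun_eq_iff)
  note K_K\<^sub>0 = kernel_at_origin_irrelevant[where K = K, folded K\<^sub>0_eq]
  interpret nonlocal_space K\<^sub>0 \<Omega>
  proof
    show "K\<^sub>0 0 = 0" by (simp add: K\<^sub>0_def)
    show "K\<^sub>0 x > 0" if "x \<noteq> 0" for x using assms(4) that by (simp add: K\<^sub>0_def)
    show "K\<^sub>0 x \<ge> K\<^sub>0 y" if "x \<noteq> 0" "y \<noteq> 0" "norm x \<le> norm y" for x y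
      using assms(6) that by (simp add: K\<^sub>0_def)
    have "(\<lambda>x. min ((norm x)\<^sup>2) 1 * K x) = (\<lambda>x. min ((norm x)\<^sup>2) 1 * K\<^sub>0 x)"
      by (auto simp: K\<^sub>0_def fun_eq_iff)
    then show "integrable lebesgue (\<lambda>x. min ((norm x)\<^sup>2) 1 * K\<^sub>0 x)" using assms(5) by simp
    show "open \<Omega>" "bounded \<Omega>" using assms(2) by (auto simp: bounded_C2_domain_def)
  qed
  have N: "DIM(real ^ 'n) = CARD('n)" by simp
  have s\<^sub>0: "2 * s\<^sub>0 \<le> real DIM(real ^ 'n)" using assms(1,9) by simp
  note order = assms(7)[unfolded K_K\<^sub>0]
  note sub = subcritical_embeddings[OF order assms(8) s\<^sub>0, unfolded N]
  note crit = critical_embeddings[OF assms(8,9), unfolded N, OF assms(1)]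
  show ?thesis
    unfolding K_K\<^sub>0 assms(10)
    using hilbert_space_X0 sub crit by blast
qed

end
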